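(* Let $\eta\ge 0$ and let $\{A_n\}$ be the dielectric-breakdown model with parameter $\eta$ (DBM-$\eta$) on $\mathbb{Z}^3$. Then: 1. If $\eta\ge 1$, there exists a constant $C>0$ (which may depend on $\eta$) such that with probability $1$ there exists $N$ such that for all $n>N$ $$\mathrm{R}(A_n)<C\,n^{\frac{\eta}{1+\eta}}(\log n)^{\frac{\eta}{2(\eta+1)}}.$$ 2. If $\eta<1$, there exists a constant $C>0$ (which may depend on $\eta$) such that with probability $1$ there exists $N$ such that for all $n>N$ $$\mathrm{R}(A_n)<C\,n^{1/2}(\log n)^{1/4}.$$
   Context: Work on the lattice $\mathbb{Z}^d$ (here $d=3$) with nearest-neighbour adjacency $x\sim y$. For $A\subset\mathbb{Z}^d$ put $\partial A=\{y\in\mathbb{Z}^d: y\notin A,\ \exists x\in A,\ x\sim y\}$ (outer boundary) and $\overline{A}=A\cup\partial A$. The radius of a finite nonempty set $A$ is $\mathrm{R}(A)=\max_{x\in A}|x|$, with $|\cdot|$ the Euclidean norm. For a finite nonempty $X\subset\mathbb{Z}^d$ and $y\in X$, the harmonic measure from infinity $\omega(y,X)$ is the probability that a simple random walk started infinitely far away, conditioned on hitting $X$, first hits $X$ at $y$; that is, $\omega(y,X)=\lim_{|x|\to\infty}\mathbb{P}^x[S(T_X)=y\mid T_X<\infty]$, where $S$ is simple random walk on $\mathbb{Z}^d$ started at $x$ under $\mathbb{P}^x$ and $T_X=\min\{j>0:S(j)\in X\}$. The dielectric-breakdown model with parameter $\eta\ge 0$ (DBM-$\eta$) on $\mathbb{Z}^d$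 is the Markov chain $\{A_n\}_{n\ge0}$ of finite connected subsets of $\mathbb{Z}^d$ with $A_0=\{0\}$ and $$\mathbb{P}[A_{n+1}=A_n\cup\{y\}\mid A_n]=\frac{\omega(y,\overline{A_n})^{\eta}}{\sum_{z\in\partial A_n}\omega(z,\overline{A_n})^{\eta}},\qquad y\in\partial A_n,$$ with the convention $0^0=1$ when $\eta=0$. *)

theory Defs
  imports "HOL-Probability.Probability"
begin

text \<open>The lattice \<open>\<int>\<^sup>d\<close> is the type \<open>int ^ 'd\<close>, with \<open>CARD('d) = d\<close>.\<close>

definition adj :: "int ^ 'd \<Rightarrow> int ^ 'd \<Rightarrow> bool" where
  "adj x y \<longleftrightarrow> (\<Sum>i\<in>UNIV. \<bar>x $ i - y $ i\<bar>) = 1"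

definition outer_boundary :: "(int ^ 'd) set \<Rightarrow> (int ^ 'd) set" where
  "outer_boundary A = {y. y \<notin> A \<and> (\<exists>x\<in>A. adj x y)}"

definition lattice_closure :: "(int ^ 'd) set \<Rightarrow> (int ^ 'd) set" where
  "lattice_closure A = A \<union> outer_boundary A"

definition lattice_connected :: "(int ^ 'd) set \<Rightarrow> bool" where
  "lattice_connected A \<longleftrightarrow>
     (\<forall>x\<in>A. \<forall>y\<in>A. (x, y) \<in> {(u, v). u \<in> A \<and> v \<in> A \<and> adj u v}\<^sup>*)"

definition euclidean_norm :: "int ^ 'd \<Rightarrow> real" where
  "euclidean_norm x = norm (\<chi> i. real_of_int (x $ i))"

definition radius :: "(int ^ 'd) set \<Rightarrow> real" where
  "radius A = Max (euclidean_norm ` A)"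

text \<open>Simple random walk: \<open>srw_steps\<close> is the law of an i.i.d. sequence of uniformly chosen
  unit steps; under it, \<open>srw x\<close> is the walk started at \<open>x\<close>.\<close>

definition srw_steps :: "(nat \<Rightarrow> int ^ 'd) measure" where
  "srw_steps = (\<Pi>\<^sub>M i\<in>(UNIV :: nat set). measure_pmf (pmf_of_set {e. adj 0 e}))"

definition srw :: "int ^ 'd \<Rightarrow> (nat \<Rightarrow> int ^ 'd) \<Rightarrow> nat \<Rightarrow> int ^ 'd" where
  "srw x s n = x + (\<Sum>i<n. s i)"

definition hits :: "(int ^ 'd) set \<Rightarrow> (nat \<Rightarrow> int ^ 'd) \<Rightarrow> bool" where
  "hits X S \<longleftrightarrow> (\<exists>j>0. S j \<in> X)"

text \<open>Only meaningful for paths that satisfy \<open>hits X S\<close>.\<close>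

definition hitting_time :: "(int ^ 'd) set \<Rightarrow> (nat \<Rightarrow> int ^ 'd) \<Rightarrow> nat" where
  "hitting_time X S = (LEAST j. 0 < j \<and> S j \<in> X)"

definition harmonic_measure :: "int ^ 'd \<Rightarrow> (int ^ 'd) set \<Rightarrow> real" where
  "harmonic_measure y X =
     Lim (filtercomap euclidean_norm at_top)
       (\<lambda>x. \<P>(s in srw_steps. srw x s (hitting_time X (srw x s)) = y \<bar> hits X (srw x s)))"

text \<open>The case split implements the convention \<open>0\<^sup>0 = 1\<close>, whereas \<open>0 powr 0 = 0\<close>.\<close>

definition dbm_weight :: "real \<Rightarrow> (int ^ 'd) set \<Rightarrow> int ^ 'd \<Rightarrow> real" where
  "dbm_weight \<eta> A y =
     (if \<eta> = 0 then 1 else harmonic_measure y (lattice_closure A) powr \<eta>)"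

text \<open>\<open>is_dbm \<eta> M A\<close>: on the probability space \<open>M\<close>, the process \<open>A\<close> is a Markov chain of finite
  connected sets, started at \<open>{0}\<close>, with the DBM transition probabilities. The Markov property
  is built in by conditioning on every history \<open>a 0, \<dots>, a n\<close> of positive probability.\<close>

definition is_dbm :: "real \<Rightarrow> 'w measure \<Rightarrow> (nat \<Rightarrow> 'w \<Rightarrow> (int ^ 'd) set) \<Rightarrow> bool" where
  "is_dbm \<eta> M A \<longleftrightarrow>
     prob_space M \<and>
     (\<forall>n. A n \<in> M \<rightarrow>\<^sub>M count_space {X. finite X \<and> lattice_connected X}) \<and>
     (\<forall>w\<in>space M. A 0 w = {0}) \<and>
     (\<forall>n a. \<P>(w in M. \<forall>i\<le>n. A i w = a i) > 0 \<longrightarrow>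
        (\<forall>y\<in>outer_boundary (a n).
           \<P>(w in M. A (Suc n) w = a n \<union> {y} \<bar> \<forall>i\<le>n. A i w = a i) =
             dbm_weight \<eta> (a n) y / (\<Sum>z\<in>outer_boundary (a n). dbm_weight \<eta> (a n) z)))"

end

theory Submission
  imports Defs "HOL-Real_Asymp.Real_Asymp"
begin

text \<open>
  Why the cluster cannot spread fast. A site \<open>y\<close> that joins a cluster \<open>A\<close> is chosen with a probability that
  is controlled by its harmonic measure in the closure of \<open>A\<close>. The theorem rests on a discrete Beurling
  estimate in three dimensions (\<open>beurling_estimate\<close>): in a finite connected set that reaches distance \<open>n\<close>
  from \<open>y\<close>, the harmonic measure of \<open>y\<close> is at most \<open>C * sqrt (ln n) / n\<close>. So an arm that wants to grow from
  radius \<open>2 * l\<close> to radius \<open>3 * l\<close> needs \<open>l\<close> successive adjacent sites, each of which is added with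
  probability at most \<open>q\<close> per step, where \<open>q\<close> is the bound on the transition probability at radius \<open>l\<close>. The
  expected number of arms of length \<open>l\<close> completed by time \<open>m\<close> is at most about \<open>l ^ 3 * (6 e m q / l) ^ l\<close>
  (\<open>prob_radius\<close>), which is exponentially small in \<open>l\<close> as soon as \<open>l\<close> exceeds a large multiple of \<open>m q\<close>.
  For \<open>\<eta> < 1\<close> one gets \<open>q = C sqrt (ln l) / l\<close>; for \<open>\<eta> \<ge> 1\<close> convexity costs a factor
  \<open>m powr (\<eta> - 1)\<close> and \<open>q = C m powr (\<eta> - 1) * (sqrt (ln l) / l) powr \<eta>\<close>. Solving \<open>l = C m q\<close>
  gives the two scales of the theorem, and the bounds are summable in \<open>m\<close>, so Borel-Cantelli finishes.

  The Beurling estimate. The harmonic measure of \<open>y\<close> is the equilibrium charge of \<open>y\<close>, that is its escape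
  probability, divided by the capacity (\<open>harmonic_measure_eq\<close>), and it decreases when the set grows. It
  therefore suffices to treat a chain \<open>x 0 = y, x 1, x 2, ...\<close> with one point in each spherical shell around
  \<open>y\<close>. The capacity of such a chain up to \<open>n\<close> is at least \<open>c n / ln n\<close>, because the Green function decays like
  the inverse distance. The escape probability from the tip \<open>y\<close> is at most \<open>C / sqrt (ln n)\<close>. To see this,
  put mass \<open>F 0\<close> at \<open>y\<close> and mass \<open>- (F (j - 1) - F j)\<close> at \<open>x j\<close>, where \<open>F j = 1 / sqrt (ln (j + 1) + s)\<close>. If
  the potential of this signed measure is nonnegative on the chain and bounded below at \<open>y\<close>, pairing it with
  the equilibrium charge shows that the escape probability is at most a constant times the total mass, which
  telescopes to \<open>F n\<close>. Positivity of the potential is an inequality in one variable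
  (\<open>profile_inequality\<close>), since \<open>x i\<close> and \<open>x j\<close> are at distance at least about \<open>\<bar>i - j\<bar>\<close>. The profile \<open>F\<close> is
  the critical solution of this inequality, so the same constant \<open>g\<close> must govern the upper and the lower bound
  of the Green function, and a bound up to constants would not do.

  The Green function. Its asymptotics \<open>g / |x|\<close> are obtained by comparison with explicit functions and no
  Fourier analysis. The function \<open>(|x|^2 + b) powr (- 1/2)\<close> is superharmonic on the lattice once \<open>b\<close> is large,
  and its charge decays like \<open>|x| powr (- 5)\<close>; this bounds the Green function by a multiple of the inverse
  distance. The analogous dipole is superharmonic in a half space, and a reflection argument turns this into
  the gradient bound \<open>C / |x|^2\<close>. As the first function is the potential of its own rapidly decaying charge,
  the gradient bound lets one replace that charge by a point mass (\<open>green_asymptotics\<close>). All comparisons use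
  one minimum principle for functions that tend to zero at infinity.
\<close>

section \<open>Harmonic functions on the cubic lattice\<close>

definition walk_mean :: "(int ^ 3 \<Rightarrow> real) \<Rightarrow> int ^ 3 \<Rightarrow> real" where
  "walk_mean f x = (\<Sum>e\<in>{e. adj 0 e}. f (x + e)) / 6"

definition sqnorm :: "int ^ 3 \<Rightarrow> real" where
  "sqnorm x = (\<Sum>i\<in>UNIV. (real_of_int (x $ i))\<^sup>2)"

lemma euclidean_norm_sqnorm: "euclidean_norm x = sqrt (sqnorm x)"
  by (simp add: euclidean_norm_def norm_vec_def L2_set_def sqnorm_def)

lemma sqnorm_nonneg [simp]: "sqnorm x \<ge> 0"
  by (simp add: sqnorm_def sum_nonneg)

lemma ex_3_iff: "(\<exists>i :: 3. P i) \<longleftrightarrow> P 1 \<or> P 2 \<or> P 3"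
  by (metis exhaust_3)

lemma adj_0_iff:
  fixes e :: "int ^ 3"
  shows "adj 0 e \<longleftrightarrow> (\<exists>i. e = axis i 1 \<or> e = - axis i 1)"
proof -
  have "\<bar>a\<bar> + \<bar>b\<bar> + \<bar>c\<bar> = 1 \<longleftrightarrow> (\<bar>a\<bar> = 1 \<and> b = 0 \<and> c = 0) \<or> (a = 0 \<and> \<bar>b\<bar> = 1 \<and> c = 0)
      \<or> (a = 0 \<and> b = 0 \<and> \<bar>c\<bar> = 1)" for a b c :: int
    by arith
  moreover have "\<bar>a\<bar> = 1 \<longleftrightarrow> a = 1 \<or> a = - 1" for a :: int by arith
  ultimately show ?thesis
    by (simp only: adj_def sum_3 ex_3_iff) (auto simp: vec_eq_iff forall_3 axis_def)
qed

lemma unit_steps_eq: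
  "{e :: int ^ 3. adj 0 e} = {axis 1 1, - axis 1 1, axis 2 1, - axis 2 1, axis 3 1, - axis 3 1}"
  by (auto simp: adj_0_iff ex_3_iff)

lemma axis_distinct:
  "distinct [axis 1 1, - axis 1 1, axis 2 1, - axis 2 1, axis 3 1, - axis 3 1 :: int ^ 3]"
  by (simp add: vec_eq_iff forall_3 axis_def)

lemma finite_unit_steps [simp]: "finite {e :: int ^ 3. adj 0 e}"
  by (simp add: unit_steps_eq)

lemma sum_unit_steps:
  fixes f :: "int ^ 3 \<Rightarrow> 'a :: comm_monoid_add"
  shows "(\<Sum>e\<in>{e. adj 0 e}. f e) =
    f (axis 1 1) + f (- axis 1 1) + f (axis 2 1) + f (- axis 2 1) + f (axis 3 1) + f (- axis 3 1)"
  using axis_distinct by (simp add: unit_steps_eq ac_simps)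

lemma card_unit_steps: "card {e :: int ^ 3. adj 0 e} = 6"
  using sum_unit_steps[of "\<lambda>_. 1 :: nat"] by simp

lemma walk_mean_expand:
  "walk_mean f x = (f (x + axis 1 1) + f (x - axis 1 1) + f (x + axis 2 1) + f (x - axis 2 1)
     + f (x + axis 3 1) + f (x - axis 3 1)) / 6"
  by (simp add: walk_mean_def sum_unit_steps)

lemma walk_mean_const [simp]: "walk_mean (\<lambda>_. c) x = c"
  by (simp add: walk_mean_expand add_divide_distrib diff_divide_distrib)
lemma walk_mean_add: "walk_mean (\<lambda>x. f x + g x) x = walk_mean f x + walk_mean g x"
  by (simp add: walk_mean_expand add_divide_distrib diff_divide_distrib)
lemma walk_mean_diff: "walk_mean (\<lambda>x. f x - g x) x = walk_mean f x - walk_mean g x"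
  by (simp add: walk_mean_expand add_divide_distrib diff_divide_distrib)
lemma walk_mean_cmult: "walk_mean (\<lambda>x. c * f x) x = c * walk_mean f x"
  by (simp add: walk_mean_expand algebra_simps)
lemma walk_mean_sum: "walk_mean (\<lambda>x. \<Sum>i\<in>I. f i x) x = (\<Sum>i\<in>I. walk_mean (f i) x)"
  by (simp add: walk_mean_expand sum.distrib flip: sum_divide_distrib)
lemma walk_mean_mono: "(\<And>x. f x \<le> g x) \<Longrightarrow> walk_mean f x \<le> walk_mean g x"
  by (simp add: walk_mean_def sum_mono divide_right_mono)
lemma walk_mean_shift: "walk_mean (\<lambda>x. f (x - z)) x = walk_mean f (x - z)"
  by (simp add: walk_mean_def algebra_simps)
lemma walk_mean_reflect: "walk_mean (\<lambda>x. f (z - x)) x = walk_mean f (z - x)"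
  by (simp add: walk_mean_expand algebra_simps)
lemma walk_mean_tendsto:
  "(\<And>x. (\<lambda>n. f n x) \<longlonglongrightarrow> g x) \<Longrightarrow> (\<lambda>n. walk_mean (f n) x) \<longlonglongrightarrow> walk_mean g x"
  unfolding walk_mean_def by (intro tendsto_intros) auto

lemma walk_mean_ge_of_step:
  assumes "\<And>x. f x \<ge> m" "walk_mean f x \<le> m" "adj 0 e"
  shows "f (x + e) = m"
proof -
  have *: "(\<Sum>e\<in>{e. adj 0 e}. f (x + e) - m) \<le> 0"
    using assms(2) card_unit_steps by (simp add: walk_mean_def sum_subtractf)
  moreover have "(\<Sum>e\<in>{e. adj 0 e}. f (x + e) - m) \<ge> 0"
    using assms(1) by (intro sum_nonneg) simp
  ultimately have "(\<Sum>e\<in>{e. adj 0 e}. f (x + e) - m) = 0" by simp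
  then show ?thesis
    using assms by (subst (asm) sum_nonneg_eq_0_iff) auto
qed

text \<open>The form of convergence to zero at infinity that the minimum principle consumes: a superlevel
  set of \<open>\<bar>f\<bar>\<close> is finite, so that negative minima are attained.\<close>

definition vanishes_at_inf :: "(int ^ 3 \<Rightarrow> real) \<Rightarrow> bool" where
  "vanishes_at_inf f \<longleftrightarrow> (\<forall>\<epsilon>>0. finite {x. \<epsilon> \<le> \<bar>f x\<bar>})"

lemma vanishes_at_inf_le:
  assumes "vanishes_at_inf g" "\<And>x. \<bar>f x\<bar> \<le> \<bar>g x\<bar>"
  shows "vanishes_at_inf f"
  unfolding vanishes_at_inf_def
proof (intro allI impI)
  fix \<epsilon> :: real assume "\<epsilon> > 0"
  have "{x. \<epsilon> \<le> \<bar>f x\<bar>} \<subseteq> {x. \<epsilon> \<le> \<bar>g x\<bar>}" using assms(2) by (auto intro: order_trans)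
  then show "finite {x. \<epsilon> \<le> \<bar>f x\<bar>}"
    using assms(1) \<open>\<epsilon> > 0\<close> finite_subset unfolding vanishes_at_inf_def by blast
qed

lemma vanishes_at_inf_add:
  assumes "vanishes_at_inf f" "vanishes_at_inf g"
  shows "vanishes_at_inf (\<lambda>x. f x + g x)"
  unfolding vanishes_at_inf_def
proof (intro allI impI)
  fix \<epsilon> :: real assume "\<epsilon> > 0"
  then have "finite ({x. \<epsilon>/2 \<le> \<bar>f x\<bar>} \<union> {x. \<epsilon>/2 \<le> \<bar>g x\<bar>})"
    using assms unfolding vanishes_at_inf_def by (meson finite_UnI half_gt_zero)
  moreover have "{x. \<epsilon> \<le> \<bar>f x + g x\<bar>} \<subseteq> {x. \<epsilon>/2 \<le> \<bar>f x\<bar>} \<union> {x. \<epsilon>/2 \<le> \<bar>g x\<bar>}" by auto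
  ultimately show "finite {x. \<epsilon> \<le> \<bar>f x + g x\<bar>}" using finite_subset by blast
qed

lemma vanishes_at_inf_cmult:
  assumes "vanishes_at_inf f" shows "vanishes_at_inf (\<lambda>x. c * f x)"
proof (cases "c = 0")
  case True then show ?thesis by (simp add: vanishes_at_inf_def)
next
  case False
  have "{x. \<epsilon> \<le> \<bar>c * f x\<bar>} = {x. \<epsilon> / \<bar>c\<bar> \<le> \<bar>f x\<bar>}" for \<epsilon>
    using False by (auto simp: abs_mult field_simps)
  then show ?thesis using assms False by (simp add: vanishes_at_inf_def)
qed

lemma vanishes_at_inf_diff: "vanishes_at_inf f \<Longrightarrow> vanishes_at_inf g \<Longrightarrow> vanishes_at_inf (\<lambda>x. f x - g x)"
  using vanishes_at_inf_add[of f "\<lambda>x. -1 * g x"] vanishes_at_inf_cmult[of g "-1"] by simp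

lemma vanishes_at_inf_sum: "finite I \<Longrightarrow> (\<And>i. i \<in> I \<Longrightarrow> vanishes_at_inf (f i)) \<Longrightarrow> vanishes_at_inf (\<lambda>x. \<Sum>i\<in>I. f i x)"
proof (induction I rule: finite_induct)
  case empty then show ?case by (simp add: vanishes_at_inf_def)
next
  case (insert i I) then show ?case by (simp add: vanishes_at_inf_add)
qed

lemma vanishes_at_inf_shift: assumes "vanishes_at_inf f" shows "vanishes_at_inf (\<lambda>x. f (x - z))"
proof -
  have "{x. \<epsilon> \<le> \<bar>f (x - z)\<bar>} \<subseteq> (\<lambda>x. x + z) ` {x. \<epsilon> \<le> \<bar>f x\<bar>}" for \<epsilon>
    by (auto intro!: image_eqI[where x = "_ - z"])
  then show ?thesis using assms unfolding vanishes_at_inf_def by (meson finite_imageI finite_subset)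
qed

text \<open>A negative minimum is attained on a finite set. At a minimum point that lies furthest in the
  direction of the first axis, the mean over the neighbours forces the next site in that direction to be a
  minimum as well, which is absurd. Superharmonicity is demanded only where \<open>f\<close> is negative; this allows the use
  on half spaces and next to charged sites.\<close>

lemma min_principle:
  assumes van: "vanishes_at_inf f" and sup: "\<And>x. f x < 0 \<Longrightarrow> walk_mean f x \<le> f x"
  shows "f x \<ge> 0"
proof (rule ccontr)
  assume "\<not> f x \<ge> 0"
  define S where "S = {y. f y \<le> f x}"
  have "S \<subseteq> {y. - f x \<le> \<bar>f y\<bar>}" using \<open>\<not> f x \<ge> 0\<close> by (auto simp: S_def)
  moreover have "finite {y. - f x \<le> \<bar>f y\<bar>}"
    using van \<open>\<not> f x \<ge> 0\<close> unfolding vanishes_at_inf_def by simp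
  ultimately have fin: "finite S" by (rule finite_subset)
  have "x \<in> S" by (simp add: S_def)
  define m where "m = Min (f ` S)"
  have m_le: "f y \<ge> m" for y
  proof (cases "y \<in> S")
    case True then show ?thesis using fin by (simp add: m_def)
  next
    case False
    then have "f y \<ge> f x" by (simp add: S_def)
    moreover have "f x \<ge> m" using fin \<open>x \<in> S\<close> by (simp add: m_def)
    ultimately show ?thesis by simp
  qed
  have "m < 0" using m_le[of x] \<open>\<not> f x \<ge> 0\<close> by simp
  define T where "T = {y \<in> S. f y = m}"
  have "m \<in> f ` S" unfolding m_def using fin \<open>x \<in> S\<close> by (intro Min_in) auto
  then have "T \<noteq> {}" "finite T" using fin by (auto simp: T_def)
  \<comment> \<open>A minimum point that is extreme in direction of the first axis.\<close>
  then obtain y where y: "y \<in> T" "\<And>z. z \<in> T \<Longrightarrow> z $ 1 \<le> y $ 1"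
  proof -
    have "Max ((\<lambda>z. z $ 1) ` T) \<in> (\<lambda>z. z $ 1) ` T"
      using \<open>T \<noteq> {}\<close> \<open>finite T\<close> by (intro Max_in) auto
    then obtain y where "y \<in> T" "Max ((\<lambda>z. z $ 1) ` T) = y $ 1" by (elim imageE)
    then show thesis using that[of y] Max_ge[of "(\<lambda>z. z $ 1) ` T"] \<open>finite T\<close> by auto
  qed
  have "f y = m" using y by (simp add: T_def)
  then have "f (y + axis 1 1) = m"
    using sup[of y] \<open>m < 0\<close> m_le by (intro walk_mean_ge_of_step) (auto simp: adj_0_iff)
  then have "y + axis 1 1 \<in> T" using m_le[of x] by (simp add: T_def S_def)
  from y(2)[OF this] show False by (simp add: axis_def)
qed

lemma max_principle_eq_0:
  assumes van: "vanishes_at_inf f" and harm: "\<And>x. walk_mean f x = f x"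
  shows "f x = 0"
proof -
  have "f x \<ge> 0" using min_principle[OF van] harm by simp
  moreover have "- 1 * f x \<ge> 0"
    using harm walk_mean_cmult[of "-1" f] by (intro min_principle vanishes_at_inf_cmult van) simp
  ultimately show ?thesis by simp
qed

lemma coord_sq_le_sqnorm: "(real_of_int (x $ i))\<^sup>2 \<le> sqnorm x"
  unfolding sqnorm_def by (rule member_le_sum) auto

lemma finite_sqnorm_le: "finite {x. sqnorm x \<le> r}"
proof -
  define k where "k = \<lfloor>sqrt \<bar>r\<bar>\<rfloor>"
  have "{x. sqnorm x \<le> r} \<subseteq> vec_lambda ` (UNIV \<rightarrow> {-k..k})"
  proof
    fix x assume "x \<in> {x. sqnorm x \<le> r}"
    then have "(real_of_int (x $ i))\<^sup>2 \<le> \<bar>r\<bar>" for i using coord_sq_le_sqnorm[of x i] by simp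
    then have "\<bar>real_of_int (x $ i)\<bar> \<le> sqrt \<bar>r\<bar>" for i
      by (metis real_sqrt_abs real_sqrt_le_mono)
    then have "\<bar>x $ i\<bar> \<le> k" for i unfolding k_def
      by (simp add: le_floor_iff)
    then have "- k \<le> x $ i \<and> x $ i \<le> k" for i by (simp add: abs_le_iff minus_le_iff)
    then have "(\<lambda>i. x $ i) \<in> UNIV \<rightarrow> {-k..k}" by auto
    then show "x \<in> vec_lambda ` (UNIV \<rightarrow> {-k..k})"
      by (intro image_eqI[where x = "\<lambda>i. x $ i"]) (simp_all add: vec_eq_iff)
  qed
  moreover have "finite ((UNIV :: 3 set) \<rightarrow> {-k..k})"
    using finite_PiE[of "UNIV :: 3 set" "\<lambda>_. {-k..k}"] by (simp add: PiE_UNIV_domain)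
  ultimately show ?thesis using finite_subset by blast
qed

lemma vanishes_at_inf_of_bound:
  assumes "\<And>x. \<bar>f x\<bar> \<le> C / sqrt (sqnorm x + 1)"
  shows "vanishes_at_inf f"
  unfolding vanishes_at_inf_def
proof (intro allI impI)
  fix \<epsilon> :: real assume "\<epsilon> > 0"
  have "{x. \<epsilon> \<le> \<bar>f x\<bar>} \<subseteq> {x. sqnorm x \<le> (C/\<epsilon>)\<^sup>2}"
  proof
    fix x assume "x \<in> {x. \<epsilon> \<le> \<bar>f x\<bar>}"
    then have "\<epsilon> \<le> C / sqrt (sqnorm x + 1)" using assms[of x] by simp
    moreover have p: "sqrt (sqnorm x + 1) > 0" using sqnorm_nonneg[of x] by (simp add: add_nonneg_pos)
    ultimately have "sqrt (sqnorm x + 1) \<le> C / \<epsilon>" using \<open>\<epsilon> > 0\<close> by (simp add: field_simps)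
    then have "(sqrt (sqnorm x + 1))\<^sup>2 \<le> (C/\<epsilon>)\<^sup>2" using p by (intro power_mono) auto
    then show "x \<in> {x. sqnorm x \<le> (C/\<epsilon>)\<^sup>2}" using sqnorm_nonneg[of x] by simp
  qed
  then show "finite {x. \<epsilon> \<le> \<bar>f x\<bar>}" using finite_sqnorm_le finite_subset by blast
qed

section \<open>Superharmonic barriers\<close>

text \<open>Bounds on the monomials, for proving inequalities between polynomials on \<open>[-1/2, 1/2]\<close> by
  linear arithmetic.\<close>

lemma half_power_bounds:
  fixes u :: real assumes "\<bar>u\<bar> \<le> 1/2"
  shows "- (1/8) \<le> u^3" "u^3 \<le> 1/8" "- (1/32) \<le> u^5" "u^5 \<le> 1/32" "- (1/128) \<le> u^7" "u^7 \<le> 1/128"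
    "- (1/2) \<le> u" "u \<le> 1/2" "0 \<le> u^2" "u^2 \<le> 1/4" "0 \<le> u^4" "u^4 \<le> 1/16" "0 \<le> u^6"
proof -
  have *: "\<bar>u^n\<bar> \<le> (1/2)^n" for n using power_mono[OF assms, of n] by (simp add: power_abs)
  show "- (1/8) \<le> u^3" "u^3 \<le> 1/8" "- (1/32) \<le> u^5" "u^5 \<le> 1/32" "- (1/128) \<le> u^7" "u^7 \<le> 1/128"
    "- (1/2) \<le> u" "u \<le> 1/2" "0 \<le> u^2" "u^2 \<le> 1/4" "0 \<le> u^4" "u^4 \<le> 1/16" "0 \<le> u^6"
    using *[of 1] *[of 2] *[of 3] *[of 4] *[of 5] *[of 7] by (simp_all add: power_divide abs_le_iff)
qed

text \<open>Third-order Taylor polynomials of \<open>(1 + u) powr (- 1/2)\<close> and \<open>(1 + u) powr (- 3/2)\<close> with a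
  crude fourth-order remainder. After squaring, each bound becomes a polynomial inequality in which \<open>u ^ 4\<close>
  factors out.\<close>

lemma inv_sqrt_taylor_upper:
  fixes u :: real assumes "\<bar>u\<bar> \<le> 1/2"
  shows "1 / sqrt (1 + u) \<le> 1 - u/2 + 3*u^2/8 - 5*u^3/16 + 8*u^4"
proof -
  define U where "U = 1 - u/2 + 3*u^2/8 - 5*u^3/16 + 8*u^4"
  note b = half_power_bounds[OF assms]
  have "(1 + u) * U^2 - 1 = u^4 * (989/64 + 263/32*u - 547/256*u^2 + 281/256*u^3 + 59*u^4 + 64*u^5)"
    unfolding U_def by algebra
  moreover have "989/64 + 263/32*u - 547/256*u^2 + 281/256*u^3 + 59*u^4 + 64*u^5 \<ge> 0"
    using b by linarith
  ultimately have "(1 + u) * U^2 \<ge> 1" using b(11) by (metis diff_ge_0_iff_ge mult_nonneg_nonneg)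
  moreover have "U > 0" unfolding U_def using b by linarith
  moreover have p: "1 + u > 0" using b by simp
  ultimately have "1 \<le> (sqrt (1+u) * U)^2" by (simp add: power_mult_distrib)
  then have "1 \<le> sqrt (1+u) * U"
    using \<open>U > 0\<close> p power2_le_imp_le[of 1 "sqrt (1+u) * U"] by simp
  then show ?thesis unfolding U_def[symmetric] using p by (simp add: field_simps)
qed

lemma inv_sqrt_taylor_lower:
  fixes u :: real assumes "\<bar>u\<bar> \<le> 1/2"
  shows "1 / sqrt (1 + u) \<ge> 1 - u/2 + 3*u^2/8 - 5*u^3/16 - 8*u^4"
proof -
  define U where "U = 1 - u/2 + 3*u^2/8 - 5*u^3/16 - 8*u^4"
  note b = half_power_bounds[OF assms]
  have "(1 + u) * U^2 - 1 = - (u^4 * (1059/64 + 249/32*u - 477/256*u^2 + 231/256*u^3 - 69*u^4 - 64*u^5))"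
    unfolding U_def by algebra
  moreover have "1059/64 + 249/32*u - 477/256*u^2 + 231/256*u^3 - 69*u^4 - 64*u^5 \<ge> 0"
    using b by linarith
  ultimately have "(1 + u) * U^2 \<le> 1" using b(11) by (metis diff_le_0_iff_le mult_nonneg_nonneg neg_le_0_iff_le)
  moreover have p: "1 + u > 0" using b by simp
  ultimately have "(sqrt (1+u) * U)^2 \<le> 1^2" by (simp add: power_mult_distrib)
  then have "sqrt (1+u) * U \<le> 1"
    by (rule power2_le_imp_le) simp
  then show ?thesis unfolding U_def[symmetric] using p by (simp add: field_simps)
qed

lemma inv_cubed_sqrt_taylor_upper:
  fixes u :: real assumes "\<bar>u\<bar> \<le> 1/2"
  shows "1 / ((1 + u) * sqrt (1 + u)) \<le> 1 - 3*u/2 + 15*u^2/8 - 35*u^3/16 + 16*u^4"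
proof -
  define U where "U = 1 - 3*u/2 + 15*u^2/8 - 35*u^3/16 + 16*u^4"
  note b = half_power_bounds[OF assms]
  have "(1 + u)^3 * U^2 - 1 = u^4 * (1733/64 + 1473/32*u + 3177/256*u^2 - 557/256*u^3 + 47143/256*u^4
      + 159433/256*u^5 + 698*u^6 + 256*u^7)"
    unfolding U_def by algebra
  moreover have "1733/64 + 1473/32*u + 3177/256*u^2 - 557/256*u^3 + 47143/256*u^4
      + 159433/256*u^5 + 698*u^6 + 256*u^7 \<ge> 0"
  proof -
    have "(u + 1/2) * (u^4 * 8) \<ge> 0" "(u + 1/2) * (u^6 * 8) \<ge> 0" using b by simp_all
    then have "- (u^4/2) \<le> u^5" by (simp add: algebra_simps power_numeral_reduce)
    moreover have "u^4 \<le> u^2/4"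
      using mult_right_mono[OF b(10), of "u^2"] by (simp add: power_numeral_reduce)
    moreover have "0 \<le> u^2 * (u^2 - 1/11)^2" by simp
    then have "0 \<le> u^6 - 2/11 * u^4 + u^2/121"
      by (simp add: power2_eq_square power_numeral_reduce algebra_simps)
    ultimately show ?thesis using b by linarith
  qed
  ultimately have "(1 + u)^3 * U^2 \<ge> 1" using b(11) by (metis diff_ge_0_iff_ge mult_nonneg_nonneg)
  moreover have "0 \<le> (u - 2/5)^2" by simp
  then have "0 \<le> u^2 - 4/5 * u + 4/25" by (simp add: power2_eq_square algebra_simps)
  then have "U > 0" unfolding U_def using b by linarith
  moreover have p: "1 + u > 0" using b by simp
  moreover have "((1+u) * sqrt (1+u) * U)^2 = (1+u)^3 * U^2"
    using p by (simp add: power_mult_distrib power_numeral_reduce)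
  ultimately have "1 \<le> ((1+u) * sqrt (1+u) * U)^2" by simp
  then have "1 \<le> (1+u) * sqrt (1+u) * U"
    using \<open>U > 0\<close> p power2_le_imp_le[of 1 "(1+u) * sqrt (1+u) * U"] by simp
  then show ?thesis unfolding U_def[symmetric] using p
    by (subst pos_divide_le_eq) (auto simp: mult_ac)
qed

text \<open>A step along an axis changes the squared norm from \<open>s\<close> to \<open>s + 1 + 2 * a\<close> or \<open>s + 1 - 2 * a\<close>,
  where \<open>a\<close> is the coordinate. So \<open>(1 + 2 * a) / s\<close> is the relative increment, and the shift by \<open>1000\<close> keeps it
  in the range of the Taylor bounds.\<close>

lemma increment_small:
  fixes a s :: real
  assumes "s \<ge> a^2 + 1000"
  shows "\<bar>(1 + 2*a) / s\<bar> \<le> 1/2"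
proof -
  have "(a-2)^2 \<ge> 0" "(a+2)^2 \<ge> 0" by simp_all
  then have "\<bar>1 + 2*a\<bar> \<le> 1 + a^2/2 + 2" by (simp add: power2_eq_square abs_le_iff algebra_simps)
  also have "\<dots> \<le> s / 2" using assms by simp
  finally have "\<bar>1 + 2*a\<bar> \<le> s / 2" .
  moreover have "s > 0" using assms by (smt (verit) zero_le_power2)
  ultimately show ?thesis by (simp add: abs_divide field_simps)
qed

lemma increments_sum4:
  fixes a b c s :: real
  assumes s: "s = a^2 + b^2 + c^2 + 1000"
  shows "((1+2*a)/s)^4 + ((1-2*a)/s)^4 + ((1+2*b)/s)^4 + ((1-2*b)/s)^4 + ((1+2*c)/s)^4 + ((1-2*c)/s)^4
     \<le> 33 / s^2" (is "?L \<le> _")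
proof -
  have "s > 0" using s by (smt (verit) zero_le_power2)
  have "?L = (6 + 48*(a^2+b^2+c^2) + 32*(a^4+b^4+c^4)) / s^4"
    by (simp add: power_divide add_divide_distrib[symmetric] algebra_simps) algebra
  also have "6 + 48*(a^2+b^2+c^2) + 32*(a^4+b^4+c^4) \<le> 33 * s^2"
  proof -
    have "a^4+b^4+c^4 \<le> (a^2+b^2+c^2)^2"
    proof -
      have le: "S = X - 2 * Z \<Longrightarrow> Z \<ge> 0 \<Longrightarrow> S \<le> X" for S X Z :: real by simp
      show ?thesis
        by (rule le[of _ _ "a^2*b^2 + a^2*c^2 + b^2*c^2"]) (algebra, simp)
    qed
    moreover have "6 + 48*q + 32*q^2 \<le> 33*(q+1000)^2" if "q \<ge> 0" for q :: real
    proof -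
      have "q^2 \<ge> 0" by simp
      then show ?thesis using that by (simp add: power2_eq_square algebra_simps)
    qed
    from this[of "a^2+b^2+c^2"] have "6 + 48*(a^2+b^2+c^2) + 32*(a^2+b^2+c^2)^2 \<le> 33 * s^2" using s by simp
    moreover have "P \<le> X \<Longrightarrow> 6 + 48 * q + 32 * X \<le> Y \<Longrightarrow> 6 + 48 * q + 32 * P \<le> Y"
      for P X Y q :: real by simp
    ultimately show ?thesis by blast
  qed
  then have "(6 + 48*(a^2+b^2+c^2) + 32*(a^4+b^4+c^4)) / s^4 \<le> 33 * s^2 / s^4"
    using \<open>s > 0\<close> by (intro divide_right_mono) auto
  also have "\<dots> = 33 / s^2" using \<open>s > 0\<close> by (simp add: power_numeral_reduce field_simps)
  finally show ?thesis .
qed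

text \<open>Power sums of the relative increments over the six neighbours. Cancellation between
  opposite neighbours makes the third and fourth power sums of order \<open>1 / s^2\<close>, although single increments
  are only of order \<open>1 / sqrt s\<close>.\<close>

lemma six_point_moments:
  fixes a b c s :: real
  assumes s: "s = a^2 + b^2 + c^2 + 1000"
  defines "t \<equiv> 1 / s"
  shows "(1+2*a)/s + (1-2*a)/s + (1+2*b)/s + (1-2*b)/s + (1+2*c)/s + (1-2*c)/s = 6*t"
    "((1+2*a)/s)^2 + ((1-2*a)/s)^2 + ((1+2*b)/s)^2 + ((1-2*b)/s)^2 + ((1+2*c)/s)^2 + ((1-2*c)/s)^2
       = 8*t - 7994*t^2"
    "0 \<le> ((1+2*a)/s)^3 + ((1-2*a)/s)^3 + ((1+2*b)/s)^3 + ((1-2*b)/s)^3 + ((1+2*c)/s)^3 + ((1-2*c)/s)^3"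
    "((1+2*a)/s)^3 + ((1-2*a)/s)^3 + ((1+2*b)/s)^3 + ((1-2*b)/s)^3 + ((1+2*c)/s)^3 + ((1-2*c)/s)^3 \<le> 30*t^2"
    "((1+2*a)/s)^4 + ((1-2*a)/s)^4 + ((1+2*b)/s)^4 + ((1-2*b)/s)^4 + ((1+2*c)/s)^4 + ((1-2*c)/s)^4 \<le> 33*t^2"
    "\<bar>(1+2*a)/s\<bar> \<le> 1/2" "\<bar>(1-2*a)/s\<bar> \<le> 1/2" "\<bar>(1+2*b)/s\<bar> \<le> 1/2" "\<bar>(1-2*b)/s\<bar> \<le> 1/2"
    "\<bar>(1+2*c)/s\<bar> \<le> 1/2" "\<bar>(1-2*c)/s\<bar> \<le> 1/2" "0 < s" "0 < t" "t \<le> 1/1000" "s * t = 1"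
proof -
  have sg: "s \<ge> a^2 + 1000" "s \<ge> b^2 + 1000" "s \<ge> c^2 + 1000" "s \<ge> 1000" using s by simp_all
  show "0 < s" using sg by simp
  show sm: "\<bar>(1+2*a)/s\<bar> \<le> 1/2" "\<bar>(1-2*a)/s\<bar> \<le> 1/2" "\<bar>(1+2*b)/s\<bar> \<le> 1/2" "\<bar>(1-2*b)/s\<bar> \<le> 1/2"
     "\<bar>(1+2*c)/s\<bar> \<le> 1/2" "\<bar>(1-2*c)/s\<bar> \<le> 1/2"
    using increment_small[of a s] increment_small[of "-a" s] increment_small[of b s]
      increment_small[of "-b" s] increment_small[of c s] increment_small[of "-c" s] sg by simp_all
  define q where "q = a^2+b^2+c^2"
  have q: "q = s - 1000" "q \<ge> 0" using s sg by (auto simp: q_def)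
  show t: "0 < t" "t \<le> 1/1000" "s * t = 1" using sg by (auto simp: t_def field_simps)
  show "(1+2*a)/s + (1-2*a)/s + (1+2*b)/s + (1-2*b)/s + (1+2*c)/s + (1-2*c)/s = 6*t"
    by (simp add: t_def add_divide_distrib diff_divide_distrib)
  have "((1+2*a)/s)^2 + ((1-2*a)/s)^2 + ((1+2*b)/s)^2 + ((1-2*b)/s)^2 + ((1+2*c)/s)^2 + ((1-2*c)/s)^2
     = (6 + 8*q)*t^2"
    unfolding q_def t_def divide_inverse by algebra
  moreover have "q * t^2 = t - 1000 * t^2" using t(3) unfolding q by algebra
  ultimately show "((1+2*a)/s)^2 + ((1-2*a)/s)^2 + ((1+2*b)/s)^2 + ((1-2*b)/s)^2 + ((1+2*c)/s)^2 + ((1-2*c)/s)^2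
       = 8*t - 7994*t^2" by (simp add: algebra_simps)
  have s3: "((1+2*a)/s)^3 + ((1-2*a)/s)^3 + ((1+2*b)/s)^3 + ((1-2*b)/s)^3 + ((1+2*c)/s)^3 + ((1-2*c)/s)^3
     = (6 + 24*q)*t^3"
    unfolding q_def t_def divide_inverse by algebra
  show "0 \<le> ((1+2*a)/s)^3 + ((1-2*a)/s)^3 + ((1+2*b)/s)^3 + ((1-2*b)/s)^3 + ((1+2*c)/s)^3 + ((1-2*c)/s)^3"
    unfolding s3 using t q by simp
  have "q * t = 1 - 1000 * t" using t(3) unfolding q by algebra
  then have "q * t \<le> 1" using t by simp
  then have "(6+24*q)*t \<le> 30" using t by (simp add: algebra_simps)
  then have "(6+24*q)*t*t^2 \<le> 30*t^2" by (intro mult_right_mono) auto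
  then show "((1+2*a)/s)^3 + ((1-2*a)/s)^3 + ((1+2*b)/s)^3 + ((1-2*b)/s)^3 + ((1+2*c)/s)^3 + ((1-2*c)/s)^3 \<le> 30*t^2"
    unfolding s3 by (simp add: power_numeral_reduce mult.assoc)
  show "((1+2*a)/s)^4 + ((1-2*a)/s)^4 + ((1+2*b)/s)^4 + ((1-2*b)/s)^4 + ((1+2*c)/s)^4 + ((1-2*c)/s)^4 \<le> 33*t^2"
    using increments_sum4[OF s] by (simp add: t_def power_divide)
qed

text \<open>In the Taylor expansion the terms of order \<open>1 / s\<close> cancel, because \<open>1 / |x|\<close> is harmonic in
  three dimensions. In order \<open>1 / s^2\<close> the shift contributes \<open>- 3 * 1000\<close>, which dominates the remainders; this
  is what the size of the shift is for.\<close>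

lemma newton_neighbour_sum:
  fixes a b c s :: real
  assumes s: "s = a^2 + b^2 + c^2 + 1000"
  defines "Q \<equiv> 1/sqrt (1+(1+2*a)/s) + 1/sqrt (1+(1-2*a)/s) + 1/sqrt (1+(1+2*b)/s)
     + 1/sqrt (1+(1-2*b)/s) + 1/sqrt (1+(1+2*c)/s) + 1/sqrt (1+(1-2*c)/s)"
  shows "Q \<le> 6 - 6 / s^2" "Q \<ge> 6 - 6000 / s^2"
proof -
  note m = six_point_moments[OF s]
  have e: "6 / s^2 = 6 * (1/s)^2" "6000 / s^2 = 6000 * (1/s)^2" by (simp_all add: power_divide)
  show "Q \<le> 6 - 6 / s^2"
    using m(6-11)[THEN inv_sqrt_taylor_upper] m(1-5) zero_le_power2[of "1/s"] unfolding Q_def e by linarith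
  show "Q \<ge> 6 - 6000 / s^2"
    using m(6-11)[THEN inv_sqrt_taylor_lower] m(1-5) zero_le_power2[of "1/s"] unfolding Q_def e by linarith
qed

text \<open>The same cancellation for the derivative \<open>a / s powr (3/2)\<close> of the Newton kernel. The factor
  of the backward neighbour is \<open>a - 1\<close>, so an upper bound there needs \<open>a \<ge> 1\<close>; on the lattice the only other
  value is \<open>a = 1/2\<close>, where that neighbour is the mirror image and its increment is zero.\<close>

lemma dipole_neighbour_sum:
  fixes a b c s :: real
  assumes s: "s = a^2 + b^2 + c^2 + 1000" and a: "a = 1/2 \<or> a \<ge> 1"
  defines "f \<equiv> \<lambda>u :: real. 1 / ((1+u) * sqrt (1+u))"
  shows "(a + 1) * f ((1+2*a)/s) + (a - 1) * f ((1-2*a)/s)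
     + a * (f ((1+2*b)/s) + f ((1-2*b)/s) + f ((1+2*c)/s) + f ((1-2*c)/s)) \<le> 6 * a"
proof -
  define U where "U u = 1 - 3*u/2 + 15*u^2/8 - 35*u^3/16 + 16*u^4" for u :: real
  define t where "t = 1/s"
  note m = six_point_moments[OF s, folded t_def]
  note sm = m(6-11) and t = m(13-15)
  have fU: "f u \<le> U u" if "\<bar>u\<bar> \<le> 1/2" for u
    using inv_cubed_sqrt_taylor_upper[OF that] by (simp add: f_def U_def)
  have neg: "(a - 1) * f ((1-2*a)/s) \<le> (a - 1) * U ((1-2*a)/s)"
    using a
  proof
    assume "a = 1/2"
    then have "1 - 2 * a = 0" by simp
    then show ?thesis by (simp add: f_def U_def)
  next
    assume "a \<ge> 1" then show ?thesis using fU[OF sm(2)] by (intro mult_left_mono) auto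
  qed
  have a0: "a > 0" using a by auto
  have pos: "(a + 1) * f ((1+2*a)/s) \<le> (a + 1) * U ((1+2*a)/s)"
    using fU[OF sm(1)] a0 by (intro mult_left_mono) auto
  have rest: "a * (f ((1+2*b)/s) + f ((1-2*b)/s) + f ((1+2*c)/s) + f ((1-2*c)/s))
     \<le> a * (U ((1+2*b)/s) + U ((1-2*b)/s) + U ((1+2*c)/s) + U ((1-2*c)/s))"
    using fU[OF sm(3)] fU[OF sm(4)] fU[OF sm(5)] fU[OF sm(6)] a0 by (intro mult_left_mono) linarith+
  have total: "U ((1+2*a)/s) + U ((1-2*a)/s) + U ((1+2*b)/s) + U ((1-2*b)/s) + U ((1+2*c)/s) + U ((1-2*c)/s)
     \<le> 6 + 6*t - 14460 * t^2"
    using m(1-5) zero_le_power2[of t] unfolding U_def by linarith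
  have "U ((1+2*a)/s) - U ((1-2*a)/s) = - 6*a*t + 15*a*t^2 - 35/4*a*(3+4*a^2)*t^3 + 16*a*((16+64*a^2)*t^4)"
    unfolding U_def t_def divide_inverse by algebra
  also have "\<dots> \<le> - 6*a*t + 15*a*t^2 + 16 * a * t^2"
  proof -
    have "(16+64*a^2)*t^4 \<le> t^2"
    proof -
      have "(16+64*a^2) * t \<le> (64 * s) * t"
        using t unfolding s by (intro mult_right_mono) (simp_all add: add_nonneg_nonneg)
      then have "(16+64*a^2) * t \<le> 64" using t(3) by (simp add: mult.assoc)
      then have "(16+64*a^2) * t * t \<le> 64 * t" using t by (intro mult_right_mono) auto
      also have "\<dots> \<le> 1" using t by simp
      finally have "(16+64*a^2) * t * t * t^2 \<le> 1 * t^2" by (intro mult_right_mono) auto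
      then show ?thesis by (simp add: power_numeral_reduce mult.assoc)
    qed
    then have "a * ((16+64*a^2)*t^4) \<le> a * t^2" using a0 by (intro mult_left_mono) auto
    moreover have "a*(3+4*a^2)*t^3 \<ge> 0" using a0 t by simp
    moreover have "- 6*a*t + 15*a*t^2 - 35/4*a*(3+4*a^2)*t^3 + 16*a*((16+64*a^2)*t^4)
      = - 6*a*t + 15*a*t^2 - 35/4*(a*(3+4*a^2)*t^3) + 16*(a*((16+64*a^2)*t^4))" by simp
    moreover have "16 * a * t^2 = 16 * (a * t^2)" by simp
    ultimately show ?thesis by linarith
  qed
  finally have dif: "U ((1+2*a)/s) - U ((1-2*a)/s) \<le> - 6*a*t + 15*a*t^2 + 16 * a * t^2" .
  have "(a + 1) * f ((1+2*a)/s) + (a - 1) * f ((1-2*a)/s)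
     + a * (f ((1+2*b)/s) + f ((1-2*b)/s) + f ((1+2*c)/s) + f ((1-2*c)/s))
    \<le> a * (U ((1+2*a)/s) + U ((1-2*a)/s) + U ((1+2*b)/s) + U ((1-2*b)/s) + U ((1+2*c)/s) + U ((1-2*c)/s))
      + (U ((1+2*a)/s) - U ((1-2*a)/s))"
    using pos neg rest by (simp add: algebra_simps)
  also have "\<dots> \<le> a * (6 + 6*t - 14460 * t^2) + (- 6*a*t + 15*a*t^2 + 16 * a * t^2)"
    using total dif a0 by (intro add_mono mult_left_mono) auto
  also have "\<dots> = 6 * a - 14429 * (a * t^2)" by (simp add: algebra_simps)
  also have "\<dots> \<le> 6 * a" using a0 by simp
  finally show ?thesis .
qed

definition coord :: "int ^ 3 \<Rightarrow> 3 \<Rightarrow> real" where "coord x i = real_of_int (x $ i)"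

lemma sqnorm_3: "sqnorm x = (coord x 1)^2 + (coord x 2)^2 + (coord x 3)^2"
  by (simp add: sqnorm_def sum_3 coord_def)

lemma coord_add_axis [simp]:
  "coord (x + axis i 1) j = coord x j + (if i = j then 1 else 0)"
  "coord (x - axis i 1) j = coord x j - (if i = j then 1 else 0)"
  by (auto simp: coord_def axis_def)

text \<open>The Newton potential \<open>1 / |x|\<close>, smoothed so that it is superharmonic on the whole lattice.\<close>

definition newton_kernel :: "int ^ 3 \<Rightarrow> real" where
  "newton_kernel x = 1 / sqrt (sqnorm x + 1000)"

text \<open>The Newton kernel is the potential of this charge distribution; see \<open>newton_as_potential\<close>.\<close>

definition charge :: "int ^ 3 \<Rightarrow> real" where
  "charge x = newton_kernel x - walk_mean newton_kernel x"

lemma inv_sqrt_split: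
  fixes s :: real assumes "s > 0"
  shows "1 / sqrt (s + v) = 1 / sqrt s * (1 / sqrt (1 + v / s))"
  using assms by (simp add: real_sqrt_mult[symmetric] field_simps)

lemma charge_bounds:
  defines "r \<equiv> \<lambda>x. sqrt (sqnorm x + 1000)"
  shows "charge x \<ge> 1 / r x ^ 5" "charge x \<le> 1000 / r x ^ 5"
proof -
  let ?a = "coord x 1" and ?b = "coord x 2" and ?c = "coord x 3"
  define s where "s = ?a^2 + ?b^2 + ?c^2 + 1000"
  have s: "s > 0" unfolding s_def by (simp add: add_nonneg_pos)
  have sx: "sqnorm x + 1000 = s" by (simp add: s_def sqnorm_3)
  have nb: "newton_kernel (x + axis 1 1) = 1 / sqrt (s + (1+2*?a))" "newton_kernel (x - axis 1 1) = 1 / sqrt (s + (1-2*?a))"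
    "newton_kernel (x + axis 2 1) = 1 / sqrt (s + (1+2*?b))" "newton_kernel (x - axis 2 1) = 1 / sqrt (s + (1-2*?b))"
    "newton_kernel (x + axis 3 1) = 1 / sqrt (s + (1+2*?c))" "newton_kernel (x - axis 3 1) = 1 / sqrt (s + (1-2*?c))"
    by (simp_all add: newton_kernel_def sqnorm_3 s_def power2_eq_square algebra_simps)
  define Q where "Q = 1/sqrt (1+(1+2*?a)/s) + 1/sqrt (1+(1-2*?a)/s) + 1/sqrt (1+(1+2*?b)/s)
     + 1/sqrt (1+(1-2*?b)/s) + 1/sqrt (1+(1+2*?c)/s) + 1/sqrt (1+(1-2*?c)/s)"
  have wm: "walk_mean newton_kernel x = 1 / sqrt s * (Q / 6)"
  proof -
    have "(k * A + k * B + k * C + k * D + k * E + k * F) / 6 = k * ((A + B + C + D + E + F) / 6)"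
      for k A B C D E F :: real by (simp add: distrib_left)
    then show ?thesis unfolding walk_mean_expand nb inv_sqrt_split[OF s] Q_def .
  qed
  have c: "charge x = 1 / sqrt s * (1 - Q / 6)"
    unfolding charge_def wm by (simp add: newton_kernel_def sx right_diff_distrib)
  have Q: "Q \<le> 6 - 6 / s^2" "Q \<ge> 6 - 6000 / s^2"
    unfolding Q_def by (rule newton_neighbour_sum[OF s_def])+
  have r: "r x = sqrt s" by (simp add: r_def sx)
  have r5: "sqrt s ^ 5 = sqrt s * s^2" using s by (simp add: power_numeral_reduce mult.assoc[symmetric])
  have "1 / sqrt s * (1 / s^2) \<le> charge x" unfolding c
    using Q s by (intro mult_left_mono) auto
  then show "charge x \<ge> 1 / r x ^ 5" by (simp add: r r5)
  have "charge x \<le> 1 / sqrt s * (1000 / s^2)" unfolding c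
    using Q s by (intro mult_left_mono) auto
  then show "charge x \<le> 1000 / r x ^ 5" by (simp add: r r5)
qed

text \<open>The derivative of the Newton kernel in direction \<open>i\<close>, centred at the midpoint of the bond between
  \<open>0\<close> and \<open>axis i 1\<close>, so that it is odd under the reflection that exchanges these two sites.\<close>

definition dipole :: "3 \<Rightarrow> int ^ 3 \<Rightarrow> real" where
  "dipole i x = (let s = sqnorm x - coord x i + 1/4 + 1000 in (coord x i - 1/2) / (s * sqrt s))"

lemma inv_cube_split:
  fixes s :: real assumes "s > 0"
  shows "1 / ((s + v) * sqrt (s + v)) = 1 / (s * sqrt s) * (1 / ((1 + v / s) * sqrt (1 + v / s)))"
proof -
  have "s + v = s * (1 + v/s)" using assms by (simp add: field_simps)
  then have "(s + v) * sqrt (s + v) = (s * sqrt s) * ((1 + v / s) * sqrt (1 + v / s))"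
    by (simp add: real_sqrt_mult)
  then show ?thesis by simp
qed

lemma dipole_superharmonic:
  assumes i: "x $ i \<ge> 1"
  shows "walk_mean (dipole i) x \<le> dipole i x"
proof -
  \<comment> \<open>The other two directions enter symmetrically.\<close>
  obtain j k where ijk: "{i, j, k} = (UNIV :: 3 set)" "i \<noteq> j" "i \<noteq> k" "j \<noteq> k"
  proof -
    consider "i = 1" | "i = 2" | "i = 3" using exhaust_3 by blast
    then show thesis
    proof cases
      case 1
      have "{1, 2, 3} = (UNIV :: 3 set)" using exhaust_3 by blast
      then show ?thesis using that[of 2 3] 1 by simp
    next
      case 2
      have "{2, 1, 3} = (UNIV :: 3 set)" using exhaust_3 by blast
      then show ?thesis using that[of 1 3] 2 by simp
    next
      case 3
      have "{3, 1, 2} = (UNIV :: 3 set)" using exhaust_3 by blast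
      then show ?thesis using that[of 1 2] 3 by simp
    qed
  qed
  let ?a = "coord x i - 1/2" and ?b = "coord x j" and ?c = "coord x k"
  define s where "s = ?a^2 + ?b^2 + ?c^2 + 1000"
  have s: "s > 0" unfolding s_def by (simp add: add_nonneg_pos)
  have sum_ijk: "sum g UNIV = g i + g j + g k" for g :: "3 \<Rightarrow> real"
    unfolding ijk(1)[symmetric] using ijk(2-) by (simp add: ac_simps)
  have sq: "sqnorm y = (coord y i)^2 + (coord y j)^2 + (coord y k)^2" for y
    unfolding sqnorm_def sum_ijk coord_def by simp
  define f where "f = (\<lambda>u :: real. 1 / ((1+u) * sqrt (1+u)))"
  have d: "dipole i y = \<alpha> * (1 / (t * sqrt t))"
    if "coord y i = \<alpha> + 1/2" "coord y j = \<beta>" "coord y k = \<gamma>" "t = \<alpha>^2 + \<beta>^2 + \<gamma>^2 + 1000" for y t \<alpha> \<beta> \<gamma>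
  proof -
    have "t = sqnorm y - coord y i + 1/4 + 1000"
      unfolding sq that by (simp add: power2_eq_square algebra_simps)
    then show ?thesis using that(1) by (simp add: dipole_def Let_def)
  qed
  note ne = ijk(2-) ijk(2-)[symmetric]
  have nb1: "dipole i (x + axis i 1) = (?a + 1) * (1 / ((s + (1+2*?a)) * sqrt (s + (1+2*?a))))"
    by (rule d[of _ _ "?b" "?c"]) (use ne in \<open>simp_all add: s_def power2_sum power2_diff power_divide\<close>)
  have nb2: "dipole i (x - axis i 1) = (?a - 1) * (1 / ((s + (1-2*?a)) * sqrt (s + (1-2*?a))))"
    by (rule d[of _ _ "?b" "?c"]) (use ne in \<open>simp_all add: s_def power2_sum power2_diff power_divide\<close>)
  have nb3: "dipole i (x + axis j 1) = ?a * (1 / ((s + (1+2*?b)) * sqrt (s + (1+2*?b))))"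
    by (rule d[of _ _ "(?b + 1)" "?c"]) (use ne in \<open>simp_all add: s_def power2_sum power2_diff power_divide\<close>)
  have nb4: "dipole i (x - axis j 1) = ?a * (1 / ((s + (1-2*?b)) * sqrt (s + (1-2*?b))))"
    by (rule d[of _ _ "(?b - 1)" "?c"]) (use ne in \<open>simp_all add: s_def power2_sum power2_diff power_divide\<close>)
  have nb5: "dipole i (x + axis k 1) = ?a * (1 / ((s + (1+2*?c)) * sqrt (s + (1+2*?c))))"
    by (rule d[of _ _ "?b" "(?c + 1)"]) (use ne in \<open>simp_all add: s_def power2_sum power2_diff power_divide\<close>)
  have nb6: "dipole i (x - axis k 1) = ?a * (1 / ((s + (1-2*?c)) * sqrt (s + (1-2*?c))))"
    by (rule d[of _ _ "?b" "(?c - 1)"]) (use ne in \<open>simp_all add: s_def power2_sum power2_diff power_divide\<close>)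
  note nb = nb1 nb2 nb3 nb4 nb5 nb6
  have wm: "walk_mean (dipole i) x = (dipole i (x + axis i 1) + dipole i (x - axis i 1)
      + dipole i (x + axis j 1) + dipole i (x - axis j 1) + dipole i (x + axis k 1) + dipole i (x - axis k 1)) / 6"
    using sum_ijk[of "\<lambda>l. dipole i (x + axis l 1) + dipole i (x - axis l 1)"]
    unfolding sum_3 walk_mean_expand by simp
  have a: "?a = 1/2 \<or> ?a \<ge> 1"
  proof (cases "x $ i = 1")
    case True then show ?thesis by (simp add: coord_def)
  next
    case False
    then have "x $ i \<ge> 2" using i by simp
    then show ?thesis by (simp add: coord_def)
  qed
  have "walk_mean (dipole i) x = 1 / (s * sqrt s) * (((?a + 1) * f ((1+2*?a)/s) + (?a - 1) * f ((1-2*?a)/s)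
     + ?a * (f ((1+2*?b)/s) + f ((1-2*?b)/s) + f ((1+2*?c)/s) + f ((1-2*?c)/s))) / 6)"
  proof -
    have "((a+1)*(k*A) + (a-1)*(k*B) + a*(k*C) + a*(k*D) + a*(k*E) + a*(k*F)) / 6
      = k * (((a+1)*A + (a-1)*B + a*(C+D+E+F)) / 6)" for a k A B C D E F :: real
      by (simp add: algebra_simps)
    then show ?thesis unfolding wm nb inv_cube_split[OF s] f_def .
  qed
  also have "\<dots> \<le> 1 / (s * sqrt s) * ?a"
  proof (rule mult_left_mono)
    have "X \<le> 6 * a \<Longrightarrow> X / 6 \<le> a" for X a :: real by simp
    then show "((?a + 1) * f ((1+2*?a)/s) + (?a - 1) * f ((1-2*?a)/s)
     + ?a * (f ((1+2*?b)/s) + f ((1-2*?b)/s) + f ((1+2*?c)/s) + f ((1-2*?c)/s))) / 6 \<le> ?a"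
      using dipole_neighbour_sum[OF s_def a] unfolding f_def by blast
  qed (use s in simp)
  also have "\<dots> = ?a * (1 / (s * sqrt s))" by (rule mult.commute)
  also have "\<dots> = dipole i x"
    by (rule d[symmetric]) (simp_all add: s_def)
  finally show ?thesis .
qed

section \<open>The Green function and its gradient\<close>

text \<open>The expected number of visits to \<open>x\<close> before time \<open>n\<close> by a walk from the origin.\<close>

primrec green_iter :: "nat \<Rightarrow> int ^ 3 \<Rightarrow> real" where
  "green_iter 0 = (\<lambda>_. 0)"
| "green_iter (Suc n) = (\<lambda>x. (if x = 0 then 1 else 0) + walk_mean (green_iter n) x)"

definition green :: "int ^ 3 \<Rightarrow> real" where
  "green x = lim (\<lambda>n. green_iter n x)"

lemma newton_pos: "newton_kernel x > 0"
  by (simp add: newton_kernel_def add_nonneg_pos)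

lemma charge_nonneg: "charge x \<ge> 0"
proof -
  have "0 \<le> 1 / sqrt (sqnorm x + 1000) ^ 5" by simp
  then show ?thesis using charge_bounds(1)[of x] by linarith
qed

lemma green_iter_mono: "green_iter n x \<le> green_iter (Suc n) x"
proof (induction n arbitrary: x)
  case 0 then show ?case by simp
next
  case (Suc n)
  have "walk_mean (green_iter n) x \<le> walk_mean (green_iter (Suc n)) x"
    by (intro walk_mean_mono Suc.IH)
  then show ?case by simp
qed

text \<open>A multiple of the Newton kernel dominates one step of the recursion, since its charge is
  nonnegative and at least one at the origin.\<close>

lemma green_iter_le: "green_iter n x \<le> sqrt 1000 ^ 5 * newton_kernel x"
proof (induction n arbitrary: x)
  case 0 then show ?case using newton_pos[of x] by simp
next
  case (Suc n)
  have "walk_mean (green_iter n) x \<le> walk_mean (\<lambda>x. sqrt 1000 ^ 5 * newton_kernel x) x"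
    by (intro walk_mean_mono Suc.IH)
  also have "\<dots> = sqrt 1000 ^ 5 * newton_kernel x - sqrt 1000 ^ 5 * charge x"
    by (simp only: walk_mean_cmult charge_def right_diff_distrib)
  finally have *: "walk_mean (green_iter n) x \<le> sqrt 1000 ^ 5 * newton_kernel x - sqrt 1000 ^ 5 * charge x" .
  have "sqrt 1000 ^ 5 * charge x \<ge> (if x = 0 then 1 else 0)"
  proof (cases "x = 0")
    case True
    have "sqrt 1000 ^ 5 * (1 / sqrt 1000 ^ 5) \<le> sqrt 1000 ^ 5 * charge x"
      using charge_bounds(1)[of x] True by (intro mult_left_mono) (auto simp: sqnorm_def)
    then show ?thesis using True by simp
  next
    case False then show ?thesis using charge_nonneg[of x] by simp
  qed
  then show ?case using * by simp
qed

lemma green_tendsto: "(\<lambda>n. green_iter n x) \<longlonglongrightarrow> green x"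
proof -
  have inc: "incseq (\<lambda>n. green_iter n x)" by (intro incseq_SucI green_iter_mono)
  show ?thesis
  proof (rule incseq_convergent[OF inc])
    show "\<forall>i. green_iter i x \<le> sqrt 1000 ^ 5 * newton_kernel x" using green_iter_le by simp
    fix L assume "(\<lambda>n. green_iter n x) \<longlonglongrightarrow> L"
    then show "(\<lambda>n. green_iter n x) \<longlonglongrightarrow> green x" by (simp add: green_def limI)
  qed
qed

lemma green_nonneg: "green x \<ge> 0"
proof -
  have "green_iter n x \<ge> 0" for n
    using lift_Suc_mono_le[of "\<lambda>n. green_iter n x" 0 n] green_iter_mono by simp
  then show ?thesis using green_tendsto[of x] by (meson LIMSEQ_le_const)
qed

lemma green_le_newton: "green x \<le> sqrt 1000 ^ 5 * newton_kernel x"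
  using green_tendsto[of x] green_iter_le by (meson LIMSEQ_le_const2)

lemma green_eq: "green x = (if x = 0 then 1 else 0) + walk_mean green x"
proof -
  have "(\<lambda>n. green_iter (Suc n) x) \<longlonglongrightarrow> (if x = 0 then 1 else 0) + walk_mean green x"
    unfolding green_iter.simps by (intro tendsto_intros walk_mean_tendsto green_tendsto)
  moreover have "(\<lambda>n. green_iter (Suc n) x) \<longlonglongrightarrow> green x"
    using green_tendsto by (rule LIMSEQ_Suc)
  ultimately show ?thesis by (metis LIMSEQ_unique)
qed

lemma walk_mean_green: "walk_mean green (x - z) = green (x - z) - (if x = z then 1 else 0)"
  using green_eq[of "x - z"] unfolding right_minus_eq by linarith

lemma sqnorm_1_pos [simp]: "0 < sqnorm x + 1"
  using sqnorm_nonneg[of x] by linarith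

lemma newton_le: "newton_kernel x \<le> 1 / sqrt (sqnorm x + 1)"
  unfolding newton_kernel_def by (rule divide_left_mono) (simp_all add: add_nonneg_pos)

lemma newton_vanishes: "vanishes_at_inf newton_kernel"
proof (rule vanishes_at_inf_of_bound)
  show "\<bar>newton_kernel x\<bar> \<le> 1 / sqrt (sqnorm x + 1)" for x
    using newton_le[of x] newton_pos[of x] by linarith
qed

lemma green_vanishes: "vanishes_at_inf green"
proof (rule vanishes_at_inf_le)
  show "vanishes_at_inf (\<lambda>x. sqrt 1000 ^ 5 * newton_kernel x)"
    by (rule vanishes_at_inf_cmult[OF newton_vanishes])
  show "\<bar>green x\<bar> \<le> \<bar>sqrt 1000 ^ 5 * newton_kernel x\<bar>" for x
    using green_nonneg[of x] green_le_newton[of x] by linarith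
qed

lemma green_bound: "\<exists>C>0. \<forall>x. green x \<le> C / sqrt (sqnorm x + 1)"
proof (intro exI conjI allI)
  fix x
  have "sqrt 1000 ^ 5 * newton_kernel x \<le> sqrt 1000 ^ 5 * (1 / sqrt (sqnorm x + 1))"
    by (intro mult_left_mono newton_le) simp
  moreover have "c * (1 / b) = c / b" for c b :: real by simp
  ultimately show "green x \<le> sqrt 1000 ^ 5 / sqrt (sqnorm x + 1)"
    using green_le_newton[of x] by (metis order_trans)
qed simp

lemma green_unique:
  assumes "vanishes_at_inf f" "\<And>x. f x = (if x = 0 then 1 else 0) + walk_mean f x"
  shows "f x = green x"
proof -
  have "walk_mean (\<lambda>x. f x - green x) x = f x - green x" for x
    unfolding walk_mean_diff using assms(2)[of x] green_eq[of x] by linarith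
  then have "f x - green x = 0"
    by (rule max_principle_eq_0[OF vanishes_at_inf_diff[OF assms(1) green_vanishes]])
  then show ?thesis by simp
qed

definition reflect :: "3 \<Rightarrow> int ^ 3 \<Rightarrow> int ^ 3" where
  "reflect i x = (\<chi> j. if j = i then - (x $ j) else x $ j)"

lemma reflect_reflect [simp]: "reflect i (reflect i x) = x"
  by (simp add: reflect_def vec_eq_iff)
lemma reflect_eq_0 [simp]: "reflect i x = 0 \<longleftrightarrow> x = 0"
  by (auto simp: reflect_def vec_eq_iff)
lemma sqnorm_reflect [simp]: "sqnorm (reflect i x) = sqnorm x"
  unfolding sqnorm_def reflect_def by (intro sum.cong) auto

lemma reflect_axis:
  "reflect i (x + axis l 1) = (if l = i then reflect i x - axis l 1 else reflect i x + axis l 1)"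
  "reflect i (x - axis l 1) = (if l = i then reflect i x + axis l 1 else reflect i x - axis l 1)"
  by (auto simp: reflect_def vec_eq_iff axis_def)

lemma walk_mean_comp_reflect: "walk_mean (\<lambda>x. f (reflect i x)) x = walk_mean f (reflect i x)"
  by (auto simp: walk_mean_expand reflect_axis)

lemma vanishes_at_inf_reflect: "vanishes_at_inf f \<Longrightarrow> vanishes_at_inf (\<lambda>x. f (reflect i x))"
proof -
  assume "vanishes_at_inf f"
  moreover have "{x. \<epsilon> \<le> \<bar>f (reflect i x)\<bar>} \<subseteq> reflect i ` {x. \<epsilon> \<le> \<bar>f x\<bar>}" for \<epsilon>
    by (auto intro!: image_eqI[where x = "reflect i _"])
  ultimately show ?thesis unfolding vanishes_at_inf_def by (meson finite_imageI finite_subset)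
qed

lemma green_reflect: "green (reflect i x) = green x"
proof (rule green_unique[of "\<lambda>x. green (reflect i x)"])
  show "vanishes_at_inf (\<lambda>x. green (reflect i x))" by (rule vanishes_at_inf_reflect[OF green_vanishes])
  show "green (reflect i x) = (if x = 0 then 1 else 0) + walk_mean (\<lambda>x. green (reflect i x)) x" for x
    unfolding walk_mean_comp_reflect[of green i x] using green_eq[of "reflect i x"] by simp
qed

lemma green_uminus: "green (- x) = green x"
proof (rule green_unique[of "\<lambda>x. green (- x)"])
  show "vanishes_at_inf (\<lambda>x. green (- x))"
  proof -
    have "{x. \<epsilon> \<le> \<bar>green (- x)\<bar>} \<subseteq> uminus ` {x. \<epsilon> \<le> \<bar>green x\<bar>}" for \<epsilon>
      by (auto intro!: image_eqI[where x = "- _"])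
    then show ?thesis using green_vanishes unfolding vanishes_at_inf_def by (meson finite_imageI finite_subset)
  qed
  show "green (- x) = (if x = 0 then 1 else 0) + walk_mean (\<lambda>x. green (- x)) x" for x
    using green_eq[of "-x"] walk_mean_reflect[of green 0 x] by simp
qed

text \<open>An odd function may be cut off to zero behind the mirror plane: at a point next to the plane
  where \<open>f\<close> is negative, the mirrored neighbour has a positive value, so the cut-off only lowers the mean.\<close>

lemma half_space_principle:
  assumes van: "vanishes_at_inf f"
    and odd: "\<And>x. x $ i = 1 \<Longrightarrow> f (x - axis i 1) = - f x"
    and sup: "\<And>x. x $ i \<ge> 1 \<Longrightarrow> f x < 0 \<Longrightarrow> walk_mean f x \<le> f x"
    and x: "x $ i \<ge> 1"
  shows "f x \<ge> 0"
proof -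
  define g where "g x = (if x $ i \<ge> 1 then f x else 0)" for x
  have "g x \<ge> 0"
  proof (rule min_principle)
    show "vanishes_at_inf g" by (rule vanishes_at_inf_le[OF van]) (simp add: g_def)
    fix x assume neg: "g x < 0"
    then have x: "x $ i \<ge> 1" "f x < 0" by (auto simp: g_def split: if_splits)
    have "walk_mean g x \<le> walk_mean f x"
      unfolding walk_mean_def
    proof (intro divide_right_mono sum_mono)
      fix e :: "int ^ 3" assume "e \<in> {e. adj 0 e}"
      then obtain l where l: "e = axis l 1 \<or> e = - axis l 1" by (auto simp: adj_0_iff)
      show "g (x + e) \<le> f (x + e)"
      proof (cases "(x + e) $ i \<ge> 1")
        case False
        have ax: "axis l (1::int) $ i = (if i = l then 1 else 0)" by (simp add: axis_def)
        have "e $ i \<ge> - 1 \<and> (e $ i < 0 \<longrightarrow> e = - axis i 1)"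
          using l
        proof
          assume "e = axis l 1" then show ?thesis using ax by auto
        next
          assume "e = - axis l 1" then show ?thesis using ax by auto
        qed
        then have "e = - axis i 1" "x $ i = 1" using False x by auto
        then show ?thesis using odd[of x] x False by (simp add: g_def)
      qed (simp add: g_def)
    qed simp
    also have "\<dots> \<le> f x" by (rule sup) (use x in auto)
    finally show "walk_mean g x \<le> g x" using x by (simp add: g_def)
  qed
  then show ?thesis using x by (simp add: g_def)
qed

lemma dipole_odd:
  assumes "x $ i = 1" shows "dipole i (x - axis i 1) = - dipole i x"
proof -
  have "sqnorm (x - axis i 1) = sqnorm x - 1"
  proof -
    have "sqnorm x = (coord x i)^2 + (\<Sum>j\<in>UNIV - {i}. (coord x j)^2)" for x
      unfolding sqnorm_def coord_def by (subst sum.remove[of _ i]) auto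
    moreover have "(\<Sum>j\<in>UNIV - {i}. (coord (x - axis i 1) j)^2) = (\<Sum>j\<in>UNIV - {i}. (coord x j)^2)"
      by (intro sum.cong) auto
    moreover have "coord x i = 1" using assms by (simp add: coord_def)
    ultimately show ?thesis by simp
  qed
  moreover have "coord x i = 1" using assms by (simp add: coord_def)
  ultimately show ?thesis by (simp add: dipole_def Let_def)
qed

lemma coord_sq_le: "(coord x i)^2 \<le> sqnorm x"
  using coord_sq_le_sqnorm by (simp add: coord_def)

lemma dipole_bound: "\<bar>dipole i x\<bar> \<le> 2 / (sqnorm x + 1)"
proof -
  define s where "s = sqnorm x - coord x i + 1/4 + 1000"
  have s: "s \<ge> (coord x i - 1/2)^2" using coord_sq_le[of x i] by (simp add: s_def power2_diff power_divide)
  have s2: "2 * s \<ge> sqnorm x + 1"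
  proof -
    have "(coord x i - 1)^2 \<ge> 0" by simp
    then have "2 * coord x i \<le> sqnorm x + 1" using coord_sq_le[of x i] by (simp add: power2_diff)
    then show ?thesis by (simp add: s_def)
  qed
  have pos: "sqnorm x + 1 > 0" using sqnorm_nonneg[of x] by linarith
  then have sp: "s > 0" using s2 by linarith
  have "\<bar>coord x i - 1/2\<bar> \<le> sqrt s" using s by (metis real_sqrt_abs real_sqrt_le_mono)
  then have le: "\<bar>coord x i - 1/2\<bar> / (s * sqrt s) \<le> sqrt s / (s * sqrt s)"
    using sp by (intro divide_right_mono) auto
  have "dipole i x = (coord x i - 1/2) / (s * sqrt s)" by (simp add: dipole_def s_def Let_def)
  then have "\<bar>dipole i x\<bar> = \<bar>coord x i - 1/2\<bar> / (s * sqrt s)"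
    using sp by (simp only: abs_divide abs_mult) simp
  also note le
  also have "sqrt s / (s * sqrt s) = 1 / s" using sp by simp
  also have "1 / s \<le> 2 / (sqnorm x + 1)" using s2 pos sp by (simp add: field_simps)
  finally show ?thesis .
qed

lemma dipole_vanishes: "vanishes_at_inf (dipole i)"
proof (rule vanishes_at_inf_of_bound[where C = 2])
  fix x
  have pos: "sqnorm x + 1 \<ge> 1" using sqnorm_nonneg[of x] by linarith
  then have "sqrt (sqnorm x + 1) \<le> sqnorm x + 1" 
    by (intro real_le_lsqrt) (auto intro: self_le_power)
  then have "2 / (sqnorm x + 1) \<le> 2 / sqrt (sqnorm x + 1)" using pos by (intro divide_left_mono) auto
  then show "\<bar>dipole i x\<bar> \<le> 2 / sqrt (sqnorm x + 1)" using dipole_bound[of i x] by linarith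
qed

text \<open>The difference of two translates of the Green function is odd under the reflection at the bond
  \<open>{0, axis i 1}\<close> and harmonic in the half space except at \<open>axis i 1\<close>. A multiple of the dipole that dominates
  it at this one site dominates it everywhere.\<close>

lemma green_gradient: "\<exists>C>0. \<forall>x i. \<bar>green x - green (x - axis i 1)\<bar> \<le> C / (sqnorm x + 1)"
proof -
  \<comment> \<open>Large enough for all three directions; the summand 1 makes it positive.\<close>
  define K where "K = (\<Sum>i\<in>UNIV. \<bar>green (axis i 1) - green 0\<bar> / dipole i (axis i 1)) + 1"
  have dpos: "dipole i (axis i 1) > 0" for i
  proof -
    have "sqnorm (axis i 1) \<ge> 0" by simp
    moreover have "coord (axis i 1) i = 1" by (simp add: coord_def axis_def)
    ultimately show ?thesis by (auto simp: dipole_def Let_def intro!: mult_pos_pos add_pos_nonneg)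
  qed
  have K: "K * dipole i (axis i 1) \<ge> \<bar>green (axis i 1) - green 0\<bar>" "K > 0" for i
  proof -
    have nn: "\<And>i. \<bar>green (axis i 1) - green 0\<bar> / dipole i (axis i 1) \<ge> 0"
      by (rule divide_nonneg_nonneg[OF abs_ge_zero less_imp_le[OF dpos]])
    then have "\<bar>green (axis i 1) - green 0\<bar> / dipole i (axis i 1) \<le> K - 1"
      using member_le_sum[of i UNIV "\<lambda>i. \<bar>green (axis i 1) - green 0\<bar> / dipole i (axis i 1)"]
      by (simp add: K_def)
    then show "K * dipole i (axis i 1) \<ge> \<bar>green (axis i 1) - green 0\<bar>"
      using dpos[of i] by (simp add: field_simps)
    show "K > 0" unfolding K_def using nn by (simp add: add_nonneg_pos sum_nonneg)
  qed
  \<comment> \<open>The bound on the side of the mirror plane that contains \<open>axis i 1\<close>.\<close>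
  have half: "\<bar>green x - green (x - axis i 1)\<bar> \<le> K * dipole i x" if x: "x $ i \<ge> 1" for x i
  proof -
    define h where "h x = green x - green (x - axis i 1)" for x
    have vh: "vanishes_at_inf h" unfolding h_def
      by (intro vanishes_at_inf_diff green_vanishes vanishes_at_inf_shift)
    have wh: "walk_mean h x = h x + (if x = axis i 1 then 1 else 0)" if "x $ i \<ge> 1" for x
    proof -
      have "x \<noteq> 0" using that by auto
      then have "walk_mean green x = green x" using walk_mean_green[of x 0] by simp
      then show ?thesis unfolding h_def walk_mean_diff walk_mean_shift walk_mean_green by linarith
    qed
    have oddh: "h (x - axis i 1) = - h x" if "x $ i = 1" for x
    proof -
      have "x - axis i 1 - axis i 1 = reflect i x" using that
        by (auto simp: reflect_def vec_eq_iff axis_def)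
      then show ?thesis by (simp add: h_def green_reflect)
    qed
    have wd: "walk_mean (\<lambda>x. K * dipole i x) x \<le> K * dipole i x" if "x $ i \<ge> 1" for x
      using dipole_superharmonic[OF that] K(2) by (simp add: walk_mean_cmult)
    have "K * dipole i x - h x \<ge> 0"
    proof (rule half_space_principle[OF _ _ _ x, of "\<lambda>x. K * dipole i x - h x"])
      show "vanishes_at_inf (\<lambda>x. K * dipole i x - h x)"
        by (intro vanishes_at_inf_diff vanishes_at_inf_cmult dipole_vanishes vh)
      show "K * dipole i (x - axis i 1) - h (x - axis i 1) = - (K * dipole i x - h x)" if "x $ i = 1" for x
        using dipole_odd[OF that] oddh[OF that] by simp
      fix y assume y: "y $ i \<ge> 1" "K * dipole i y - h y < 0"
      show "walk_mean (\<lambda>x. K * dipole i x - h x) y \<le> K * dipole i y - h y"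
        using wd[OF y(1)] wh[OF y(1)] unfolding walk_mean_diff by (auto split: if_splits)
    qed
    moreover have "K * dipole i x + h x \<ge> 0"
    proof (rule half_space_principle[OF _ _ _ x, of "\<lambda>x. K * dipole i x + h x"])
      show "vanishes_at_inf (\<lambda>x. K * dipole i x + h x)"
        by (intro vanishes_at_inf_add vanishes_at_inf_cmult dipole_vanishes vh)
      show "K * dipole i (x - axis i 1) + h (x - axis i 1) = - (K * dipole i x + h x)" if "x $ i = 1" for x
        using dipole_odd[OF that] oddh[OF that] by simp
      fix y assume y: "y $ i \<ge> 1" "K * dipole i y + h y < 0"
      then have "y \<noteq> axis i 1" using K(1)[of i] unfolding h_def by auto
      then show "walk_mean (\<lambda>x. K * dipole i x + h x) y \<le> K * dipole i y + h y"
        using wd[OF y(1)] wh[OF y(1)] unfolding walk_mean_add by simp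
    qed
    ultimately show ?thesis by (simp add: h_def abs_le_iff)
  qed
  have "\<bar>green x - green (x - axis i 1)\<bar> \<le> 2 * K / (sqnorm x + 1)" for x i
  proof (cases "x $ i \<ge> 1")
    case True
    have "K * dipole i x \<le> K * (2 / (sqnorm x + 1))"
      using dipole_bound[of i x] K(2) by (intro mult_left_mono) auto
    then show ?thesis using half[OF True] by (simp add: mult.commute)
  next
    case False
    \<comment> \<open>The mirror image of \<open>x\<close>, which is at least as far from the origin.\<close>
    define y where "y = reflect i (x - axis i 1)"
    have y: "y $ i \<ge> 1" using False by (simp add: y_def reflect_def axis_def)
    have "y - axis i 1 = reflect i x" by (auto simp: y_def reflect_def vec_eq_iff axis_def)
    then have e: "green x - green (x - axis i 1) = - (green y - green (y - axis i 1))"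
      by (simp add: y_def green_reflect)
    have "sqnorm y \<ge> sqnorm x"
    proof -
      have "sqnorm y = sqnorm (x - axis i 1)" by (simp add: y_def)
      also have "\<dots> = (\<Sum>j\<in>UNIV. (coord (x - axis i 1) j)^2)" by (simp add: sqnorm_def coord_def)
      also have "\<dots> \<ge> (\<Sum>j\<in>UNIV. (coord x j)^2)"
      proof (intro sum_mono)
        fix j
        have "coord x i \<le> 0" using False by (simp add: coord_def)
        then show "(coord x j)^2 \<le> (coord (x - axis i 1) j)^2"
          by (auto simp: power2_diff)
      qed
      finally show ?thesis by (simp add: sqnorm_def coord_def)
    qed
    then have le: "2 / (sqnorm y + 1) \<le> 2 / (sqnorm x + 1)"
      by (intro divide_left_mono) (simp_all add: add_nonneg_pos)
    have "K * dipole i y \<le> K * (2 / (sqnorm x + 1))"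
      using dipole_bound[of i y] le K(2) by (intro mult_left_mono) auto
    then show ?thesis using half[OF y] e by (simp add: mult.commute)
  qed
  then show ?thesis using K(2) by (intro exI[of _ "2 * K"]) auto
qed

section \<open>Asymptotics of the Green function\<close>

lemma euclidean_norm_triangle: "euclidean_norm (x + y) \<le> euclidean_norm x + euclidean_norm (y :: int ^ 3)"
proof -
  have "(\<chi> i. real_of_int ((x + y) $ i)) = (\<chi> i. real_of_int (x $ i)) + (\<chi> i. real_of_int (y $ i))"
    by (simp add: vec_eq_iff)
  then show ?thesis unfolding euclidean_norm_def using norm_triangle_ineq by metis
qed

lemma euclidean_norm_minus [simp]: "euclidean_norm (- x) = euclidean_norm (x :: int ^ 3)"
  by (simp add: euclidean_norm_sqnorm sqnorm_def)

lemma euclidean_norm_diff: "euclidean_norm x - euclidean_norm y \<le> euclidean_norm (x - y :: int ^ 3)"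
  using euclidean_norm_triangle[of "x - y" y] by simp

lemma euclidean_norm_nonneg [simp]: "euclidean_norm (x :: int ^ 3) \<ge> 0"
  by (simp add: euclidean_norm_sqnorm)

lemma euclidean_norm_power2: "(euclidean_norm x)\<^sup>2 = sqnorm x"
  by (simp add: euclidean_norm_sqnorm)

lemma sqnorm_eq_0 [simp]: "sqnorm x = 0 \<longleftrightarrow> x = 0"
  unfolding sqnorm_def by (subst sum_nonneg_eq_0_iff) (auto simp: vec_eq_iff)

lemma sqnorm_ge_1: "x \<noteq> 0 \<Longrightarrow> sqnorm x \<ge> 1"
proof -
  assume "x \<noteq> 0"
  define n where "n = (\<Sum>i\<in>UNIV. (x $ i)^2)"
  have n: "sqnorm x = real_of_int n" by (simp add: n_def sqnorm_def)
  then have "n \<noteq> 0" using \<open>x \<noteq> 0\<close> sqnorm_eq_0[of x] by auto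
  moreover have "n \<ge> 0" unfolding n_def by (intro sum_nonneg) auto
  ultimately show ?thesis using n by simp
qed

lemma coord_abs_le: "\<bar>coord x i\<bar> \<le> euclidean_norm x"
  unfolding euclidean_norm_sqnorm using coord_sq_le[of x i] by (metis real_sqrt_abs real_sqrt_le_mono)

lemma sqnorm_diff_ge:
  assumes "4 * sqnorm z \<le> sqnorm x" shows "sqnorm (x - z) \<ge> sqnorm x / 4"
proof -
  have "2 * euclidean_norm z \<le> euclidean_norm x"
    using assms real_sqrt_le_mono[OF assms] by (simp add: euclidean_norm_sqnorm real_sqrt_mult)
  then have "euclidean_norm x / 2 \<le> euclidean_norm (x - z)" using euclidean_norm_diff[of x z] by linarith
  then have "(euclidean_norm x / 2)^2 \<le> (euclidean_norm (x - z))^2" by (intro power_mono) auto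
  then show ?thesis by (simp add: euclidean_norm_power2 power_divide)
qed

text \<open>Move from \<open>x\<close> to \<open>x - z\<close> in unit steps that shrink \<open>z\<close>. All sites on the way stay at
  distance at least \<open>|x| / 2\<close> from the origin.\<close>

lemma green_diff_path:
  assumes C: "C > 0" "\<And>x i. \<bar>green x - green (x - axis i 1)\<bar> \<le> C / (sqnorm x + 1)"
    and z: "4 * sqnorm z \<le> sqnorm x"
  shows "\<bar>green x - green (x - z)\<bar> \<le> real_of_int (\<Sum>i\<in>UNIV. \<bar>z $ i\<bar>) * (4 * C / (sqnorm x + 1))"
  using z
proof (induction "nat (\<Sum>i\<in>UNIV. \<bar>z $ i\<bar>)" arbitrary: z)
  case 0
  have "(\<Sum>i\<in>UNIV. \<bar>z $ i\<bar>) \<ge> 0" by (intro sum_nonneg) simp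
  moreover have "(\<Sum>i\<in>UNIV. \<bar>z $ i\<bar>) \<le> 0" using 0(1) by simp
  ultimately have "(\<Sum>i\<in>UNIV. \<bar>z $ i\<bar>) = 0" by linarith
  then have "z = 0" by (subst (asm) sum_nonneg_eq_0_iff) (auto simp: vec_eq_iff)
  then show ?case by simp
next
  case (Suc n)
  have step: "C / (sqnorm p + 1) \<le> 4 * C / (sqnorm x + 1)" if "sqnorm p \<ge> sqnorm x / 4" for p
  proof -
    have "C / (sqnorm p + 1) \<le> C / ((sqnorm x + 1) / 4)"
      using that C(1) sqnorm_1_pos[of x] sqnorm_1_pos[of p] by (intro divide_left_mono) (auto intro!: mult_pos_pos)
    then show ?thesis by (simp add: mult.commute)
  qed
  obtain i where i: "z $ i \<noteq> 0"
    using Suc.hyps(2) by (metis Zero_not_Suc abs_zero nat_zero_as_int sum.neutral zero_index)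
  \<comment> \<open>One unit closer to the origin than \<open>z\<close> along an axis.\<close>
  define w where "w = (if z $ i > 0 then z - axis i 1 else z + axis i 1)"
  have wj: "w $ j = (if j = i then (if z $ i > 0 then z $ i - 1 else z $ i + 1) else z $ j)" for j
    by (auto simp: w_def axis_def)
  have sw: "(\<Sum>i\<in>UNIV. \<bar>w $ i\<bar>) = (\<Sum>i\<in>UNIV. \<bar>z $ i\<bar>) - 1"
  proof -
    have "(\<Sum>j\<in>UNIV. \<bar>w $ j\<bar>) = \<bar>w $ i\<bar> + (\<Sum>j\<in>UNIV - {i}. \<bar>w $ j\<bar>)"
      "(\<Sum>j\<in>UNIV. \<bar>z $ j\<bar>) = \<bar>z $ i\<bar> + (\<Sum>j\<in>UNIV - {i}. \<bar>z $ j\<bar>)"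
      by (simp_all add: sum.remove)
    moreover have "(\<Sum>j\<in>UNIV - {i}. \<bar>w $ j\<bar>) = (\<Sum>j\<in>UNIV - {i}. \<bar>z $ j\<bar>)"
      by (intro sum.cong) (auto simp: wj)
    ultimately show ?thesis using i by (simp add: wj)
  qed
  have qw: "sqnorm w \<le> sqnorm z"
    unfolding sqnorm_def
  proof (intro sum_mono)
    fix j
    have "\<bar>w $ j\<bar> \<le> \<bar>z $ j\<bar>" using i by (auto simp: wj)
    then show "(real_of_int (w $ j))^2 \<le> (real_of_int (z $ j))^2"
      by (metis abs_le_square_iff of_int_abs of_int_le_iff)
  qed
  then have zw: "4 * sqnorm w \<le> sqnorm x" using Suc.prems by simp
  have "\<bar>green (x - w) - green (x - z)\<bar> \<le> 4 * C / (sqnorm x + 1)"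
  proof (cases "z $ i > 0")
    case True
    then have e: "x - z = (x - w) - axis i 1" by (simp add: w_def)
    show ?thesis
      unfolding e using C(2)[of "x - w" i] step[OF sqnorm_diff_ge[OF zw]] by linarith
  next
    case False
    then have e: "x - w = (x - z) - axis i 1" by (simp add: w_def)
    show ?thesis
      unfolding e using C(2)[of "x - z" i] step[OF sqnorm_diff_ge[OF Suc.prems]] by linarith
  qed
  moreover have "\<bar>green x - green (x - w)\<bar> \<le> real_of_int (\<Sum>i\<in>UNIV. \<bar>w $ i\<bar>) * (4 * C / (sqnorm x + 1))"
    using Suc.hyps(2) sw by (intro Suc.hyps(1) zw) auto
  ultimately have "\<bar>green x - green (x - z)\<bar> \<le>
     real_of_int (\<Sum>i\<in>UNIV. \<bar>w $ i\<bar>) * (4 * C / (sqnorm x + 1)) + 4 * C / (sqnorm x + 1)"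
    by linarith
  also have "\<dots> = real_of_int (\<Sum>i\<in>UNIV. \<bar>z $ i\<bar>) * (4 * C / (sqnorm x + 1))"
  proof -
    have "real_of_int (s - 1) * X + X = real_of_int s * X" for s X by (simp add: algebra_simps)
    then show ?thesis unfolding sw .
  qed
  finally show ?case .
qed

text \<open>The square root of a norm. Powers with half-integer exponent of the distance become natural
  powers of this quantity.\<close>

definition quarter_norm :: "int ^ 3 \<Rightarrow> real" where
  "quarter_norm x = sqrt (sqrt (sqnorm x + 1))"

lemma quarter_norm_ge_1: "quarter_norm x \<ge> 1"
  by (simp add: quarter_norm_def)

lemma quarter_norm_power4: "quarter_norm x ^ 4 = sqnorm x + 1"
proof -
  have "quarter_norm x ^ 4 = ((quarter_norm x)^2)^2" by (simp flip: power_mult)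
  then show ?thesis using sqnorm_nonneg[of x] by (simp add: quarter_norm_def)
qed

lemma quarter_norm_power2: "quarter_norm x ^ 2 = sqrt (sqnorm x + 1)"
  using sqnorm_nonneg[of x] by (simp add: quarter_norm_def)

text \<open>For \<open>z\<close> small compared with \<open>x\<close> this is weaker than the gradient bound, and for the other \<open>z\<close> it
  follows from boundedness. The exponent \<open>3/2\<close> of the distance is a compromise: it must exceed \<open>1\<close> to give an
  error term below \<open>1 / |x|\<close>, and be less than \<open>2\<close> so that the charge, which decays like \<open>|z| powr (- 5)\<close>,
  has a finite moment of this order.\<close>

lemma green_diff_bound:
  "\<exists>C>0. \<forall>x z. \<bar>green x - green (x - z)\<bar> \<le> C * quarter_norm z ^ 3 / quarter_norm x ^ 3"
proof -
  obtain C where C: "C > 0" "\<And>x i. \<bar>green x - green (x - axis i 1)\<bar> \<le> C / (sqnorm x + 1)"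
    using green_gradient by blast
  obtain M where M: "M > 0" "\<And>x. green x \<le> M / sqrt (sqnorm x + 1)" using green_bound by blast
  have M': "green x \<le> M" for x
  proof -
    have "M / sqrt (sqnorm x + 1) \<le> M / 1" using M(1) by (intro divide_left_mono) auto
    then show ?thesis using M(2)[of x] by simp
  qed
  have "\<bar>green x - green (x - z)\<bar> \<le> (12 * C + 8 * M) * quarter_norm z ^ 3 / quarter_norm x ^ 3" for x z
  proof (cases "4 * sqnorm z \<le> sqnorm x")
    case True
    have zi: "\<bar>real_of_int (z $ i)\<bar> \<le> quarter_norm z ^ 2" for i
    proof -
      have "euclidean_norm z \<le> quarter_norm z ^ 2" by (simp add: quarter_norm_power2 euclidean_norm_sqnorm)
      then show ?thesis using coord_abs_le[of z i] by (simp add: coord_def)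
    qed
    have "real_of_int (\<Sum>i\<in>UNIV. \<bar>z $ i\<bar>) \<le> 3 * quarter_norm z ^ 2"
      unfolding of_int_sum using sum_mono[of UNIV "\<lambda>i :: 3. \<bar>real_of_int (z $ i)\<bar>" "\<lambda>_. quarter_norm z ^ 2"] zi by simp
    also have "\<dots> \<le> 3 * quarter_norm z ^ 3" using power_increasing[OF _ quarter_norm_ge_1, of 2 3 z] by simp
    finally have "real_of_int (\<Sum>i\<in>UNIV. \<bar>z $ i\<bar>) * (4 * C / (sqnorm x + 1))
      \<le> 3 * quarter_norm z ^ 3 * (4 * C / (sqnorm x + 1))"
      using C(1) sqnorm_1_pos[of x] by (intro mult_right_mono divide_nonneg_pos) auto
    also have "\<dots> \<le> 3 * quarter_norm z ^ 3 * (4 * C / quarter_norm x ^ 3)"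
    proof -
      have "quarter_norm x ^ 3 \<le> sqnorm x + 1"
        using power_increasing[OF _ quarter_norm_ge_1, of 3 4 x] by (simp add: quarter_norm_power4)
      moreover have "quarter_norm x ^ 3 > 0" "quarter_norm z ^ 3 > 0"
        using quarter_norm_ge_1[of x] quarter_norm_ge_1[of z] by simp_all
      ultimately show ?thesis using C(1)
        by (intro mult_left_mono divide_left_mono) (auto intro!: mult_pos_pos)
    qed
    also have "\<dots> = 12 * C * (quarter_norm z ^ 3 / quarter_norm x ^ 3)" by simp
    also have "\<dots> \<le> (12 * C + 8 * M) * (quarter_norm z ^ 3 / quarter_norm x ^ 3)"
      using M(1) quarter_norm_ge_1[of x] quarter_norm_ge_1[of z] by (intro mult_right_mono) auto
    finally show ?thesis using green_diff_path[OF C True] by simp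
  next
    case False
    have "quarter_norm x ^ 4 \<le> (2 * quarter_norm z) ^ 4"
    proof -
      have "a < 4 * b \<Longrightarrow> 0 \<le> b \<Longrightarrow> a + 1 \<le> 16 * (b + 1)" for a b :: real by simp
      from this[OF not_le_imp_less[OF False] sqnorm_nonneg]
      have "sqnorm x + 1 \<le> 16 * (sqnorm z + 1)" .
      then show ?thesis unfolding power_mult_distrib quarter_norm_power4 by simp
    qed
    then have "quarter_norm x \<le> 2 * quarter_norm z"
      using quarter_norm_ge_1[of z] power_le_imp_le_base[of "quarter_norm x" 3 "2 * quarter_norm z"] by simp
    then have "quarter_norm x ^ 3 \<le> (2 * quarter_norm z) ^ 3" using quarter_norm_ge_1[of x] by (intro power_mono) auto
    then have "quarter_norm x ^ 3 \<le> 8 * quarter_norm z ^ 3" by (simp add: power_mult_distrib)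
    moreover have "0 < quarter_norm x ^ 3" using quarter_norm_ge_1[of x] by simp
    ultimately have "1 \<le> 8 * (quarter_norm z ^ 3 / quarter_norm x ^ 3)" by (simp add: pos_le_divide_eq)
    then have "M * 1 \<le> M * (8 * (quarter_norm z ^ 3 / quarter_norm x ^ 3))" using M(1) by (intro mult_left_mono) auto
    also have "\<dots> = 8 * M * (quarter_norm z ^ 3 / quarter_norm x ^ 3)" by simp
    also have "\<dots> \<le> (12 * C + 8 * M) * (quarter_norm z ^ 3 / quarter_norm x ^ 3)"
      using C(1) quarter_norm_ge_1[of x] quarter_norm_ge_1[of z] by (intro mult_right_mono) auto
    finally have "M \<le> (12 * C + 8 * M) * (quarter_norm z ^ 3 / quarter_norm x ^ 3)" by simp
    moreover have "\<bar>green x - green (x - z)\<bar> \<le> M"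
      using M'[of x] M'[of "x - z"] green_nonneg[of x] green_nonneg[of "x - z"] by linarith
    ultimately show ?thesis by simp
  qed
  then show ?thesis using C(1) M(1) by (intro exI[of _ "12 * C + 8 * M"]) auto
qed

lemma sum_int_powr_bounded: "\<exists>S. \<forall>A :: int set. finite A \<longrightarrow> (\<Sum>k\<in>A. (1 + (real_of_int k)\<^sup>2) powr (- 7/12)) \<le> S"
proof -
  define f where "f n = (1 + (real n)\<^sup>2) powr (- 7/12)" for n :: nat
  have "summable (\<lambda>n. real n powr (- 7/6))" by (simp add: summable_real_powr_iff)
  then have "summable (\<lambda>n. real (Suc n) powr (- 7/6))" by (subst summable_Suc_iff)
  then have "summable (\<lambda>n. f (Suc n))"
  proof (rule summable_comparison_test[rotated], intro exI allI impI)
    fix n :: nat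
    have "f (Suc n) \<le> ((real (Suc n))\<^sup>2) powr (- 7/12)"
      unfolding f_def by (intro powr_mono2') auto
    also have "\<dots> = real (Suc n) powr (- 7/6)" by (simp add: powr_powr flip: powr_numeral)
    finally show "norm (f (Suc n)) \<le> real (Suc n) powr (- 7/6)" by (simp add: f_def)
  qed
  then have sf: "summable f" by (subst (asm) summable_Suc_iff)
  have "(\<Sum>k\<in>A. (1 + (real_of_int k)\<^sup>2) powr (- 7/12)) \<le> 2 * suminf f" if A: "finite A" for A :: "int set"
  proof -
    have *: "(\<Sum>k\<in>B. (1 + (real_of_int k)\<^sup>2) powr (- 7/12)) \<le> suminf f"
      if "finite B" "inj_on (\<lambda>k. nat \<bar>k\<bar>) B" for B
    proof -
      have "(\<Sum>k\<in>B. (1 + (real_of_int k)\<^sup>2) powr (- 7/12)) = (\<Sum>k\<in>B. f (nat \<bar>k\<bar>))"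
        by (intro sum.cong) (auto simp: f_def)
      also have "\<dots> = sum f ((\<lambda>k. nat \<bar>k\<bar>) ` B)" using that by (simp add: sum.reindex)
      also have "\<dots> \<le> suminf f" using that sf by (intro sum_le_suminf) (auto simp: f_def)
      finally show ?thesis .
    qed
    have "A = (A \<inter> {0..}) \<union> (A \<inter> {..<0})" by auto
    then have "(\<Sum>k\<in>A. (1 + (real_of_int k)\<^sup>2) powr (- 7/12)) =
       (\<Sum>k\<in>A \<inter> {0..}. (1 + (real_of_int k)\<^sup>2) powr (- 7/12)) + (\<Sum>k\<in>A \<inter> {..<0}. (1 + (real_of_int k)\<^sup>2) powr (- 7/12))"
      using A by (subst (1) \<open>A = _\<close>, intro sum.union_disjoint) auto
    also have "\<dots> \<le> suminf f + suminf f"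
      using A by (intro add_mono *) (auto simp: inj_on_def)
    finally show ?thesis by simp
  qed
  then show ?thesis by blast
qed

text \<open>\<open>(1 + |z|^2) ^ 3\<close> is at least the product of the three factors \<open>1 + z_i^2\<close>, which
  splits the sum over the lattice into a product of convergent sums over the integers.\<close>

lemma quarter_norm_sum_bounded: "\<exists>S. \<forall>F. finite F \<longrightarrow> (\<Sum>z\<in>F. 1 / quarter_norm z ^ 7) \<le> S"
proof -
  define p where "p k = (1 + (real_of_int k)\<^sup>2) powr (- 7/12)" for k
  obtain S where S: "\<And>A. finite A \<Longrightarrow> sum p A \<le> S" unfolding p_def using sum_int_powr_bounded by blast
  have pp: "p k > 0" for k
  proof -
    have "1 + (real_of_int k)\<^sup>2 > 0" by (simp add: add_pos_nonneg)
    then show ?thesis by (simp add: p_def)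
  qed
  have pn: "p k \<ge> 0" for k using pp[of k] by linarith
  have each: "1 / quarter_norm z ^ 7 \<le> p (z $ 1) * p (z $ 2) * p (z $ 3)" for z
  proof -
    let ?t = "\<lambda>i. 1 + (real_of_int (z $ i))\<^sup>2"
    have tp: "?t i > 0" for i by (simp add: add_pos_nonneg)
    have tn: "?t i \<ge> 0" for i using tp[of i] by linarith
    have le: "?t i \<le> sqnorm z + 1" for i using coord_sq_le_sqnorm[of z i] by simp
    have "?t 1 * ?t 2 * ?t 3 \<le> (sqnorm z + 1) * (sqnorm z + 1) * (sqnorm z + 1)"
      by (intro mult_mono le tn mult_nonneg_nonneg) auto
    also have "\<dots> = quarter_norm z ^ 12" unfolding quarter_norm_power4[symmetric] by (simp flip: power_add)
    finally have "(quarter_norm z ^ 12) powr (- 7/12) \<le> (?t 1 * ?t 2 * ?t 3) powr (- 7/12)"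
      using tp by (intro powr_mono2') (auto intro!: mult_pos_pos)
    also have "\<dots> = p (z $ 1) * p (z $ 2) * p (z $ 3)"
      using tn by (simp add: p_def powr_mult mult_nonneg_nonneg)
    also have "(quarter_norm z ^ 12) powr (- 7/12) = 1 / quarter_norm z ^ 7"
    proof -
      have r: "quarter_norm z > 0" using quarter_norm_ge_1[of z] by linarith
      have "(quarter_norm z ^ 12) powr (- 7/12) = (quarter_norm z powr 12) powr (- 7/12)" using r by (simp add: powr_numeral)
      also have "\<dots> = quarter_norm z powr (- 7)" by (simp add: powr_powr)
      also have "\<dots> = 1 / quarter_norm z ^ 7" using r by (simp add: powr_minus_divide powr_numeral)
      finally show ?thesis .
    qed
    finally show ?thesis .
  qed
  have "(\<Sum>z\<in>F. 1 / quarter_norm z ^ 7) \<le> S * S * S" if F: "finite F" for F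
  proof -
    define A where "A = (\<Union>i. (\<lambda>z. z $ i) ` F)"
    have fA: "finite A" using F by (simp add: A_def)
    define \<phi> where "\<phi> z = ((z $ 1, z $ 2), z $ 3)" for z :: "int ^ 3"
    have inj: "inj_on \<phi> F" by (auto simp: inj_on_def \<phi>_def vec_eq_iff forall_3)
    have sub: "\<phi> ` F \<subseteq> (A \<times> A) \<times> A" by (auto simp: \<phi>_def A_def)
    have "(\<Sum>z\<in>F. 1 / quarter_norm z ^ 7) \<le> (\<Sum>z\<in>F. p (z $ 1) * p (z $ 2) * p (z $ 3))"
      by (intro sum_mono each)
    also have "\<dots> = (\<Sum>((a, b), c)\<in>\<phi> ` F. p a * p b * p c)"
      by (subst sum.reindex[OF inj]) (simp add: \<phi>_def)
    also have "\<dots> \<le> (\<Sum>((a, b), c)\<in>(A \<times> A) \<times> A. p a * p b * p c)"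
      using fA sub pn by (intro sum_mono2) (auto intro!: mult_nonneg_nonneg)
    also have "\<dots> = sum p A * sum p A * sum p A"
      by (simp only: sum_product sum.cartesian_product case_prod_unfold)
    also have "\<dots> \<le> S * S * S"
      using S[OF fA] S[of "{}"] by (intro mult_mono sum_nonneg mult_nonneg_nonneg pn) auto
    finally show ?thesis .
  qed
  then show ?thesis by blast
qed

lemma charge_decay: "charge z \<le> 1000 / quarter_norm z ^ 10"
proof -
  have "quarter_norm z ^ 10 = (quarter_norm z ^ 2) ^ 5" by (simp flip: power_mult)
  also have "\<dots> \<le> sqrt (sqnorm z + 1000) ^ 5" unfolding quarter_norm_power2 by (intro power_mono) auto
  finally have "1000 / sqrt (sqnorm z + 1000) ^ 5 \<le> 1000 / quarter_norm z ^ 10"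
    using quarter_norm_ge_1[of z] by (intro divide_left_mono) (auto intro!: mult_pos_pos add_nonneg_pos)
  then show ?thesis using charge_bounds(2)[of z] by linarith
qed

text \<open>The potentials of the truncated charge increase and stay below the Newton kernel. What is
  left in the limit is a harmonic function that tends to zero at infinity.\<close>

lemma newton_as_potential:
  "(\<lambda>n. \<Sum>z | sqnorm z \<le> real n. charge z * green (x - z)) \<longlonglongrightarrow> newton_kernel x"
proof -
  define F where "F n = {z. sqnorm z \<le> real n}" for n :: nat
  have fF: "finite (F n)" for n unfolding F_def by (rule finite_sqnorm_le)
  define u where "u n x = (\<Sum>z\<in>F n. charge z * green (x - z))" for n x
  have van_u: "vanishes_at_inf (u n)" for n
    unfolding u_def by (intro vanishes_at_inf_sum fF vanishes_at_inf_cmult vanishes_at_inf_shift green_vanishes)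
  have wu: "walk_mean (u n) x = u n x - (if x \<in> F n then charge x else 0)" for n x
  proof -
    have g: "walk_mean green (x - z) = green (x - z) - (if x = z then 1 else 0)" for z
      using green_eq[of "x - z"] by (auto split: if_splits)
    have "walk_mean (u n) x = (\<Sum>z\<in>F n. charge z * walk_mean green (x - z))"
      unfolding u_def walk_mean_sum walk_mean_cmult walk_mean_shift ..
    also have "\<dots> = (\<Sum>z\<in>F n. charge z * green (x - z) - (if x = z then charge x else 0))"
      unfolding g by (intro sum.cong) (auto simp: algebra_simps)
    also have "\<dots> = u n x - (if x \<in> F n then charge x else 0)"
      unfolding sum_subtractf u_def using fF by (simp add: sum.delta)
    finally show ?thesis .
  qed
  have le: "u n x \<le> newton_kernel x" for n x
  proof -
    have "newton_kernel x - u n x \<ge> 0"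
    proof (rule min_principle[of "\<lambda>x. newton_kernel x - u n x"])
      show "vanishes_at_inf (\<lambda>x. newton_kernel x - u n x)" by (intro vanishes_at_inf_diff newton_vanishes van_u)
      show "walk_mean (\<lambda>x. newton_kernel x - u n x) y \<le> newton_kernel y - u n y" for y
        unfolding walk_mean_diff wu using charge_nonneg[of y] by (simp add: charge_def)
    qed
    then show ?thesis by simp
  qed
  have inc: "incseq (\<lambda>n. u n x)" for x
    unfolding incseq_def u_def
    by (intro allI impI sum_mono2 fF) (auto simp: F_def charge_nonneg green_nonneg)
  have "\<exists>L. (\<lambda>n. u n x) \<longlonglongrightarrow> L" for x
  proof (rule incseq_convergent[OF inc[of x]])
    show "\<forall>i. u i x \<le> newton_kernel x" using le by simp
    show "(\<lambda>n. u n x) \<longlonglongrightarrow> L \<Longrightarrow> \<exists>L. (\<lambda>n. u n x) \<longlonglongrightarrow> L" for L by (rule exI)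
  qed
  then obtain L where L: "\<And>x. (\<lambda>n. u n x) \<longlonglongrightarrow> L x" by metis
  have u0: "u n x \<ge> 0" for n x
    unfolding u_def by (intro sum_nonneg mult_nonneg_nonneg charge_nonneg green_nonneg)
  have L_le: "L x \<le> newton_kernel x" for x by (rule LIMSEQ_le_const2[OF L]) (use le in auto)
  have L_ge: "L x \<ge> 0" for x by (rule LIMSEQ_le_const[OF L]) (use u0 in auto)
  have "newton_kernel x - L x = 0" for x
  proof (rule max_principle_eq_0[of "\<lambda>x. newton_kernel x - L x"])
    show "vanishes_at_inf (\<lambda>x. newton_kernel x - L x)"
    proof (rule vanishes_at_inf_le[OF newton_vanishes])
      show "\<bar>newton_kernel x - L x\<bar> \<le> \<bar>newton_kernel x\<bar>" for x using L_le[of x] L_ge[of x] by linarith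
    qed
    fix y
    have "(\<lambda>n. walk_mean (u n) y) \<longlonglongrightarrow> walk_mean L y" by (rule walk_mean_tendsto[OF L])
    moreover have "(\<lambda>n. walk_mean (u n) y) \<longlonglongrightarrow> L y - charge y"
    proof (rule Lim_transform_eventually)
      show "(\<lambda>n. u n y - charge y) \<longlonglongrightarrow> L y - charge y" by (intro tendsto_intros L)
      have "\<forall>\<^sub>F n in sequentially. sqnorm y \<le> real n"
        using filterlim_real_sequentially by (simp add: filterlim_at_top)
      then show "\<forall>\<^sub>F n in sequentially. u n y - charge y = walk_mean (u n) y"
        by eventually_elim (simp add: wu F_def)
    qed
    ultimately have "walk_mean L y = L y - charge y" by (rule LIMSEQ_unique)
    then show "walk_mean (\<lambda>x. newton_kernel x - L x) y = newton_kernel y - L y"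
      unfolding walk_mean_diff by (simp add: charge_def)
  qed
  then show ?thesis using L[of x] by (simp add: u_def F_def)
qed

text \<open>Here \<open>\<kappa>\<close> is the total charge. Seen from \<open>x\<close>, moving the charge at \<open>z\<close> to the origin changes its
  potential by at most the bound of \<open>green_diff_bound\<close>.\<close>

lemma green_newton: "\<exists>\<kappa>>0. \<exists>C>0. \<forall>x. \<bar>\<kappa> * green x - newton_kernel x\<bar> \<le> C / quarter_norm x ^ 3"
proof -
  obtain C where C: "C > 0" "\<And>x z. \<bar>green x - green (x - z)\<bar> \<le> C * quarter_norm z ^ 3 / quarter_norm x ^ 3"
    using green_diff_bound by blast
  obtain S where S: "\<And>F. finite F \<Longrightarrow> (\<Sum>z\<in>F. 1 / quarter_norm z ^ 7) \<le> S" using quarter_norm_sum_bounded by blast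
  have S0: "S \<ge> 0" using S[of "{}"] by simp
  define F where "F n = {z. sqnorm z \<le> real n}" for n :: nat
  have fF: "finite (F n)" for n unfolding F_def by (rule finite_sqnorm_le)
  define k where "k n = sum charge (F n)" for n
  have ch: "charge z * quarter_norm z ^ 3 \<le> 1000 * (1 / quarter_norm z ^ 7)" for z
  proof -
    have r: "quarter_norm z > 0" using quarter_norm_ge_1[of z] by linarith
    have "charge z * quarter_norm z ^ 3 \<le> 1000 / quarter_norm z ^ 10 * quarter_norm z ^ 3"
      using charge_decay[of z] r by (intro mult_right_mono) auto
    also have "quarter_norm z ^ 10 = quarter_norm z ^ 7 * quarter_norm z ^ 3" by (simp flip: power_add)
    also have "1000 / (quarter_norm z ^ 7 * quarter_norm z ^ 3) * quarter_norm z ^ 3 = 1000 * (1 / quarter_norm z ^ 7)"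
    proof -
      have "B > 0 \<Longrightarrow> 1000 / (A * B) * B = 1000 * (1 / A)" for A B :: real by simp
      then show ?thesis using zero_less_power[OF r, of 3] .
    qed
    finally show ?thesis .
  qed
  have sum_ch: "(\<Sum>z\<in>F n. charge z * quarter_norm z ^ 3) \<le> 1000 * S" for n
  proof -
    have "(\<Sum>z\<in>F n. charge z * quarter_norm z ^ 3) \<le> (\<Sum>z\<in>F n. 1000 * (1 / quarter_norm z ^ 7))"
      by (intro sum_mono ch)
    also have "\<dots> \<le> 1000 * S" using S[OF fF[of n]] unfolding sum_distrib_left[symmetric] by simp
    finally show ?thesis .
  qed
  have k_le: "k n \<le> 1000 * S" for n
  proof -
    have "k n \<le> (\<Sum>z\<in>F n. charge z * quarter_norm z ^ 3)"
      unfolding k_def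
    proof (rule sum_mono)
      fix z
      have "charge z * 1 \<le> charge z * quarter_norm z ^ 3"
        by (intro mult_left_mono one_le_power quarter_norm_ge_1 charge_nonneg)
      then show "charge z \<le> charge z * quarter_norm z ^ 3" by simp
    qed
    then show ?thesis using sum_ch[of n] by simp
  qed
  have k_inc: "incseq k"
    unfolding incseq_def k_def by (intro allI impI sum_mono2 fF) (auto simp: F_def charge_nonneg)
  obtain \<kappa> where \<kappa>: "k \<longlonglongrightarrow> \<kappa>" "\<forall>n. k n \<le> \<kappa>"
  proof (rule incseq_convergent[OF k_inc])
    show "\<forall>i. k i \<le> 1000 * S" using k_le by simp
  qed
  have "charge 0 > 0"
  proof -
    have "0 < 1 / sqrt (sqnorm 0 + 1000) ^ 5" by (auto simp: sqnorm_def)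
    then show ?thesis using charge_bounds(1)[of 0] by linarith
  qed
  moreover have "charge 0 \<le> k 0"
    unfolding k_def by (rule member_le_sum[OF _ charge_nonneg fF]) (simp add: F_def sqnorm_def)
  ultimately have kp: "\<kappa> > 0" using \<kappa>(2)[rule_format, of 0] by linarith
  have "\<bar>\<kappa> * green x - newton_kernel x\<bar> \<le> (C * 1000 * S + 1) / quarter_norm x ^ 3" for x
  proof -
    have r: "quarter_norm x ^ 3 > 0" using quarter_norm_ge_1[of x] by simp
    have "\<bar>k n * green x - (\<Sum>z\<in>F n. charge z * green (x - z))\<bar> \<le> (C * 1000 * S) / quarter_norm x ^ 3" for n
    proof -
      have "k n * green x - (\<Sum>z\<in>F n. charge z * green (x - z)) = (\<Sum>z\<in>F n. charge z * (green x - green (x - z)))"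
        by (simp add: k_def sum_distrib_right right_diff_distrib sum_subtractf)
      also have "\<bar>\<dots>\<bar> \<le> (\<Sum>z\<in>F n. \<bar>charge z * (green x - green (x - z))\<bar>)" by (rule sum_abs)
      also have "\<dots> \<le> (\<Sum>z\<in>F n. C / quarter_norm x ^ 3 * (charge z * quarter_norm z ^ 3))"
      proof (intro sum_mono)
        fix z
        have "\<bar>charge z * (green x - green (x - z))\<bar> \<le> charge z * (C * quarter_norm z ^ 3 / quarter_norm x ^ 3)"
          unfolding abs_mult abs_of_nonneg[OF charge_nonneg] by (rule mult_left_mono[OF C(2) charge_nonneg])
        also have "\<dots> = C / quarter_norm x ^ 3 * (charge z * quarter_norm z ^ 3)" by simp
        finally show "\<bar>charge z * (green x - green (x - z))\<bar> \<le> C / quarter_norm x ^ 3 * (charge z * quarter_norm z ^ 3)" .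
      qed
      also have "\<dots> \<le> C / quarter_norm x ^ 3 * (1000 * S)"
        unfolding sum_distrib_left[symmetric] using sum_ch[of n] C(1) r by (intro mult_left_mono) auto
      finally show ?thesis by (simp add: mult.assoc)
    qed
    moreover have "(\<lambda>n. \<bar>k n * green x - (\<Sum>z\<in>F n. charge z * green (x - z))\<bar>) \<longlonglongrightarrow> \<bar>\<kappa> * green x - newton_kernel x\<bar>"
      unfolding F_def by (intro tendsto_intros \<kappa> newton_as_potential)
    ultimately have "\<bar>\<kappa> * green x - newton_kernel x\<bar> \<le> (C * 1000 * S) / quarter_norm x ^ 3"
      by (meson LIMSEQ_le_const2)
    also have "\<dots> \<le> (C * 1000 * S + 1) / quarter_norm x ^ 3" using r by (intro divide_right_mono) auto
    finally show ?thesis .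
  qed
  moreover have "C * 1000 * S + 1 > 0" using C(1) S0 by (simp add: add_nonneg_pos)
  ultimately show ?thesis using kp by blast
qed

lemma green_asymptotics:
  "\<exists>g>0. \<exists>C>0. \<forall>x. x \<noteq> 0 \<longrightarrow> \<bar>green x - g / euclidean_norm x\<bar> \<le> C / (euclidean_norm x * sqrt (euclidean_norm x))"
proof -
  obtain \<kappa> C where \<kappa>: "\<kappa> > 0" "C > 0" "\<And>x. \<bar>\<kappa> * green x - newton_kernel x\<bar> \<le> C / quarter_norm x ^ 3"
    using green_newton by blast
  have "\<bar>green x - (1/\<kappa>) / euclidean_norm x\<bar> \<le> ((C + 1000) / \<kappa>) / (euclidean_norm x * sqrt (euclidean_norm x))"
    if "x \<noteq> 0" for x
  proof -
    define r where "r = euclidean_norm x"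
    have r: "r \<ge> 1" "r^2 = sqnorm x"
      using sqnorm_ge_1[OF that] by (auto simp: r_def euclidean_norm_sqnorm)
    have q: "quarter_norm x ^ 3 \<ge> r * sqrt r"
    proof -
      have "quarter_norm x \<ge> sqrt r" by (simp add: quarter_norm_def r_def euclidean_norm_sqnorm)
      then have "quarter_norm x ^ 3 \<ge> sqrt r ^ 3" using r by (intro power_mono) auto
      moreover have "sqrt r ^ 3 = r * sqrt r" using r by (simp add: power3_eq_cube)
      ultimately show ?thesis by simp
    qed
    have rp: "r * sqrt r > 0" using r by simp
    have 1: "C / quarter_norm x ^ 3 \<le> C / (r * sqrt r)"
      using q rp r(1) \<kappa>(2) quarter_norm_ge_1[of x] by (intro divide_left_mono mult_pos_pos zero_less_power) auto
    have 2: "\<bar>newton_kernel x - 1 / r\<bar> \<le> 1000 / (r * sqrt r)"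
    proof -
      define s where "s = sqrt (r^2 + 1000)"
      have n: "newton_kernel x = 1 / s" by (simp add: newton_kernel_def s_def r)
      have s: "s \<ge> r" "s^2 = r^2 + 1000" using r(1) by (auto simp: s_def real_le_rsqrt)
      have "(s - r) * (s + r) = 1000" using s(2) by (simp add: power2_eq_square algebra_simps)
      moreover have "(s - r) * (s + r) \<ge> (s - r) * 1" using s(1) r(1) by (intro mult_left_mono) auto
      ultimately have sr: "s - r \<le> 1000" by simp
      have "\<bar>newton_kernel x - 1 / r\<bar> = (s - r) / (r * s)" using s r by (simp add: n field_simps abs_if)
      also have "\<dots> \<le> 1000 / (r * s)" using sr s r by (intro divide_right_mono) auto
      also have "\<dots> \<le> 1000 / (r * sqrt r)"
      proof -
        have "sqrt r \<le> r" using r(1) by (intro real_le_lsqrt) (auto intro: self_le_power)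
        then have "r * sqrt r \<le> r * s" using s r by (intro mult_left_mono) auto
        then show ?thesis using rp by (intro divide_left_mono) (auto intro!: mult_pos_pos)
      qed
      finally show ?thesis .
    qed
    have "\<bar>\<kappa> * green x - 1 / r\<bar> \<le> (C + 1000) / (r * sqrt r)"
      using \<kappa>(3)[of x] 1 2 by (simp add: add_divide_distrib)
    then have "\<bar>\<kappa> * green x - 1 / r\<bar> / \<kappa> \<le> (C + 1000) / (r * sqrt r) / \<kappa>"
      using \<kappa>(1) by (intro divide_right_mono) auto
    moreover have "\<bar>\<kappa> * green x - 1 / r\<bar> / \<kappa> = \<bar>green x - (1/\<kappa>) / r\<bar>"
    proof -
      have "\<bar>\<kappa> * green x - 1 / r\<bar> / \<kappa> = \<bar>(\<kappa> * green x - 1 / r) / \<kappa>\<bar>" using \<kappa>(1) by simp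
      also have "(\<kappa> * green x - 1 / r) / \<kappa> = green x - (1/\<kappa>) / r" using \<kappa>(1) by (simp add: diff_divide_distrib)
      finally show ?thesis .
    qed
    ultimately show ?thesis by (simp add: r_def mult_ac)
  qed
  then show ?thesis using \<kappa> by (intro exI[of _ "1/\<kappa>"] conjI exI[of _ "(C + 1000) / \<kappa>"]) auto
qed

section \<open>Hitting probabilities, equilibrium charge and capacity\<close>

text \<open>The probability that the walk from \<open>x\<close> meets \<open>X\<close> within \<open>n\<close> steps, counting time \<open>0\<close>, and does so first
  at a site of \<open>Y\<close>. A recursion in \<open>n\<close> is used, and not a harmonic function with given boundary values,
  because constants are harmonic too: decay at infinity comes from the recursion.\<close>

primrec hit_within :: "(int ^ 3) set \<Rightarrow> (int ^ 3) set \<Rightarrow> nat \<Rightarrow> int ^ 3 \<Rightarrow> real" where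
  "hit_within X Y 0 = (\<lambda>x. indicat_real (X \<inter> Y) x)"
| "hit_within X Y (Suc n) = (\<lambda>x. if x \<in> X then indicat_real Y x else walk_mean (hit_within X Y n) x)"

definition hit_prob :: "(int ^ 3) set \<Rightarrow> (int ^ 3) set \<Rightarrow> int ^ 3 \<Rightarrow> real" where
  "hit_prob X Y x = lim (\<lambda>n. hit_within X Y n x)"

lemma green_0_ge_1: "green 0 \<ge> 1"
proof -
  have "walk_mean green 0 \<ge> walk_mean (\<lambda>_. 0) 0" by (intro walk_mean_mono green_nonneg)
  then show ?thesis using green_eq[of 0] by simp
qed

lemma hit_within_nonneg: "hit_within X Y n x \<ge> 0"
proof (induction n arbitrary: x)
  case 0 then show ?case by simp
next
  case (Suc n)
  have "walk_mean (hit_within X Y n) x \<ge> walk_mean (\<lambda>_. 0) x" by (intro walk_mean_mono Suc.IH)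
  then show ?case by simp
qed

lemma hit_within_le_1: "hit_within X Y n x \<le> 1"
proof (induction n arbitrary: x)
  case 0 then show ?case by (simp add: indicator_def)
next
  case (Suc n)
  have "walk_mean (hit_within X Y n) x \<le> walk_mean (\<lambda>_. 1) x" by (intro walk_mean_mono Suc.IH)
  then show ?case by (simp add: indicator_def)
qed

lemma hit_within_in: "x \<in> X \<Longrightarrow> hit_within X Y n x = indicator Y x"
  by (cases n) (auto simp: indicator_def)

lemma hit_within_mono: "hit_within X Y n x \<le> hit_within X Y (Suc n) x"
proof (induction n arbitrary: x)
  case 0
  have "walk_mean (hit_within X Y 0) x \<ge> walk_mean (\<lambda>_. 0) x" by (intro walk_mean_mono hit_within_nonneg)
  then show ?case by (simp add: indicator_def)
next
  case (Suc n)
  have "walk_mean (hit_within X Y n) x \<le> walk_mean (hit_within X Y (Suc n)) x"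
    by (intro walk_mean_mono Suc.IH)
  then show ?case by simp
qed

lemma hit_within_le_green:
  assumes "finite X" shows "hit_within X Y n x \<le> (\<Sum>z\<in>X. green (x - z))"
proof (induction n arbitrary: x)
  have *: "(\<Sum>z\<in>X. green (x - z)) \<ge> 1" if "x \<in> X" for x
  proof -
    have "green (x - x) \<le> (\<Sum>z\<in>X. green (x - z))"
      using that assms by (intro member_le_sum) (auto simp: green_nonneg)
    then show ?thesis using green_0_ge_1 by simp
  qed
  {
    case 0 show ?case
    proof (cases "x \<in> X")
      case True then show ?thesis using *[OF True] by (simp add: indicator_def)
    next
      case False then show ?thesis by (simp add: sum_nonneg green_nonneg)
    qed
  next
    case (Suc n) show ?case
    proof (cases "x \<in> X")
      case True then show ?thesis using *[OF True] by (simp add: indicator_def)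
    next
      case False
      have "walk_mean (hit_within X Y n) x \<le> walk_mean (\<lambda>x. \<Sum>z\<in>X. green (x - z)) x"
        by (intro walk_mean_mono Suc.IH)
      also have "\<dots> = (\<Sum>z\<in>X. walk_mean green (x - z))" unfolding walk_mean_sum walk_mean_shift ..
      also have "\<dots> \<le> (\<Sum>z\<in>X. green (x - z))"
        by (intro sum_mono) (simp add: walk_mean_green)
      finally show ?thesis using False by simp
    qed
  }
qed

lemma hit_prob_tendsto: "(\<lambda>n. hit_within X Y n x) \<longlonglongrightarrow> hit_prob X Y x"
proof (rule incseq_convergent)
  show "incseq (\<lambda>n. hit_within X Y n x)" by (intro incseq_SucI hit_within_mono)
  show "\<forall>i. hit_within X Y i x \<le> 1" using hit_within_le_1 by simp
  fix L assume "(\<lambda>n. hit_within X Y n x) \<longlonglongrightarrow> L"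
  then show ?thesis by (simp add: hit_prob_def limI)
qed

lemma hit_prob_nonneg: "hit_prob X Y x \<ge> 0"
  by (rule LIMSEQ_le_const[OF hit_prob_tendsto]) (use hit_within_nonneg in auto)

lemma hit_prob_le_1: "hit_prob X Y x \<le> 1"
  by (rule LIMSEQ_le_const2[OF hit_prob_tendsto]) (use hit_within_le_1 in auto)

lemma hit_prob_in: "x \<in> X \<Longrightarrow> hit_prob X Y x = indicator Y x"
  using hit_prob_tendsto[of X Y x] by (simp add: hit_within_in LIMSEQ_const_iff)

lemma hit_prob_out:
  assumes "x \<notin> X" shows "walk_mean (hit_prob X Y) x = hit_prob X Y x"
proof -
  have "(\<lambda>n. hit_within X Y (Suc n) x) \<longlonglongrightarrow> walk_mean (hit_prob X Y) x"
    using assms by (simp add: walk_mean_tendsto hit_prob_tendsto)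
  moreover have "(\<lambda>n. hit_within X Y (Suc n) x) \<longlonglongrightarrow> hit_prob X Y x"
    by (rule LIMSEQ_Suc[OF hit_prob_tendsto])
  ultimately show ?thesis by (rule LIMSEQ_unique)
qed

lemma hit_prob_vanishes:
  assumes "finite X" shows "vanishes_at_inf (hit_prob X Y)"
proof (rule vanishes_at_inf_le)
  show "vanishes_at_inf (\<lambda>x. \<Sum>z\<in>X. green (x - z))"
    by (intro vanishes_at_inf_sum assms vanishes_at_inf_shift green_vanishes)
  fix x
  have "hit_prob X Y x \<le> (\<Sum>z\<in>X. green (x - z))"
    by (rule LIMSEQ_le_const2[OF hit_prob_tendsto]) (use hit_within_le_green[OF assms] in auto)
  then show "\<bar>hit_prob X Y x\<bar> \<le> \<bar>\<Sum>z\<in>X. green (x - z)\<bar>"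
    using hit_prob_nonneg[of X Y x] by linarith
qed

text \<open>On \<open>X - B\<close> the larger set has hitting probability \<open>1\<close>.\<close>

lemma hit_prob_mono:
  assumes "B \<subseteq> X" shows "hit_prob B B x \<le> hit_prob X X x"
proof -
  have "hit_within B B n x \<le> hit_within X X n x" for n
  proof (induction n arbitrary: x)
    case 0 then show ?case using assms by (auto simp: indicator_def)
  next
    case (Suc n)
    have le: "walk_mean (hit_within B B n) x \<le> walk_mean (hit_within X X n) x" by (intro walk_mean_mono Suc.IH)
    consider "x \<in> B" | "x \<notin> B" "x \<in> X" | "x \<notin> X" by blast
    then show ?case
    proof cases
      case 1 then show ?thesis using assms by auto
    next
      case 2 then show ?thesis using hit_within_le_1[of B B "Suc n" x] by simp
    next
      case 3
      then have "x \<notin> B" using assms by blast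
      then show ?thesis using 3 le by simp
    qed
  qed
  then show ?thesis by (intro LIMSEQ_le[OF hit_prob_tendsto hit_prob_tendsto]) auto
qed

text \<open>The charge of the hitting probability. For \<open>Y = X\<close> and a site of \<open>X\<close> it is the probability of
  never returning to \<open>X\<close>.\<close>

definition equilibrium :: "(int ^ 3) set \<Rightarrow> (int ^ 3) set \<Rightarrow> int ^ 3 \<Rightarrow> real" where
  "equilibrium X Y x = hit_prob X Y x - walk_mean (hit_prob X Y) x"

definition capacity :: "(int ^ 3) set \<Rightarrow> real" where
  "capacity X = (\<Sum>z\<in>X. equilibrium X X z)"

lemma equilibrium_out: "x \<notin> X \<Longrightarrow> equilibrium X Y x = 0"
  by (simp add: equilibrium_def hit_prob_out)

lemma equilibrium_nonneg: "equilibrium X X x \<ge> 0"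
proof (cases "x \<in> X")
  case True
  have "walk_mean (hit_prob X X) x \<le> walk_mean (\<lambda>_. 1) x" by (intro walk_mean_mono hit_prob_le_1)
  then show ?thesis using True by (simp add: equilibrium_def hit_prob_in)
qed (simp add: equilibrium_out)

lemma equilibrium_antimono:
  assumes "B \<subseteq> X" "y \<in> B" shows "equilibrium X X y \<le> equilibrium B B y"
proof -
  have "walk_mean (hit_prob B B) y \<le> walk_mean (hit_prob X X) y"
    by (intro walk_mean_mono hit_prob_mono assms)
  then show ?thesis using assms by (auto simp: equilibrium_def hit_prob_in)
qed

text \<open>Both sides have the same charge and tend to zero at infinity.\<close>

lemma hit_prob_potential:
  assumes "finite X" shows "hit_prob X Y x = (\<Sum>z\<in>X. equilibrium X Y z * green (x - z))"
proof -
  define u where "u x = (\<Sum>z\<in>X. equilibrium X Y z * green (x - z))" for x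
  have wu: "walk_mean u x = u x - equilibrium X Y x" for x
  proof -
    have "walk_mean u x = (\<Sum>z\<in>X. equilibrium X Y z * walk_mean green (x - z))"
      unfolding u_def walk_mean_sum walk_mean_cmult walk_mean_shift ..
    also have "\<dots> = (\<Sum>z\<in>X. equilibrium X Y z * green (x - z) - (if x = z then equilibrium X Y z else 0))"
      unfolding walk_mean_green by (intro sum.cong) (auto simp: algebra_simps)
    also have "\<dots> = u x - (if x \<in> X then equilibrium X Y x else 0)"
      unfolding sum_subtractf u_def using assms by (simp add: sum.delta)
    finally show ?thesis by (auto simp: equilibrium_out)
  qed
  have "hit_prob X Y x - u x = 0"
  proof (rule max_principle_eq_0[of "\<lambda>x. hit_prob X Y x - u x"])
    show "vanishes_at_inf (\<lambda>x. hit_prob X Y x - u x)"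
      unfolding u_def
      by (intro vanishes_at_inf_diff hit_prob_vanishes vanishes_at_inf_sum assms vanishes_at_inf_cmult vanishes_at_inf_shift green_vanishes)
    show "walk_mean (\<lambda>x. hit_prob X Y x - u x) y = hit_prob X Y y - u y" for y
      unfolding walk_mean_diff wu by (simp add: equilibrium_def)
  qed
  then show ?thesis by (simp add: u_def)
qed

lemma capacity_pos:
  assumes "finite X" "X \<noteq> {}" shows "capacity X > 0"
proof -
  obtain x where x: "x \<in> X" using assms by blast
  have "capacity X \<noteq> 0"
  proof
    assume "capacity X = 0"
    then have "\<And>z. z \<in> X \<Longrightarrow> equilibrium X X z = 0"
      unfolding capacity_def using assms equilibrium_nonneg by (subst (asm) sum_nonneg_eq_0_iff) auto
    then have "hit_prob X X x = 0" using hit_prob_potential[OF assms(1), of X x] by simp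
    then show False using x by (simp add: hit_prob_in)
  qed
  moreover have "capacity X \<ge> 0" unfolding capacity_def by (intro sum_nonneg equilibrium_nonneg)
  ultimately show ?thesis by simp
qed

text \<open>Reciprocity: the charges \<open>equilibrium X {y}\<close> are the rows of the inverse of the Green matrix
  of \<open>X\<close>, which is symmetric, and \<open>equilibrium X X\<close> is the sum of the rows.\<close>

lemma sum_equilibrium_point:
  assumes X: "finite X" and y: "y \<in> X"
  shows "(\<Sum>z\<in>X. equilibrium X {y} z) = equilibrium X X y"
proof -
  have sym: "green (a - b) = green (b - a)" for a b using green_uminus[of "a - b"] by simp
  have "(\<Sum>z\<in>X. equilibrium X {y} z) = (\<Sum>z\<in>X. equilibrium X {y} z * hit_prob X X z)"
    by (intro sum.cong) (auto simp: hit_prob_in)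
  also have "\<dots> = (\<Sum>z\<in>X. \<Sum>a\<in>X. equilibrium X {y} z * (equilibrium X X a * green (z - a)))"
    unfolding hit_prob_potential[OF X, of X] sum_distrib_left ..
  also have "\<dots> = (\<Sum>a\<in>X. \<Sum>z\<in>X. equilibrium X X a * (equilibrium X {y} z * green (a - z)))"
    by (subst sum.swap) (simp add: sym mult.left_commute)
  also have "\<dots> = (\<Sum>a\<in>X. equilibrium X X a * hit_prob X {y} a)"
    unfolding hit_prob_potential[OF X, of "{y}"] sum_distrib_left ..
  also have "\<dots> = (\<Sum>a\<in>X. if y = a then equilibrium X X a else 0)"
    by (intro sum.cong) (auto simp: hit_prob_in indicator_def)
  also have "\<dots> = equilibrium X X y" using X y by (simp add: sum.delta)
  finally show ?thesis .
qed

abbreviation at_inf :: "(int ^ 3) filter" where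
  "at_inf \<equiv> filtercomap euclidean_norm at_top"

lemma at_inf_neq_bot: "at_inf \<noteq> bot"
proof -
  have "\<exists>x :: int ^ 3. euclidean_norm x > c" for c
  proof -
    obtain n :: nat where n: "real n > c" using reals_Archimedean2 by blast
    have "euclidean_norm (axis 1 (int n) :: int ^ 3) \<ge> real n"
      using coord_abs_le[of "axis 1 (int n)" 1] by (simp add: coord_def axis_def)
    then show ?thesis using n by (meson order_less_le_trans)
  qed
  then show ?thesis
    unfolding trivial_limit_def eventually_filtercomap eventually_at_top_linorder
    by (metis order_less_imp_le)
qed

lemma filterlim_norm_at_inf: "filterlim euclidean_norm at_top at_inf"
  by (rule filterlim_filtercomap)

lemma filterlim_shift_at_inf: "filterlim (\<lambda>x. x - z) at_inf at_inf"
  unfolding filterlim_filtercomap_iff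
proof (rule filterlim_at_top_mono)
  show "filterlim (\<lambda>x. - euclidean_norm z + euclidean_norm x) at_top at_inf"
    by (rule filterlim_tendsto_add_at_top[OF tendsto_const filterlim_norm_at_inf])
  show "\<forall>\<^sub>F x in at_inf. - euclidean_norm z + euclidean_norm x \<le> (euclidean_norm \<circ> (\<lambda>x. x - z)) x"
    using euclidean_norm_diff[of _ z] by (intro always_eventually) (auto simp: algebra_simps)
qed

lemma eventually_at_inf_notin: "finite X \<Longrightarrow> \<forall>\<^sub>F x in at_inf. x \<notin> X"
proof -
  assume X: "finite X"
  have "\<forall>\<^sub>F x in at_inf. euclidean_norm x \<ge> (\<Sum>z\<in>X. euclidean_norm z) + 1"
    using filterlim_norm_at_inf by (auto simp: filterlim_at_top)
  then show ?thesis
  proof eventually_elim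
    case (elim x)
    have "euclidean_norm x \<le> (\<Sum>z\<in>X. euclidean_norm z)" if "x \<in> X"
      using that X by (intro member_le_sum) auto
    then show ?case using elim by force
  qed
qed

text \<open>A fixed translation does not matter at infinity.\<close>

lemma green_scaled_tendsto:
  obtains g where "g > 0" "\<And>z. ((\<lambda>x. green (x - z) * euclidean_norm x) \<longlongrightarrow> g) at_inf"
proof -
  obtain g C where g: "g > 0" "C > 0" and
    b: "\<And>x. x \<noteq> 0 \<Longrightarrow> \<bar>green x - g / euclidean_norm x\<bar> \<le> C / (euclidean_norm x * sqrt (euclidean_norm x))"
    using green_asymptotics by blast
  have inv0: "((\<lambda>x. C / sqrt (euclidean_norm x)) \<longlongrightarrow> 0) at_inf"
    by (intro real_tendsto_divide_at_top[OF tendsto_const] filterlim_compose[OF sqrt_at_top filterlim_norm_at_inf])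
  have lim0: "((\<lambda>x. green x * euclidean_norm x) \<longlongrightarrow> g) at_inf"
  proof (rule LIM_zero_cancel, rule Lim_null_comparison[OF _ inv0])
    have "\<forall>\<^sub>F x in at_inf. x \<notin> {0 :: int ^ 3}" by (rule eventually_at_inf_notin) simp
    then show "\<forall>\<^sub>F x in at_inf. norm (green x * euclidean_norm x - g) \<le> C / sqrt (euclidean_norm x)"
    proof eventually_elim
      case (elim x)
      then have x0: "x \<noteq> 0" by simp
      have r: "euclidean_norm x > 0" using sqnorm_ge_1[OF x0] by (simp add: euclidean_norm_sqnorm)
      have "green x * euclidean_norm x - g = (green x - g / euclidean_norm x) * euclidean_norm x"
        using r by (simp add: left_diff_distrib)
      then have "\<bar>green x * euclidean_norm x - g\<bar> = \<bar>green x - g / euclidean_norm x\<bar> * euclidean_norm x"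
        using r by (simp add: abs_mult)
      also have "\<dots> \<le> C / (euclidean_norm x * sqrt (euclidean_norm x)) * euclidean_norm x"
        using b[OF x0] r by (intro mult_right_mono) auto
      also have "\<dots> = C / sqrt (euclidean_norm x)" using r by simp
      finally show ?case by simp
    qed
  qed
  have ratio: "((\<lambda>x. euclidean_norm x / euclidean_norm (x - z)) \<longlongrightarrow> 1) at_inf" for z
  proof (rule LIM_zero_cancel, rule Lim_null_comparison)
    have shift: "filterlim (\<lambda>x. euclidean_norm (x - z)) at_top at_inf"
      by (rule filterlim_compose[OF filterlim_norm_at_inf filterlim_shift_at_inf])
    show "((\<lambda>x. euclidean_norm z / euclidean_norm (x - z)) \<longlongrightarrow> 0) at_inf"
      by (rule real_tendsto_divide_at_top[OF tendsto_const shift])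
    have "\<forall>\<^sub>F x in at_inf. x \<notin> {z}" by (rule eventually_at_inf_notin) simp
    then show "\<forall>\<^sub>F x in at_inf. norm (euclidean_norm x / euclidean_norm (x - z) - 1)
       \<le> euclidean_norm z / euclidean_norm (x - z)"
    proof eventually_elim
      case (elim x)
      then have x0: "x - z \<noteq> 0" by simp
      have r: "euclidean_norm (x - z) > 0" using sqnorm_ge_1[OF x0] by (simp add: euclidean_norm_sqnorm)
      have "\<bar>euclidean_norm x - euclidean_norm (x - z)\<bar> \<le> euclidean_norm z"
        using euclidean_norm_diff[of x z] euclidean_norm_triangle[of x "- z"] euclidean_norm_triangle[of "x - z" z]
        by (simp add: abs_le_iff)
      then have "\<bar>euclidean_norm x - euclidean_norm (x - z)\<bar> / euclidean_norm (x - z) \<le> euclidean_norm z / euclidean_norm (x - z)"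
        using r by (intro divide_right_mono) auto
      moreover have "euclidean_norm x / euclidean_norm (x - z) - 1 = (euclidean_norm x - euclidean_norm (x - z)) / euclidean_norm (x - z)"
        using r by (simp add: diff_divide_distrib)
      ultimately show ?case using r by simp
    qed
  qed
  have "((\<lambda>x. green (x - z) * euclidean_norm x) \<longlongrightarrow> g) at_inf" for z
  proof -
    have "((\<lambda>x. (green (x - z) * euclidean_norm (x - z)) * (euclidean_norm x / euclidean_norm (x - z))) \<longlongrightarrow> g * 1) at_inf"
      by (intro tendsto_mult ratio filterlim_compose[OF lim0 filterlim_shift_at_inf])
    then have "((\<lambda>x. (green (x - z) * euclidean_norm (x - z)) * (euclidean_norm x / euclidean_norm (x - z))) \<longlongrightarrow> g) at_inf"
      by simp
    then show ?thesis
    proof (rule Lim_transform_eventually)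
      have "\<forall>\<^sub>F x in at_inf. x \<notin> {z}" by (rule eventually_at_inf_notin) simp
      then show "\<forall>\<^sub>F x in at_inf. green (x - z) * euclidean_norm (x - z) * (euclidean_norm x / euclidean_norm (x - z))
         = green (x - z) * euclidean_norm x"
      proof eventually_elim
        case (elim x)
        then have x0: "x - z \<noteq> 0" by simp
        have r: "euclidean_norm (x - z) > 0" using sqnorm_ge_1[OF x0] by (simp add: euclidean_norm_sqnorm)
        then show ?case by simp
      qed
    qed
  qed
  then show thesis using that g by blast
qed

text \<open>Far away the potential of a charge is its total times \<open>g / |x|\<close>.\<close>

lemma hit_prob_ratio_tendsto:
  assumes X: "finite X" "X \<noteq> {}" and y: "y \<in> X"
  shows "((\<lambda>x. hit_prob X {y} x / hit_prob X X x) \<longlongrightarrow> equilibrium X X y / capacity X) at_inf"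
proof -
  obtain g where g: "g > 0" "\<And>z. ((\<lambda>x. green (x - z) * euclidean_norm x) \<longlongrightarrow> g) at_inf"
    using green_scaled_tendsto by blast
  have lim: "((\<lambda>x. hit_prob X Y x * euclidean_norm x) \<longlongrightarrow> (\<Sum>z\<in>X. equilibrium X Y z * g)) at_inf" for Y
    unfolding hit_prob_potential[OF X(1)] sum_distrib_right mult.assoc
    by (intro tendsto_sum tendsto_mult tendsto_const g)
  have c: "(\<Sum>z\<in>X. equilibrium X X z * g) = capacity X * g" "(\<Sum>z\<in>X. equilibrium X {y} z * g) = equilibrium X X y * g"
    by (simp_all add: capacity_def sum_distrib_right[symmetric] sum_equilibrium_point[OF X(1) y])
  have cp: "capacity X > 0" by (rule capacity_pos[OF X])
  have "((\<lambda>x. (hit_prob X {y} x * euclidean_norm x) / (hit_prob X X x * euclidean_norm x))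
      \<longlongrightarrow> (equilibrium X X y * g) / (capacity X * g)) at_inf"
    using lim[of "{y}"] lim[of X] cp g(1) unfolding c by (intro tendsto_divide) auto
  also have "(equilibrium X X y * g) / (capacity X * g) = equilibrium X X y / capacity X" using g(1) by simp
  finally have *: "((\<lambda>x. (hit_prob X {y} x * euclidean_norm x) / (hit_prob X X x * euclidean_norm x))
      \<longlongrightarrow> equilibrium X X y / capacity X) at_inf" .
  show ?thesis
  proof (rule Lim_transform_eventually[OF *])
    have "\<forall>\<^sub>F x in at_inf. x \<notin> {0 :: int ^ 3}" by (rule eventually_at_inf_notin) simp
    then show "\<forall>\<^sub>F x in at_inf. hit_prob X {y} x * euclidean_norm x / (hit_prob X X x * euclidean_norm x)
      = hit_prob X {y} x / hit_prob X X x"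
    proof eventually_elim
      case (elim x)
      then have x0: "x \<noteq> 0" by simp
      have "euclidean_norm x > 0" using sqnorm_ge_1[OF x0] by (simp add: euclidean_norm_sqnorm)
      then show ?case by simp
    qed
  qed
qed

section \<open>Harmonic measure from infinity\<close>

abbreviation step_law :: "(int ^ 3) measure" where
  "step_law \<equiv> measure_pmf (pmf_of_set {e. adj 0 e})"

interpretation walk: sequence_space step_law
  by unfold_locales

lemma srw_steps_eq: "(srw_steps :: (nat \<Rightarrow> int ^ 3) measure) = walk.S"
  by (simp add: srw_steps_def)

lemma unit_steps_nonempty: "{e :: int ^ 3. adj 0 e} \<noteq> {}"
  using card_unit_steps by force

lemma prob_space_srw_steps: "prob_space (srw_steps :: (nat \<Rightarrow> int ^ 3) measure)"
  unfolding srw_steps_eq by unfold_locales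

lemma space_srw_steps [simp]: "space (srw_steps :: (nat \<Rightarrow> int ^ 3) measure) = UNIV"
  by (simp add: srw_steps_eq space_PiM)

lemma measurable_srw [measurable]: "(\<lambda>s. srw x s n) \<in> measurable srw_steps (count_space (UNIV :: (int ^ 3) set))"
proof (induction n)
  case 0 then show ?case by (simp add: srw_def)
next
  case (Suc n)
  have comp: "(\<lambda>s. s n) \<in> measurable srw_steps (count_space (UNIV :: (int ^ 3) set))"
  proof -
    have "(\<lambda>s. s n) \<in> measurable walk.S step_law" by (rule measurable_component_singleton) simp
    then show ?thesis unfolding srw_steps_eq by (simp cong: measurable_cong_sets)
  qed
  have "(\<lambda>s. (\<lambda>v s. v + s n) (srw x s n) s) \<in> measurable srw_steps (count_space (UNIV :: (int ^ 3) set))"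
  proof (rule measurable_compose_countable[OF _ Suc])
    fix v :: "int ^ 3"
    show "(\<lambda>s. v + s n) \<in> measurable srw_steps (count_space UNIV)"
      by (rule measurable_compose[OF comp]) simp
  qed
  then show ?case by (simp add: srw_def add.assoc)
qed

text \<open>The i.i.d. sequence of steps is a first step followed by an independent copy of itself.\<close>

lemma srw_first_step:
  fixes Q :: "(nat \<Rightarrow> int ^ 3) \<Rightarrow> bool"
  assumes Q: "Measurable.pred srw_steps Q"
  shows "\<P>(s in srw_steps. Q s) = (\<Sum>e\<in>{e. adj 0 e}. \<P>(s in srw_steps. Q (case_nat e s))) / 6"
proof -
  interpret S: prob_space "srw_steps :: (nat \<Rightarrow> int ^ 3) measure" by (rule prob_space_srw_steps)
  have meas: "(\<lambda>(e, s). case_nat e s) \<in> measurable (step_law \<Otimes>\<^sub>M walk.S) walk.S"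
    by measurable
  have A: "{s. Q s} \<in> sets walk.S" using Q by (simp add: pred_def srw_steps_eq space_PiM)
  have cn: "(\<lambda>s. case_nat e s) \<in> measurable walk.S walk.S" for e
    using measurable_compose[OF measurable_Pair1' meas, of e] by simp
  have "emeasure walk.S {s. Q s} = emeasure (distr (step_law \<Otimes>\<^sub>M walk.S) walk.S (\<lambda>(e, s). case_nat e s)) {s. Q s}"
    unfolding walk.PiM_iter ..
  also have "\<dots> = emeasure (step_law \<Otimes>\<^sub>M walk.S) ((\<lambda>(e, s). case_nat e s) -` {s. Q s} \<inter> space (step_law \<Otimes>\<^sub>M walk.S))"
    by (rule emeasure_distr[OF meas A])
  also have "\<dots> = (\<integral>\<^sup>+e. emeasure walk.S (Pair e -` ((\<lambda>(e, s). case_nat e s) -` {s. Q s} \<inter> space (step_law \<Otimes>\<^sub>M walk.S))) \<partial>step_law)"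
    by (rule walk.P.emeasure_pair_measure_alt[OF measurable_sets[OF meas A]])
  also have "\<dots> = (\<integral>\<^sup>+e. emeasure walk.S {s. Q (case_nat e s)} \<partial>step_law)"
    by (intro nn_integral_cong arg_cong[where f = "emeasure walk.S"]) (auto simp: space_pair_measure space_PiM)
  also have "\<dots> = (\<Sum>e\<in>{e. adj 0 e}. emeasure walk.S {s. Q (case_nat e s)}) / 6"
    by (subst nn_integral_pmf_of_set[OF unit_steps_nonempty finite_unit_steps]) (simp add: card_unit_steps)
  also have "\<dots> = (\<Sum>e\<in>{e. adj 0 e}. ennreal (measure walk.S {s. Q (case_nat e s)})) / 6"
    by (simp add: walk.emeasure_eq_measure)
  also have "\<dots> = ennreal ((\<Sum>e\<in>{e. adj 0 e}. measure walk.S {s. Q (case_nat e s)}) / 6)"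
    by (simp add: sum_nonneg divide_ennreal[symmetric] ennreal_numeral)
  finally have "ennreal (measure walk.S {s. Q s}) = ennreal ((\<Sum>e\<in>{e. adj 0 e}. measure walk.S {s. Q (case_nat e s)}) / 6)"
    by (simp add: walk.emeasure_eq_measure)
  then have "measure walk.S {s. Q s} = (\<Sum>e\<in>{e. adj 0 e}. measure walk.S {s. Q (case_nat e s)}) / 6"
    by (subst (asm) ennreal_inj) (auto intro!: sum_nonneg divide_nonneg_nonneg)
  then show ?thesis by (simp add: srw_steps_eq space_PiM)
qed

text \<open>In contrast to \<open>hit_within\<close>, time \<open>0\<close> does not count.\<close>

definition hits_in :: "(int ^ 3) set \<Rightarrow> (int ^ 3) set \<Rightarrow> nat \<Rightarrow> int ^ 3 \<Rightarrow> (nat \<Rightarrow> int ^ 3) \<Rightarrow> bool" where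
  "hits_in X Y n x s \<longleftrightarrow> (\<exists>j. 0 < j \<and> j \<le> n \<and> srw x s j \<in> X \<inter> Y \<and> (\<forall>i. 0 < i \<and> i < j \<longrightarrow> srw x s i \<notin> X))"

lemma pred_hits_in [measurable]: "Measurable.pred srw_steps (hits_in X Y n x)"
  unfolding hits_in_def by measurable

lemma srw_case_nat: "srw x (case_nat e s) (Suc n) = srw (x + e) s n"
  by (simp add: srw_def sum.lessThan_Suc_shift add.assoc del: sum.lessThan_Suc)

lemma hits_in_case_nat:
  "hits_in X Y (Suc n) x (case_nat e s) \<longleftrightarrow> (if x + e \<in> X then x + e \<in> Y else hits_in X Y n (x + e) s)"
proof -
  have 1: "srw x (case_nat e s) 1 = x + e" by (simp add: srw_def)
  show ?thesis
  proof (cases "x + e \<in> X")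
    case True
    have "hits_in X Y (Suc n) x (case_nat e s) \<longleftrightarrow> x + e \<in> Y"
    proof
      assume "hits_in X Y (Suc n) x (case_nat e s)"
      then obtain j where j: "0 < j" "srw x (case_nat e s) j \<in> X \<inter> Y"
        "\<forall>i. 0 < i \<and> i < j \<longrightarrow> srw x (case_nat e s) i \<notin> X" unfolding hits_in_def by blast
      have "\<not> 1 < j" using j(3) 1 True by (metis zero_less_one)
      then have "j = 1" using j(1) by simp
      then show "x + e \<in> Y" using j(2) 1 by simp
    next
      assume "x + e \<in> Y"
      then show "hits_in X Y (Suc n) x (case_nat e s)"
        unfolding hits_in_def using 1 True by (intro exI[of _ 1]) auto
    qed
    then show ?thesis using True by simp
  next
    case False
    have "hits_in X Y (Suc n) x (case_nat e s) \<longleftrightarrow> hits_in X Y n (x + e) s"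
    proof
      assume "hits_in X Y (Suc n) x (case_nat e s)"
      then obtain j where j: "0 < j" "j \<le> Suc n" "srw x (case_nat e s) j \<in> X \<inter> Y"
        "\<forall>i. 0 < i \<and> i < j \<longrightarrow> srw x (case_nat e s) i \<notin> X" unfolding hits_in_def by blast
      obtain k where k: "j = Suc k" using j(1) by (cases j) auto
      have "k \<noteq> 0" using j(3) False 1 k by (cases k) auto
      moreover have "srw (x + e) s i \<notin> X" if "0 < i" "i < k" for i
        using j(4)[rule_format, of "Suc i"] that k by (simp add: srw_case_nat)
      ultimately show "hits_in X Y n (x + e) s"
        unfolding hits_in_def using j k by (intro exI[of _ k]) (auto simp: srw_case_nat)
    next
      assume "hits_in X Y n (x + e) s"
      then obtain j where j: "0 < j" "j \<le> n" "srw (x + e) s j \<in> X \<inter> Y"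
        "\<forall>i. 0 < i \<and> i < j \<longrightarrow> srw (x + e) s i \<notin> X" unfolding hits_in_def by blast
      have "srw x (case_nat e s) i \<notin> X" if i: "0 < i" "i < Suc j" for i
      proof (cases "i = 1")
        case True then show ?thesis using 1 False by simp
      next
        case False
        then obtain k where "i = Suc k" "0 < k" using i(1) by (cases i) auto
        then show ?thesis using j(4) i(2) by (simp add: srw_case_nat)
      qed
      then show "hits_in X Y (Suc n) x (case_nat e s)"
        unfolding hits_in_def using j by (intro exI[of _ "Suc j"]) (auto simp: srw_case_nat)
    qed
    then show ?thesis using False by simp
  qed
qed

lemma prob_hits_in: "\<P>(s in srw_steps. hits_in X Y (Suc n) x s) = walk_mean (hit_within X Y n) x"
proof (induction n arbitrary: x)
  interpret S: prob_space "srw_steps :: (nat \<Rightarrow> int ^ 3) measure" by (rule prob_space_srw_steps)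
  have const: "measure (srw_steps :: (nat \<Rightarrow> int ^ 3) measure) {s. c} = (if c then 1 else 0)" for c
    using S.prob_space by (cases c) auto
  have step: "\<P>(s in srw_steps. hits_in X Y (Suc n) x s) = (\<Sum>e\<in>{e. adj 0 e}.
      if x + e \<in> X then indicator Y (x + e) else \<P>(s in srw_steps. hits_in X Y n (x + e) s)) / 6" for n x
    unfolding srw_first_step[OF pred_hits_in, of X Y "Suc n" x] hits_in_case_nat
    by (intro arg_cong[where f = "\<lambda>t. t / 6"] sum.cong) (auto simp: const indicator_def S.prob_space[simplified])
  {
    case 0
    have "\<not> hits_in X Y 0 x s" for x s by (simp add: hits_in_def)
    then show ?case unfolding step walk_mean_def
      by (intro arg_cong[where f = "\<lambda>t. t / 6"] sum.cong) (auto simp: indicator_def)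
  next
    case (Suc n)
    show ?case unfolding step[of "Suc n"] Suc.IH walk_mean_def[of "hit_within X Y (Suc n)"]
      by (intro arg_cong[where f = "\<lambda>t. t / 6"] sum.cong) auto
  }
qed

lemma hits_in_iff:
  "(\<exists>n. hits_in X Y (Suc n) x s) \<longleftrightarrow> hits X (srw x s) \<and> srw x s (hitting_time X (srw x s)) \<in> Y"
proof
  assume "\<exists>n. hits_in X Y (Suc n) x s"
  then obtain j where j: "0 < j" "srw x s j \<in> X \<inter> Y" "\<forall>i. 0 < i \<and> i < j \<longrightarrow> srw x s i \<notin> X"
    unfolding hits_in_def by blast
  have "hitting_time X (srw x s) = j"
    unfolding hitting_time_def
  proof (rule Least_equality)
    show "0 < j \<and> srw x s j \<in> X" using j by simp
    show "j \<le> i" if "0 < i \<and> srw x s i \<in> X" for i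
      using j(3) that by (metis not_le_imp_less)
  qed
  then show "hits X (srw x s) \<and> srw x s (hitting_time X (srw x s)) \<in> Y"
    using j by (auto simp: hits_def)
next
  assume h: "hits X (srw x s) \<and> srw x s (hitting_time X (srw x s)) \<in> Y"
  define j where "j = hitting_time X (srw x s)"
  have ex: "\<exists>j. 0 < j \<and> srw x s j \<in> X" using h by (auto simp: hits_def)
  have j: "0 < j \<and> srw x s j \<in> X" unfolding j_def hitting_time_def by (rule LeastI_ex[OF ex])
  have "srw x s i \<notin> X" if "0 < i" "i < j" for i
    using not_less_Least[of i "\<lambda>j. 0 < j \<and> srw x s j \<in> X"] that unfolding j_def hitting_time_def by blast
  then have "hits_in X Y (Suc j) x s"
    unfolding hits_in_def using j h by (intro exI[of _ j]) (auto simp: j_def)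
  then show "\<exists>n. hits_in X Y (Suc n) x s" by blast
qed

lemma prob_hits:
  assumes "x \<notin> X"
  shows "\<P>(s in srw_steps. hits X (srw x s) \<and> srw x s (hitting_time X (srw x s)) \<in> Y) = hit_prob X Y x"
proof -
  interpret S: prob_space "srw_steps :: (nat \<Rightarrow> int ^ 3) measure" by (rule prob_space_srw_steps)
  define E where "E n = {s. hits_in X Y (Suc n) x s}" for n
  have E_sets: "range E \<subseteq> sets srw_steps"
    using pred_hits_in by (auto simp: E_def pred_def)
  have E_inc: "incseq E"
    unfolding incseq_def E_def hits_in_def by (blast intro: le_trans Suc_leI le_imp_less_Suc Suc_le_mono[THEN iffD2])
  have "(\<lambda>n. measure srw_steps (E n)) \<longlonglongrightarrow> measure srw_steps (\<Union>n. E n)"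
    by (rule S.finite_Lim_measure_incseq[OF E_sets E_inc])
  moreover have "measure srw_steps (E n) = walk_mean (hit_within X Y n) x" for n
    using prob_hits_in[of X Y n x] by (simp add: E_def)
  moreover have "(\<lambda>n. walk_mean (hit_within X Y n) x) \<longlonglongrightarrow> hit_prob X Y x"
    using walk_mean_tendsto[of "hit_within X Y" "hit_prob X Y" x, OF hit_prob_tendsto] hit_prob_out[OF assms] by simp
  ultimately have "measure srw_steps (\<Union>n. E n) = hit_prob X Y x" using LIMSEQ_unique by auto
  moreover have "(\<Union>n. E n) = {s. hits X (srw x s) \<and> srw x s (hitting_time X (srw x s)) \<in> Y}"
    using hits_in_iff[of X Y x] by (auto simp: E_def)
  ultimately show ?thesis by simp
qed

text \<open>The limit in the definition of harmonic measure exists: far from \<open>X\<close> the conditional hitting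
  distribution is a ratio of two hitting probabilities.\<close>

theorem harmonic_measure_eq:
  assumes X: "finite X" "X \<noteq> {}" and y: "y \<in> X"
  shows "harmonic_measure y X = equilibrium X X y / capacity X"
proof -
  have "((\<lambda>x. \<P>(s in srw_steps. srw x s (hitting_time X (srw x s)) = y \<bar> hits X (srw x s)))
      \<longlongrightarrow> equilibrium X X y / capacity X) at_inf"
  proof (rule Lim_transform_eventually[OF hit_prob_ratio_tendsto[OF X y]])
    show "\<forall>\<^sub>F x in at_inf. hit_prob X {y} x / hit_prob X X x =
        \<P>(s in srw_steps. srw x s (hitting_time X (srw x s)) = y \<bar> hits X (srw x s))"
      using eventually_at_inf_notin[OF X(1)]
    proof eventually_elim
      case (elim x)
      have in_X: "srw x s (hitting_time X (srw x s)) \<in> X" if "hits X (srw x s)" for s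
        using LeastI_ex[of "\<lambda>j. 0 < j \<and> srw x s j \<in> X"] that unfolding hits_def hitting_time_def by blast
      have "\<P>(s in srw_steps. hits X (srw x s)) = hit_prob X X x"
        unfolding prob_hits[OF elim, symmetric] using in_X by (intro arg_cong[where f = "measure srw_steps"]) auto
      moreover have "\<P>(s in srw_steps. srw x s (hitting_time X (srw x s)) = y \<and> hits X (srw x s)) = hit_prob X {y} x"
        unfolding prob_hits[OF elim, symmetric] by (intro arg_cong[where f = "measure srw_steps"]) auto
      ultimately show ?case by (simp add: cond_prob_def)
    qed
  qed
  then show ?thesis
    unfolding harmonic_measure_def by (intro tendsto_Lim at_inf_neq_bot)
qed

section \<open>A one-dimensional inequality for the escape profile\<close>

definition pow32 :: "real \<Rightarrow> real" where "pow32 x = x * sqrt x"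

lemma pow32_mono: "0 \<le> x \<Longrightarrow> x \<le> y \<Longrightarrow> pow32 x \<le> pow32 y"
  unfolding pow32_def by (intro mult_mono) auto
lemma pow32_pos: "0 < x \<Longrightarrow> pow32 x > 0" by (simp add: pow32_def)
lemma pow32_nonneg: "0 \<le> x \<Longrightarrow> pow32 x \<ge> 0" by (simp add: pow32_def)
lemma pow32_mult: "pow32 (x * y) = pow32 x * pow32 y"
  by (simp add: pow32_def real_sqrt_mult)

lemma pow32_add_le:
  assumes "a \<ge> 0" "b \<ge> 0" shows "pow32 (a + b) \<le> 3 * (pow32 a + pow32 b)"
proof -
  define m where "m = max a b"
  have m: "m \<ge> 0" using assms by (simp add: m_def)
  have "pow32 (a + b) \<le> pow32 (2 * m)" using assms by (intro pow32_mono) (auto simp: m_def)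
  also have "\<dots> = pow32 2 * pow32 m" by (rule pow32_mult)
  also have "pow32 2 \<le> 3"
  proof -
    have "sqrt 2 \<le> 3 / 2" by (intro real_le_lsqrt) (auto simp: power2_eq_square)
    then show ?thesis by (simp add: pow32_def)
  qed
  then have "pow32 2 * pow32 m \<le> 3 * pow32 m" using m by (intro mult_right_mono pow32_nonneg)
  also have "pow32 m \<le> pow32 a + pow32 b"
    using assms pow32_nonneg[of a] pow32_nonneg[of b] by (auto simp: m_def max_def)
  finally show ?thesis by simp
qed

text \<open>Bounds a sum over gaps \<open>i - j\<close> by a sum over an initial segment.\<close>

lemma sum_inj_le:
  fixes f :: "'b \<Rightarrow> real"
  assumes "inj_on h A" "h ` A \<subseteq> B" "finite B" "\<And>b. b \<in> B \<Longrightarrow> f b \<ge> 0"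
  shows "(\<Sum>a\<in>A. f (h a)) \<le> sum f B"
proof -
  have "(\<Sum>a\<in>A. f (h a)) = sum f (h ` A)" using assms(1) by (simp add: sum.reindex)
  also have "\<dots> \<le> sum f B" using assms by (intro sum_mono2) auto
  finally show ?thesis .
qed

lemma sum_inv_sqrt_le: "(\<Sum>k=1..m. 1 / sqrt (real k)) \<le> 2 * sqrt (real m)"
proof (induction m)
  case 0 then show ?case by simp
next
  case (Suc m)
  define a b where "a = sqrt (real m)" and "b = sqrt (real (Suc m))"
  have ab: "a \<ge> 0" "b > 0" "a \<le> b" "b^2 = a^2 + 1" by (auto simp: a_def b_def)
  have "1 = (b - a) * (b + a)" using ab(4) by (simp add: power2_eq_square algebra_simps)
  also have "\<dots> \<le> (b - a) * (2 * b)" using ab by (intro mult_left_mono) auto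
  finally have "1 / b \<le> 2 * b - 2 * a" using ab by (simp add: field_simps)
  then show ?case using Suc by (simp add: a_def b_def)
qed

lemma sum_inv_pow32_le: "(\<Sum>k=1..m. 1 / pow32 (real k)) \<le> 3"
proof -
  have "(\<Sum>k=1..Suc m. 1 / pow32 (real k)) \<le> 3 - 2 / sqrt (real (Suc m))" for m
  proof (induction m)
    case 0 then show ?case by (simp add: pow32_def)
  next
    case (Suc m)
    define a b where "a = sqrt (real (Suc m))" and "b = sqrt (real (Suc (Suc m)))"
    have ab: "a > 0" "b > 0" "a \<le> b" "b^2 = a^2 + 1" by (auto simp: a_def b_def)
    have "1 = (b - a) * (b + a)" using ab(4) by (simp add: power2_eq_square algebra_simps)
    also have "\<dots> \<le> (b - a) * (2 * b)" using ab by (intro mult_left_mono) auto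
    finally have 1: "1 \<le> 2 * (b - a) * b" by (simp add: algebra_simps)
    have "1 / (b^2 * b) \<le> 1 / (a * b * b)"
      using ab(1-3) by (intro divide_left_mono) (auto simp: power2_eq_square intro!: mult_pos_pos)
    also have "\<dots> \<le> 2 * (b - a) * b / (a * b * b)" using 1 ab by (intro divide_right_mono) auto
    also have "\<dots> = 2 / a - 2 / b" using ab by (simp add: field_simps)
    finally have "1 / pow32 (real (Suc (Suc m))) \<le> 2 / a - 2 / b" by (simp add: pow32_def b_def)
    then show ?case using Suc by (simp add: a_def b_def)
  qed
  moreover have "(\<Sum>k=1..m. 1 / pow32 (real k)) \<le> (\<Sum>k=1..Suc m. 1 / pow32 (real k))"
    by (intro sum_mono2) (auto simp: pow32_nonneg)
  moreover have "2 / sqrt (real (Suc m)) \<ge> 0" by simp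
  ultimately show ?thesis by (smt (verit))
qed

text \<open>The shift \<open>s\<close> supplies the slack that absorbs the bounded error terms of the inequality below.\<close>

definition shifted_log :: "real \<Rightarrow> nat \<Rightarrow> real" where "shifted_log s j = ln (real j + 1) + s"
definition escape_profile :: "real \<Rightarrow> nat \<Rightarrow> real" where "escape_profile s j = 1 / sqrt (shifted_log s j)"
definition profile_drop :: "real \<Rightarrow> nat \<Rightarrow> real" where "profile_drop s j = escape_profile s (j - 1) - escape_profile s j"

lemma shifted_log_ge_1: "s \<ge> 1 \<Longrightarrow> shifted_log s j \<ge> 1"
proof -
  assume "s \<ge> 1"
  moreover have "ln (real j + 1) \<ge> 0" by simp
  ultimately show ?thesis unfolding shifted_log_def by linarith
qed

lemma shifted_log_mono: "i \<le> j \<Longrightarrow> shifted_log s i \<le> shifted_log s j"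
  by (simp add: shifted_log_def)

lemma escape_profile_antimono: "s \<ge> 1 \<Longrightarrow> i \<le> j \<Longrightarrow> escape_profile s j \<le> escape_profile s i"
  unfolding escape_profile_def using shifted_log_mono[of i j s] shifted_log_ge_1[of s i]
  by (intro divide_left_mono) (auto intro!: mult_pos_pos)

lemma profile_drop_nonneg: "s \<ge> 1 \<Longrightarrow> profile_drop s j \<ge> 0"
  unfolding profile_drop_def using escape_profile_antimono[of s "j - 1" j] by simp

text \<open>A discrete derivative of \<open>(ln j + s) powr (- 1/2)\<close>.\<close>

lemma profile_drop_le:
  assumes s: "s \<ge> 1" and j: "j \<ge> 1"
  shows "real j * profile_drop s j \<le> 1 / (2 * pow32 (shifted_log s (j - 1)))"
proof -
  define a b where "a = sqrt (shifted_log s (j - 1))" and "b = sqrt (shifted_log s j)"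
  have a2: "a^2 = shifted_log s (j - 1)" "b^2 = shifted_log s j"
    using shifted_log_ge_1[OF s, of "j - 1"] shifted_log_ge_1[OF s, of j] by (auto simp: a_def b_def)
  have ab: "a > 0" "b > 0" "a \<le> b"
    using shifted_log_ge_1[OF s, of "j - 1"] shifted_log_ge_1[OF s, of j] shifted_log_mono[of "j - 1" j s] by (auto simp: a_def b_def)
  have "b^2 - a^2 = ln (real j + 1) - ln (real j)" using j by (simp add: a2 shifted_log_def of_nat_diff)
  also have "\<dots> = ln ((real j + 1) / real j)" using j by (simp add: ln_div)
  also have "\<dots> \<le> (real j + 1) / real j - 1" using j by (intro ln_le_minus_one) auto
  also have "\<dots> = 1 / real j" using j by (simp add: field_simps)
  finally have "b^2 - a^2 \<le> 1 / real j" .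
  then have 1: "real j * ((b - a) * (b + a)) \<le> 1" using j by (simp add: field_simps power2_eq_square)
  have w: "profile_drop s j = 1 / a - 1 / b" by (simp only: profile_drop_def escape_profile_def a_def b_def)
  have "real j * profile_drop s j = real j * (b - a) / (a * b)"
    unfolding w using ab(1,2) by (simp add: diff_frac_eq mult.commute)
  also have "\<dots> = real j * ((b - a) * (b + a)) / (a * b * (b + a))" using ab by simp
  also have "\<dots> \<le> 1 / (a * b * (b + a))" using 1 ab by (intro divide_right_mono) auto
  also have "\<dots> \<le> 1 / (a * a * (a + a))"
    using ab by (intro divide_left_mono mult_mono mult_pos_pos add_mono) auto
  also have "\<dots> = 1 / (2 * pow32 (shifted_log s (j - 1)))"
    unfolding pow32_def a_def[symmetric] a2(1)[symmetric] using ab(1) by (simp add: power2_eq_square)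
  finally show ?thesis .
qed

definition log_ratio :: "nat \<Rightarrow> nat \<Rightarrow> real" where "log_ratio i j = ln ((real i + 1) / real j)"

lemma log_ratio_nonneg: "1 \<le> j \<Longrightarrow> j \<le> i \<Longrightarrow> log_ratio i j \<ge> 0"
  by (simp add: log_ratio_def)

text \<open>Logarithms vary slowly: \<open>shifted_log s i\<close> exceeds \<open>shifted_log s (j - 1)\<close> by \<open>log_ratio i j\<close>.\<close>

lemma pow32_shifted_log_ratio:
  assumes s: "s \<ge> 1" and j: "1 \<le> j" "j \<le> i"
  shows "1 / pow32 (shifted_log s (j - 1)) \<le> (1 + log_ratio i j)^2 / pow32 (shifted_log s i)"
proof -
  define a d where "a = shifted_log s (j - 1)" and "d = log_ratio i j"
  have a: "a \<ge> 1" unfolding a_def by (rule shifted_log_ge_1[OF s])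
  have d: "d \<ge> 0" unfolding d_def by (rule log_ratio_nonneg[OF j])
  have e: "shifted_log s i = a + d" using j by (simp add: shifted_log_def a_def d_def log_ratio_def ln_div of_nat_diff)
  have "a + d \<le> a * (1 + d)" using a d by (simp add: algebra_simps mult_right_mono[of 1 a d, simplified])
  then have "pow32 (a + d) \<le> pow32 (a * (1 + d))" using a d by (intro pow32_mono) auto
  also have "\<dots> = pow32 a * pow32 (1 + d)" by (rule pow32_mult)
  also have "\<dots> \<le> pow32 a * (1 + d)^2"
  proof (intro mult_left_mono)
    have "sqrt (1 + d) \<le> 1 + d" using d by (intro real_le_lsqrt) (auto intro: self_le_power)
    then show "pow32 (1 + d) \<le> (1 + d)^2" using d unfolding pow32_def power2_eq_square by (intro mult_left_mono) auto
    show "0 \<le> pow32 a" using a by (intro pow32_nonneg) simp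
  qed
  finally have "pow32 (a + d) \<le> pow32 a * (1 + d)^2" .
  moreover have "pow32 a > 0" "pow32 (a + d) > 0" using a d by (auto intro!: pow32_pos)
  ultimately show ?thesis unfolding e a_def[symmetric] d_def[symmetric] by (simp add: field_simps)
qed

lemma log_ratio_le_sqrt:
  assumes j: "1 \<le> j" "j \<le> i"
  shows "(1 + log_ratio i j)^2 \<le> 36 * (sqrt (real i) / sqrt (real j))"
    "log_ratio i j * (2 + log_ratio i j) \<le> 36 * (sqrt (real i) / sqrt (real j))"
proof -
  \<comment> \<open>The fourth root of the ratio bounds its logarithm.\<close>
  define x t where "x = (real i + 1) / real j" and "t = sqrt (sqrt x)"
  have x: "x \<ge> 1" using j by (simp add: x_def)
  have t: "t \<ge> 1" "t^2 = sqrt x" using x by (auto simp: t_def)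
  have "ln x = 4 * ln t" using x by (simp add: t_def ln_sqrt)
  also have "ln t \<le> t - 1" using t by (intro ln_le_minus_one) auto
  finally have l: "log_ratio i j \<le> 4 * t - 4" by (simp add: log_ratio_def x_def)
  have l0: "log_ratio i j \<ge> 0" by (rule log_ratio_nonneg[OF j])
  have sx: "sqrt x \<le> 36/25 * (sqrt (real i) / sqrt (real j))"
  proof -
    have "x \<le> 2 * (real i / real j)" using j by (simp add: x_def field_simps)
    then have "sqrt x \<le> sqrt 2 * (sqrt (real i) / sqrt (real j))"
      by (metis real_sqrt_divide real_sqrt_le_mono real_sqrt_mult)
    moreover have "sqrt 2 \<le> 36/25" by (intro real_le_lsqrt) (auto simp: power2_eq_square)
    ultimately show ?thesis by (smt (verit) divide_nonneg_nonneg mult_right_mono of_nat_0_le_iff real_sqrt_ge_zero)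
  qed
  have "(1 + log_ratio i j)^2 \<le> (5 * t)^2" using l l0 t by (intro power_mono) auto
  also have "\<dots> = 25 * sqrt x" using t by (simp add: power_mult_distrib)
  finally show *: "(1 + log_ratio i j)^2 \<le> 36 * (sqrt (real i) / sqrt (real j))" using sx by simp
  have "log_ratio i j * (2 + log_ratio i j) \<le> (1 + log_ratio i j)^2" by (simp add: power2_eq_square algebra_simps)
  then show "log_ratio i j * (2 + log_ratio i j) \<le> 36 * (sqrt (real i) / sqrt (real j))" using * by simp
qed

text \<open>The correction from the variation of the logarithm, summed over \<open>j < i\<close>, is bounded: near \<open>i\<close> the
  logarithm is small like the gap, and away from \<open>i\<close> the gap is of order \<open>i\<close>.\<close>

lemma log_ratio_over_gap:
  assumes j: "1 \<le> j" "j < i"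
  shows "log_ratio i j * (2 + log_ratio i j) / real (i - j) \<le> 72 / (sqrt (real i) * sqrt (real j))"
proof -
  have p: "sqrt (real i) > 0" "sqrt (real j) > 0" "real (i - j) > 0" using j by auto
  have rij: "real (i - j) = real i - real j" using j by (simp add: of_nat_diff)
  have l0: "log_ratio i j \<ge> 0" by (rule log_ratio_nonneg) (use j in auto)
  show ?thesis
  proof (cases "2 * j \<le> i")
    case True
    have h: "real (i - j) \<ge> real i / 2"
    proof -
      have "2 * real j \<le> real i" using True by (metis of_nat_le_iff of_nat_mult of_nat_numeral)
      then show ?thesis using rij by simp
    qed
    have "log_ratio i j * (2 + log_ratio i j) / real (i - j) \<le> 36 * (sqrt (real i) / sqrt (real j)) / (real i / 2)"
      using log_ratio_le_sqrt(2)[of j i] j h l0 p by (intro frac_le) auto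
    also have "\<dots> = 72 * (sqrt (real i) / (sqrt (real j) * real i))" by simp
    also have "sqrt (real i) / (sqrt (real j) * real i) = 1 / (sqrt (real i) * sqrt (real j))"
    proof -
      have "a > 0 \<Longrightarrow> a / (b * (a * a)) = 1 / (a * b)" for a b :: real by simp
      from this[OF p(1), of "sqrt (real j)"] show ?thesis by simp
    qed
    finally show ?thesis by simp
  next
    case False
    have jr: "real i < 2 * real j" using False by linarith
    have "log_ratio i j \<le> (real i + 1) / real j - 1" unfolding log_ratio_def using j by (intro ln_le_minus_one) auto
    also have "\<dots> = (real (i - j) + 1) / real j" using j by (simp add: rij field_simps)
    also have "\<dots> \<le> 2 * real (i - j) / real j" using p j by (intro divide_right_mono) auto
    finally have l1: "log_ratio i j \<le> 2 * real (i - j) / real j" .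
    have l2: "log_ratio i j \<le> 4"
    proof -
      have "2 * real (i - j) / real j \<le> 2" using j jr rij by (simp add: field_simps)
      then show ?thesis using l1 by simp
    qed
    have "log_ratio i j * (2 + log_ratio i j) / real (i - j) \<le> (2 * real (i - j) / real j) * 6 / real (i - j)"
      using l0 l1 l2 p by (intro divide_right_mono mult_mono) auto
    also have "\<dots> = 12 / real j"
    proof -
      have "k > 0 \<Longrightarrow> 2 * k / b * 6 / k = 12 / b" for k b :: real by simp
      from this[OF p(3)] show ?thesis .
    qed
    also have "\<dots> = 12 / (sqrt (real j) * sqrt (real j))" by simp
    also have "\<dots> \<le> 72 / (sqrt (real i) * sqrt (real j))"
    proof -
      have "sqrt (real i) \<le> sqrt (4 * real j)" using jr by simp
      then have "sqrt (real i) \<le> 2 * sqrt (real j)" by (simp add: real_sqrt_mult)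
      then have "sqrt (real i) \<le> 6 * sqrt (real j)" using p by linarith
      then show ?thesis using p by (simp add: field_simps del: real_sqrt_mult_self)
    qed
    finally show ?thesis .
  qed
qed

text \<open>An upper bound for the Green function between the \<open>i\<close>-th and the \<open>j\<close>-th point of a chain that has
  one point in each spherical shell.\<close>

definition green_majorant :: "real \<Rightarrow> real \<Rightarrow> nat \<Rightarrow> nat \<Rightarrow> real" where
  "green_majorant g C i j = (if i = j then C else g / \<bar>real i - real j\<bar> + C / pow32 \<bar>real i - real j\<bar>)"

text \<open>Writing \<open>i / (i - j) = 1 + j / (i - j)\<close>, the first summand makes the drops telescope, and the
  second produces half of the logarithm in \<open>harm i\<close>.\<close>

lemma majorant_sum_below:
  assumes s: "s \<ge> 1" and g: "g \<ge> 0" and C: "C \<ge> 0" and j0: "1 \<le> j0" "j0 \<le> i"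
  defines "T \<equiv> 1 / pow32 (shifted_log s i)"
  shows "(\<Sum>j\<in>{j0..<i}. real i * profile_drop s j * green_majorant g C i j)
     \<le> g * (escape_profile s (j0 - 1) - escape_profile s (i - 1)) + g / 2 * T * (harm i + 144) + C / 2 * T * 648"
proof -
  have T: "T > 0" unfolding T_def using shifted_log_ge_1[OF s, of i] by (simp add: pow32_pos)
  have each: "real i * profile_drop s j * green_majorant g C i j \<le> g * profile_drop s j
      + g / 2 * T * (1 / real (i - j) + 72 / (sqrt (real i) * sqrt (real j)))
      + C / 2 * T * (108 * (1 / pow32 (real j) + 1 / pow32 (real (i - j))))" if j: "j \<in> {j0..<i}" for j
  proof -
    have j1: "1 \<le> j" "j < i" using j j0 by auto
    define k where "k = real (i - j)"
    have k: "k > 0" "real i = real j + k" "\<bar>real i - real j\<bar> = k" using j1 by (auto simp: k_def of_nat_diff)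
    have jp: "real j > 0" using j1 by simp
    define S where "S = (1 + log_ratio i j)^2"
    have jw: "real j * profile_drop s j \<le> 1 / 2 * T * S"
    proof -
      have "real j * profile_drop s j \<le> 1 / 2 * (1 / pow32 (shifted_log s (j - 1)))" using profile_drop_le[OF s j1(1)] by simp
      also have "\<dots> \<le> 1 / 2 * (S * T)"
        using pow32_shifted_log_ratio[OF s j1(1), of i] j1 unfolding S_def T_def by (intro mult_left_mono) auto
      finally show ?thesis by (simp add: mult_ac)
    qed
    have "real i * profile_drop s j * (g / k) = g * profile_drop s j + g * (real j * profile_drop s j) / k"
      using k by (simp add: field_simps)
    also have "\<dots> \<le> g * profile_drop s j + g * (1 / 2 * T * S) / k"
      using jw g k by (intro add_left_mono divide_right_mono mult_left_mono) auto
    also have "\<dots> = g * profile_drop s j + g / 2 * T * (S / k)" by simp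
    also have "S / k = 1 / k + log_ratio i j * (2 + log_ratio i j) / k"
      by (simp add: S_def power2_eq_square algebra_simps add_divide_distrib)
    also have "g * profile_drop s j + g / 2 * T * (1 / k + log_ratio i j * (2 + log_ratio i j) / k)
      \<le> g * profile_drop s j + g / 2 * T * (1 / k + 72 / (sqrt (real i) * sqrt (real j)))"
      using log_ratio_over_gap[OF j1] g T unfolding k_def by (intro add_left_mono mult_left_mono) auto
    finally have 1: "real i * profile_drop s j * (g / k) \<le> g * profile_drop s j + g / 2 * T * (1 / k + 72 / (sqrt (real i) * sqrt (real j)))" .
    have "real i * profile_drop s j * (C / pow32 k) = C * (real i / real j) * (real j * profile_drop s j) / pow32 k"
      using jp by simp
    also have "\<dots> \<le> C * (real i / real j) * (1 / 2 * T * (36 * (sqrt (real i) / sqrt (real j)))) / pow32 k"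
    proof -
      have "real j * profile_drop s j \<le> 1 / 2 * T * (36 * (sqrt (real i) / sqrt (real j)))"
      proof -
        have "1 / 2 * T * S \<le> 1 / 2 * T * (36 * (sqrt (real i) / sqrt (real j)))"
          using log_ratio_le_sqrt(1)[of j i] j1 T unfolding S_def by (intro mult_left_mono) auto
        then show ?thesis using jw by simp
      qed
      then show ?thesis using C jp pow32_nonneg[of k] k by (intro divide_right_mono mult_left_mono) auto
    qed
    also have "\<dots> = C / 2 * T * (36 * (pow32 (real i / (real j * k))))"
      by (simp add: pow32_def real_sqrt_divide real_sqrt_mult mult_ac)
    also have "real i / (real j * k) = 1 / real j + 1 / k" using k jp by (simp add: field_simps)
    also have "C / 2 * T * (36 * pow32 (1 / real j + 1 / k)) \<le> C / 2 * T * (36 * (3 * (pow32 (1 / real j) + pow32 (1 / k))))"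
      using C T pow32_add_le[of "1 / real j" "1 / k"] jp k by (intro mult_left_mono) auto
    also have "\<dots> = C / 2 * T * (108 * (1 / pow32 (real j) + 1 / pow32 k))"
      by (simp add: pow32_def real_sqrt_divide)
    finally have 2: "real i * profile_drop s j * (C / pow32 k) \<le> C / 2 * T * (108 * (1 / pow32 (real j) + 1 / pow32 k))" .
    have "green_majorant g C i j = g / k + C / pow32 k" using j1 k(3) by (simp add: green_majorant_def)
    then have eq: "real i * profile_drop s j * green_majorant g C i j = real i * profile_drop s j * (g / k) + real i * profile_drop s j * (C / pow32 k)"
      by (simp only: distrib_left)
    show ?thesis unfolding eq unfolding k_def[symmetric] using 1 2 by (rule add_mono)
  qed
  have inj: "inj_on (\<lambda>j. i - j) {j0..<i}" by (auto simp: inj_on_def)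
  have img: "(\<lambda>j. i - j) ` {j0..<i} \<subseteq> {1..i}" by auto
  have s1: "(\<Sum>j\<in>{j0..<i}. profile_drop s j) = escape_profile s (j0 - 1) - escape_profile s (i - 1)"
    using j0(2)
  proof (induction i rule: dec_induct)
    case base then show ?case by simp
  next
    case (step n) then show ?case by (simp add: profile_drop_def)
  qed
  have s2: "(\<Sum>j\<in>{j0..<i}. 1 / real (i - j)) \<le> harm i"
    unfolding harm_def using sum_inj_le[OF inj img, of "\<lambda>k. 1 / real k"] by (simp add: inverse_eq_divide)
  have s3: "(\<Sum>j\<in>{j0..<i}. 72 / (sqrt (real i) * sqrt (real j))) \<le> 144"
  proof -
    have i: "sqrt (real i) > 0" using j0 by simp
    have "(\<Sum>j\<in>{j0..<i}. 72 / (sqrt (real i) * sqrt (real j))) = 72 / sqrt (real i) * (\<Sum>j\<in>{j0..<i}. 1 / sqrt (real j))"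
      by (simp add: sum_distrib_left)
    also have "\<dots> \<le> 72 / sqrt (real i) * (2 * sqrt (real i))"
    proof (rule mult_left_mono)
      have "(\<Sum>j\<in>{j0..<i}. 1 / sqrt (real j)) \<le> (\<Sum>j=1..i. 1 / sqrt (real j))"
        using j0 by (intro sum_mono2) auto
      then show "(\<Sum>j\<in>{j0..<i}. 1 / sqrt (real j)) \<le> 2 * sqrt (real i)"
        using sum_inv_sqrt_le[of i] by linarith
    qed (use i in simp)
    finally have "(\<Sum>j\<in>{j0..<i}. 72 / (sqrt (real i) * sqrt (real j))) \<le> 72 / sqrt (real i) * (2 * sqrt (real i))" .
    then show ?thesis using i by simp
  qed
  have s4: "(\<Sum>j\<in>{j0..<i}. 1 / pow32 (real j)) \<le> 3"
  proof -
    have "(\<Sum>j\<in>{j0..<i}. 1 / pow32 (real j)) \<le> (\<Sum>j=1..i. 1 / pow32 (real j))"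
      using j0 by (intro sum_mono2) (auto simp: pow32_nonneg)
    then show ?thesis using sum_inv_pow32_le[of i] by simp
  qed
  have s5: "(\<Sum>j\<in>{j0..<i}. 1 / pow32 (real (i - j))) \<le> 3"
    using sum_inj_le[OF inj img, of "\<lambda>k. 1 / pow32 (real k)"] sum_inv_pow32_le[of i] by (simp add: pow32_nonneg)
  have "(\<Sum>j\<in>{j0..<i}. real i * profile_drop s j * green_majorant g C i j) \<le> (\<Sum>j\<in>{j0..<i}. g * profile_drop s j
      + g / 2 * T * (1 / real (i - j) + 72 / (sqrt (real i) * sqrt (real j)))
      + C / 2 * T * (108 * (1 / pow32 (real j) + 1 / pow32 (real (i - j)))))"
    by (rule sum_mono[OF each])
  also have "\<dots> = g * (\<Sum>j\<in>{j0..<i}. profile_drop s j)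
      + g / 2 * T * ((\<Sum>j\<in>{j0..<i}. 1 / real (i - j)) + (\<Sum>j\<in>{j0..<i}. 72 / (sqrt (real i) * sqrt (real j))))
      + C / 2 * T * (108 * ((\<Sum>j\<in>{j0..<i}. 1 / pow32 (real j)) + (\<Sum>j\<in>{j0..<i}. 1 / pow32 (real (i - j)))))"
    by (simp only: sum.distrib sum_distrib_left[symmetric])
  also have "\<dots> \<le> g * (escape_profile s (j0 - 1) - escape_profile s (i - 1)) + g / 2 * T * (harm i + 144) + C / 2 * T * (108 * (3 + 3))"
    unfolding s1 using s2 s3 s4 s5 g C T by (intro add_mono mult_left_mono) auto
  finally show ?thesis by simp
qed

text \<open>Here \<open>i / (j * (j - i)) = 1 / (j - i) - 1 / j\<close>, whose sum over \<open>j\<close> gives the other half of the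
  logarithm.\<close>

lemma majorant_sum_above:
  assumes s: "s \<ge> 1" and g: "g \<ge> 0" and C: "C \<ge> 0" and i: "1 \<le> i"
  defines "T \<equiv> 1 / pow32 (shifted_log s i)"
  shows "(\<Sum>j\<in>{i<..n}. real i * profile_drop s j * green_majorant g C i j) \<le> g / 2 * T * harm i + C / 2 * T * 3"
proof -
  have T: "T > 0" unfolding T_def using shifted_log_ge_1[OF s, of i] by (simp add: pow32_pos)
  have each: "real i * profile_drop s j * green_majorant g C i j \<le> g / 2 * T * (1 / real (j - i) - 1 / real j) + C / 2 * T * (1 / pow32 (real (j - i)))"
    if j: "j \<in> {i<..n}" for j
  proof -
    define k where "k = real (j - i)"
    have k: "k > 0" "real j = real i + k" "\<bar>real i - real j\<bar> = k" using j by (auto simp: k_def of_nat_diff)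
    have jp: "real j > 0" using j by simp
    have "real j * profile_drop s j \<le> 1 / 2 * (1 / pow32 (shifted_log s (j - 1)))" using profile_drop_le[OF s, of j] j by simp
    also have "\<dots> \<le> 1 / 2 * T"
      unfolding T_def using shifted_log_ge_1[OF s, of i] shifted_log_ge_1[OF s, of "j - 1"] shifted_log_mono[of i "j - 1" s] j
      by (intro mult_left_mono divide_left_mono pow32_mono mult_pos_pos pow32_pos) auto
    finally have jw: "real j * profile_drop s j \<le> 1 / 2 * T" .
    have "real i * profile_drop s j = real i / real j * (real j * profile_drop s j)" using jp by simp
    also have "\<dots> \<le> real i / real j * (1 / 2 * T)" using jw jp by (intro mult_left_mono) auto
    finally have iw: "real i * profile_drop s j \<le> real i / real j * (1 / 2 * T)" .
    have "real i * profile_drop s j * (g / k) \<le> real i / real j * (1 / 2 * T) * (g / k)"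
      using iw g k by (intro mult_right_mono) auto
    also have "\<dots> = g / 2 * T * (real i / (real j * k))" by (simp add: mult_ac)
    also have "real i / (real j * k) = 1 / k - 1 / real j" using k jp by (simp add: field_simps)
    finally have 1: "real i * profile_drop s j * (g / k) \<le> g / 2 * T * (1 / k - 1 / real j)" .
    have "real i * profile_drop s j \<le> 1 / 2 * T"
    proof -
      have "real i * profile_drop s j \<le> real j * profile_drop s j" using k profile_drop_nonneg[OF s, of j] by (intro mult_right_mono) auto
      then show ?thesis using jw by simp
    qed
    then have "real i * profile_drop s j * (C / pow32 k) \<le> 1 / 2 * T * (C / pow32 k)"
      using C k by (intro mult_right_mono) (auto intro!: divide_nonneg_nonneg pow32_nonneg)
    then have 2: "real i * profile_drop s j * (C / pow32 k) \<le> C / 2 * T * (1 / pow32 k)" by (simp add: mult_ac)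
    have "green_majorant g C i j = g / k + C / pow32 k" using j k(3) by (simp add: green_majorant_def)
    then have eq: "real i * profile_drop s j * green_majorant g C i j = real i * profile_drop s j * (g / k) + real i * profile_drop s j * (C / pow32 k)"
      by (simp only: distrib_left)
    show ?thesis unfolding eq unfolding k_def[symmetric] using 1 2 by (rule add_mono)
  qed
  have s1: "(\<Sum>j\<in>{i<..n}. 1 / real (j - i) - 1 / real j) \<le> harm i"
  proof (cases "i \<le> n")
    case True
    have "(\<Sum>j\<in>{i<..n}. 1 / real (j - i) - 1 / real j) = harm (n - i) - (harm n - harm i)"
      using True
    proof (induction n rule: dec_induct)
      case base then show ?case by (simp add: harm_def)
    next
      case (step n)
      then have "{i<..Suc n} = insert (Suc n) {i<..n}" "Suc n - i = Suc (n - i)" by auto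
      then show ?case using step by (simp add: harm_Suc inverse_eq_divide)
    qed
    also have "harm (n - i) \<le> (harm n :: real)"
      unfolding harm_def by (intro sum_mono2) auto
    finally show ?thesis by simp
  next
    case False then show ?thesis by (simp add: harm_nonneg)
  qed
  have s2: "(\<Sum>j\<in>{i<..n}. 1 / pow32 (real (j - i))) \<le> 3"
  proof -
    have "inj_on (\<lambda>j. j - i) {i<..n}" by (rule inj_onI) auto
    moreover have "(\<lambda>j. j - i) ` {i<..n} \<subseteq> {1..n}" by auto
    ultimately have "(\<Sum>j\<in>{i<..n}. 1 / pow32 (real (j - i))) \<le> (\<Sum>k=1..n. 1 / pow32 (real k))"
      by (rule sum_inj_le) (auto simp: pow32_nonneg)
    then show ?thesis using sum_inv_pow32_le[of n] by linarith
  qed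
  have "(\<Sum>j\<in>{i<..n}. real i * profile_drop s j * green_majorant g C i j) \<le>
     (\<Sum>j\<in>{i<..n}. g / 2 * T * (1 / real (j - i) - 1 / real j) + C / 2 * T * (1 / pow32 (real (j - i))))"
    by (rule sum_mono[OF each])
  also have "\<dots> = g / 2 * T * (\<Sum>j\<in>{i<..n}. 1 / real (j - i) - 1 / real j) + C / 2 * T * (\<Sum>j\<in>{i<..n}. 1 / pow32 (real (j - i)))"
    by (simp only: sum.distrib sum_distrib_left[symmetric])
  also have "\<dots> \<le> g / 2 * T * harm i + C / 2 * T * 3"
    using s1 s2 g C T by (intro add_mono mult_left_mono) auto
  finally show ?thesis .
qed

lemma harm_le_ln: "n \<ge> 1 \<Longrightarrow> harm n \<le> ln (real n) + 1"
proof (induction n rule: dec_induct)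
  case base then show ?case by (simp add: harm_def)
next
  case (step n)
  have "ln (real n / real (Suc n)) \<le> real n / real (Suc n) - 1"
    using step by (intro ln_le_minus_one) auto
  also have "\<dots> = - inverse (real (Suc n))" by (simp add: field_simps)
  finally have "inverse (real (Suc n)) \<le> ln (real (Suc n)) - ln (real n)"
    using step by (simp add: ln_div)
  then show ?case using step by (simp add: harm_Suc)
qed

text \<open>The potential of the drops at the \<open>i\<close>-th point is at most that of a point mass
  \<open>escape_profile s (j0 - 1)\<close> at the tip. By \<open>majorant_sum_below\<close> and \<open>majorant_sum_above\<close> this amounts to
  \<open>(harm i + const) / pow32 (shifted_log s i) \<le> escape_profile s i\<close>, up to an error of order \<open>1 / sqrt i\<close>.
  As \<open>escape_profile s i\<close> equals \<open>shifted_log s i / pow32 (shifted_log s i)\<close>, a large \<open>s\<close> settles the main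
  terms, and starting the chain at a large \<open>j0\<close> settles the error.\<close>

lemma profile_inequality:
  fixes g C :: real assumes g: "g > 0" and C: "C \<ge> 0"
  shows "\<exists>s\<ge>1. \<exists>J\<ge>1. \<forall>j0\<ge>J. \<forall>i\<ge>j0. \<forall>n\<ge>i.
     (\<Sum>j=j0..n. profile_drop s j * green_majorant g C i j) \<le> escape_profile s (j0 - 1) * (g / real i - C / pow32 (real i))"
proof -
  \<comment> \<open>Collects the bounded error terms: \<open>144\<close> from the varying logarithm, and \<open>648 + 4 + 3 \<le> 1000\<close> from the second term of the majorant.\<close>
  define c where "c = 144 + (C / g) * 1000"
  have c: "c \<ge> 144" using g C by (simp add: c_def)
  define s where "s = 2 + c / 2"
  have s: "s \<ge> 1" using c by (simp add: s_def)
  have "((\<lambda>i. pow32 (ln (real i + 1) + s) / sqrt (real i)) \<longlongrightarrow> 0) sequentially"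
    unfolding pow32_def by real_asymp
  then have "\<forall>\<^sub>F i in sequentially. pow32 (shifted_log s i) / sqrt (real i) < g / (C + 1)"
    unfolding shifted_log_def by (rule order_tendstoD(2)) (use g C in auto)
  then obtain J where J: "\<And>i. i \<ge> J \<Longrightarrow> pow32 (shifted_log s i) / sqrt (real i) < g / (C + 1)"
    unfolding eventually_sequentially by blast
  have "(\<Sum>j=j0..n. profile_drop s j * green_majorant g C i j) \<le> escape_profile s (j0 - 1) * (g / real i - C / pow32 (real i))"
    if i: "j0 \<ge> max J 1" "i \<ge> j0" "n \<ge> i" for j0 i n
  proof -
    have i1: "i \<ge> 1" "j0 \<ge> 1" "i \<ge> J" using i by auto
    define T where "T = 1 / pow32 (shifted_log s i)"
    have T: "T > 0" unfolding T_def using shifted_log_ge_1[OF s, of i] by (simp add: pow32_pos)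
    \<comment> \<open>Contributions from the points before, at and after position \<open>i\<close>.\<close>
    have split: "{j0..n} = {j0..<i} \<union> {i} \<union> {i<..n}" using i by auto
    have ii: "real i * profile_drop s i * green_majorant g C i i \<le> C / 2 * T * 4"
    proof -
      have "log_ratio i i \<le> (real i + 1) / real i - 1" unfolding log_ratio_def using i1 by (intro ln_le_minus_one) auto
      also have "\<dots> \<le> 1" using i1 by (simp add: field_simps)
      finally have "(1 + log_ratio i i)^2 \<le> 2^2" using log_ratio_nonneg[of i i] i1 by (intro power_mono) auto
      then have "(1 + log_ratio i i)^2 * T \<le> 4 * T" using T by (intro mult_right_mono) auto
      then have "1 / pow32 (shifted_log s (i - 1)) \<le> 4 * T"
        using pow32_shifted_log_ratio[OF s i1(1), of i] by (simp add: T_def)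
      then have "real i * profile_drop s i \<le> 1 / 2 * (4 * T)" using profile_drop_le[OF s i1(1)] by simp
      then have "real i * profile_drop s i * C \<le> 1 / 2 * (4 * T) * C" using C by (intro mult_right_mono)
      then show ?thesis by (simp add: green_majorant_def mult_ac)
    qed
    have h: "harm i \<le> ln (real i + 1) + 1"
    proof -
      have "ln (real i) \<le> ln (real i + 1)" using i1 by simp
      then show ?thesis using harm_le_ln[OF i1(1)] by linarith
    qed
    have "(\<Sum>j=j0..n. real i * profile_drop s j * green_majorant g C i j) =
        (\<Sum>j\<in>{j0..<i}. real i * profile_drop s j * green_majorant g C i j) + real i * profile_drop s i * green_majorant g C i i
        + (\<Sum>j\<in>{i<..n}. real i * profile_drop s j * green_majorant g C i j)"
      unfolding split by (subst sum.union_disjoint; (subst sum.union_disjoint)?) auto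
    also have "\<dots> \<le> (g * (escape_profile s (j0 - 1) - escape_profile s (i - 1)) + g / 2 * T * (harm i + 144) + C / 2 * T * 648)
        + C / 2 * T * 4 + (g / 2 * T * harm i + C / 2 * T * 3)"
      using majorant_sum_below[OF s less_imp_le[OF g] C i1(2) i(2)] majorant_sum_above[OF s less_imp_le[OF g] C i1(1), of n] ii
      unfolding T_def by (intro add_mono) auto
    also have "\<dots> \<le> g * (escape_profile s (j0 - 1) - escape_profile s (i - 1)) + g * T * (harm i + c / 2)"
    proof -
      have "C / 2 * T * 655 \<le> C / 2 * T * 1000" using C T by (intro mult_left_mono) auto
      moreover have "g * T * (harm i + c / 2) = g / 2 * T * (harm i + 144) + g / 2 * T * harm i + C / 2 * T * 1000"
        using g by (simp add: c_def field_simps)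
      ultimately show ?thesis by (simp add: algebra_simps)
    qed
    also have "\<dots> \<le> g * escape_profile s (j0 - 1) - g * T"
    proof -
      have "T * shifted_log s i = escape_profile s i"
        using shifted_log_ge_1[OF s, of i] by (simp add: T_def escape_profile_def pow32_def)
      moreover have "escape_profile s i \<le> escape_profile s (i - 1)" by (rule escape_profile_antimono[OF s]) simp
      moreover have "T * (harm i + c / 2) \<le> T * (shifted_log s i - 1)"
        using h T by (intro mult_left_mono) (auto simp: shifted_log_def s_def)
      ultimately have "T * (harm i + c / 2) \<le> escape_profile s (i - 1) - T" by (simp add: right_diff_distrib)
      then have "g * (T * (harm i + c / 2)) \<le> g * (escape_profile s (i - 1) - T)" using g by (intro mult_left_mono) auto
      then show ?thesis by (simp add: algebra_simps)
    qed
    also have "\<dots> \<le> g * escape_profile s (j0 - 1) - C / sqrt (real i) * escape_profile s (j0 - 1)"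
    proof -
      have p1: "escape_profile s (j0 - 1) \<le> 1" using shifted_log_ge_1[OF s, of "j0 - 1"] by (simp add: escape_profile_def)
      have "pow32 (shifted_log s i) * (C + 1) \<le> g * sqrt (real i)"
        using J[OF i1(3)] i1 C by (simp add: field_simps)
      moreover have "pow32 (shifted_log s i) * C \<le> pow32 (shifted_log s i) * (C + 1)"
        using pow32_nonneg[of "shifted_log s i"] shifted_log_ge_1[OF s, of i] by (intro mult_left_mono) auto
      ultimately have "pow32 (shifted_log s i) * C \<le> g * sqrt (real i)" by simp
      moreover have "pow32 (shifted_log s i) > 0" using shifted_log_ge_1[OF s, of i] by (simp add: pow32_pos)
      ultimately have "C / sqrt (real i) \<le> g * T" using i1 by (simp add: T_def field_simps)
      moreover have "C / sqrt (real i) * escape_profile s (j0 - 1) \<le> C / sqrt (real i) * 1"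
        using p1 C by (intro mult_left_mono) auto
      ultimately show ?thesis by simp
    qed
    finally have *: "(\<Sum>j=j0..n. real i * profile_drop s j * green_majorant g C i j) \<le> g * escape_profile s (j0 - 1) - C / sqrt (real i) * escape_profile s (j0 - 1)" .
    have "(\<Sum>j=j0..n. profile_drop s j * green_majorant g C i j) = (\<Sum>j=j0..n. real i * profile_drop s j * green_majorant g C i j) / real i"
      using i1 by (simp add: sum_divide_distrib)
    also have "\<dots> \<le> (g * escape_profile s (j0 - 1) - C / sqrt (real i) * escape_profile s (j0 - 1)) / real i"
      using * by (intro divide_right_mono) auto
    also have "\<dots> = escape_profile s (j0 - 1) * (g / real i - C / pow32 (real i))"
      using i1 by (simp add: pow32_def field_simps)
    finally show ?thesis .
  qed
  then show ?thesis using s by (intro exI[of _ s] conjI exI[of _ "max J 1"]) auto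
qed

section \<open>The discrete Beurling estimate\<close>

lemma adj_norm:
  assumes "adj u (v :: int ^ 3)" shows "euclidean_norm (v - u) = 1"
proof -
  have "adj 0 (v - u)" using assms by (simp add: adj_def abs_minus_commute)
  then obtain i where "v - u = axis i 1 \<or> v - u = - axis i 1" by (auto simp: adj_0_iff)
  moreover have "euclidean_norm (axis i 1 :: int ^ 3) = 1"
  proof -
    have "sqnorm (axis i 1) = (\<Sum>j\<in>UNIV. if j = i then 1 else 0)"
      unfolding sqnorm_def by (intro sum.cong) (auto simp: axis_def)
    then show ?thesis by (simp add: euclidean_norm_sqnorm)
  qed
  ultimately show ?thesis by auto
qed

lemma euclidean_norm_0 [simp]: "euclidean_norm (0 :: int ^ 3) = 0"
  by (simp add: euclidean_norm_sqnorm)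

text \<open>A step changes the distance from \<open>y\<close> by at most one, so a path cannot jump over a spherical shell.\<close>

lemma chain_exists:
  assumes con: "lattice_connected X" and y: "y \<in> X" and u: "u \<in> X" and j: "real j \<le> euclidean_norm (u - y)"
  shows "\<exists>x\<in>X. real j \<le> euclidean_norm (x - y :: int ^ 3) \<and> euclidean_norm (x - y) < real j + 1"
proof -
  have "(y, u) \<in> {(u, v). u \<in> X \<and> v \<in> X \<and> adj u v}\<^sup>*" using con y u by (simp add: lattice_connected_def)
  then show ?thesis using j
  proof (induction rule: rtrancl_induct)
    case base
    then show ?case using y by (intro bexI[of _ y]) auto
  next
    case (step v w)
    have w: "w \<in> X" "adj v w" using step.hyps(2) by auto
    show ?case
    proof (cases "real j \<le> euclidean_norm (v - y)")
      case True then show ?thesis by (rule step.IH)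
    next
      case False
      have "euclidean_norm (w - y) \<le> euclidean_norm (w - v) + euclidean_norm (v - y)"
        using euclidean_norm_triangle[of "w - v" "v - y"] by simp
      then have "euclidean_norm (w - y) < real j + 1" using False adj_norm[OF w(2)] by simp
      then show ?thesis using step.prems w by blast
    qed
  qed
qed

text \<open>The asymptotics in the form in which they are applied to a chain, with the rounding of
  distances to integers absorbed in \<open>C\<close>. The leading constant \<open>g\<close> is the same in both directions.\<close>

lemma green_kernel_bounds:
  obtains g C where "g > 0" "C \<ge> 0"
    "\<And>x k :: nat. k \<ge> 1 \<Longrightarrow> real k \<le> euclidean_norm x \<Longrightarrow> euclidean_norm x < real k + 1 \<Longrightarrow>
        green x \<ge> g / real k - C / pow32 (real k)"
    "\<And>x d :: nat. d \<ge> 1 \<Longrightarrow> euclidean_norm x > real d - 1 \<Longrightarrow> green x \<le> g / real d + C / pow32 (real d)"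
    "\<And>x. green x \<le> C"
proof -
  obtain g C0 where g: "g > 0" "C0 > 0" and
    b: "\<And>x. x \<noteq> 0 \<Longrightarrow> \<bar>green x - g / euclidean_norm x\<bar> \<le> C0 / (euclidean_norm x * sqrt (euclidean_norm x))"
    using green_asymptotics by blast
  obtain M where M: "M > 0" "\<And>x. green x \<le> M / sqrt (sqnorm x + 1)" using green_bound by blast
  have M': "green x \<le> M" for x
  proof -
    have "M / sqrt (sqnorm x + 1) \<le> M / 1" using M(1) by (intro divide_left_mono) auto
    then show ?thesis using M(2)[of x] by simp
  qed
  define C where "C = 2 * g + 3 * C0 + M"
  have C: "C \<ge> 0" "g + C0 \<le> C" "M \<le> C" using g M by (auto simp: C_def)
  have b': "\<bar>green x - g / euclidean_norm x\<bar> \<le> C0 / pow32 (euclidean_norm x)" if "euclidean_norm x > 0" for x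
    using b[of x] that by (cases "x = 0") (auto simp: pow32_def)
  show thesis
  proof (rule that[of g C])
    show "g > 0" "C \<ge> 0" by fact+
    show "green x \<le> C" for x using M'[of x] C by simp
    show "green x \<ge> g / real k - C / pow32 (real k)"
      if k: "k \<ge> 1" "real k \<le> euclidean_norm x" "euclidean_norm x < real k + 1" for x k
    proof -
      define r K where "r = euclidean_norm x" and "K = real k"
      have r: "K \<ge> 1" "K \<le> r" "r < K + 1" using k by (auto simp: r_def K_def)
      have p: "pow32 K > 0" using r by (intro pow32_pos) simp
      have K2: "pow32 K \<le> K * (K + 1)"
      proof -
        have "sqrt K \<le> K + 1" using r by (intro real_le_lsqrt) (auto simp: power2_eq_square algebra_simps)
        then show ?thesis unfolding pow32_def using r by (intro mult_left_mono) auto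
      qed
      have "g / r \<ge> g / (K + 1)" using r g by (intro divide_left_mono) auto
      moreover have "g / K - g / (K + 1) = g / (K * (K + 1))" using r by (simp add: field_simps)
      moreover have "g / (K * (K + 1)) \<le> g / pow32 K"
        using K2 p g r by (intro divide_left_mono) auto
      moreover have "C0 / pow32 r \<le> C0 / pow32 K"
        using r g p pow32_mono[of K r] by (intro divide_left_mono) (auto intro!: mult_pos_pos pow32_pos)
      moreover have "\<bar>green x - g / r\<bar> \<le> C0 / pow32 r" unfolding r_def using b'[of x] r by (simp add: r_def)
      moreover have "(g + C0) / pow32 K \<le> C / pow32 K" using C p by (intro divide_right_mono) auto
      moreover have "(g + C0) / pow32 K = g / pow32 K + C0 / pow32 K" by (rule add_divide_distrib)
      ultimately show ?thesis unfolding K_def[symmetric] by linarith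
    qed
    show "green x \<le> g / real d + C / pow32 (real d)" if d: "d \<ge> 1" "euclidean_norm x > real d - 1" for x d
    proof (cases "d = 1")
      case True
      then show ?thesis using M'[of x] C g by (simp add: pow32_def)
    next
      case False
      define r D where "r = euclidean_norm x" and "D = real d"
      have r: "D \<ge> 2" "r > D - 1" using d False by (auto simp: r_def D_def)
      have p: "pow32 D > 0" "pow32 (D - 1) > 0" using r by (auto intro!: pow32_pos)
      have "\<bar>green x - g / r\<bar> \<le> C0 / pow32 r" unfolding r_def using b'[of x] r by (simp add: r_def)
      moreover have "g / r \<le> g / (D - 1)" using r g by (intro divide_left_mono) auto
      moreover have "g / (D - 1) - g / D = g / (D * (D - 1))" using r by (simp add: field_simps)
      moreover have "g / (D * (D - 1)) \<le> 2 * g / pow32 D"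
      proof -
        have "sqrt D \<le> D" using r by (intro real_le_lsqrt) (auto intro: self_le_power)
        also have "D \<le> 2 * (D - 1)" using r by simp
        finally have "pow32 D \<le> D * (2 * (D - 1))" unfolding pow32_def using r by (intro mult_left_mono) auto
        then have "2 * g / (D * (2 * (D - 1))) \<le> 2 * g / pow32 D"
          using p g r by (intro divide_left_mono) auto
        moreover have "2 * g / (D * (2 * E)) = g / (D * E)" for E by simp
        ultimately show ?thesis by (simp only:)
      qed
      moreover have "C0 / pow32 r \<le> C0 / pow32 (D - 1)"
        using r g p pow32_mono[of "D - 1" r] by (intro divide_left_mono) (auto intro!: mult_pos_pos pow32_pos)
      moreover have "C0 / pow32 (D - 1) \<le> 3 * C0 / pow32 D"
      proof -
        have "pow32 D \<le> pow32 (2 * (D - 1))" using r by (intro pow32_mono) auto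
        also have "\<dots> = pow32 2 * pow32 (D - 1)" by (rule pow32_mult)
        also have "\<dots> \<le> 3 * pow32 (D - 1)"
        proof (rule mult_right_mono)
          have "sqrt 2 \<le> 3 / 2" by (intro real_le_lsqrt) (auto simp: power2_eq_square)
          then show "pow32 2 \<le> 3" by (simp add: pow32_def)
        qed (use p in simp)
        finally have "3 * C0 / (3 * pow32 (D - 1)) \<le> 3 * C0 / pow32 D"
          using g p by (intro divide_left_mono) auto
        then show ?thesis by simp
      qed
      moreover have "2 * g / pow32 D + 3 * C0 / pow32 D \<le> C / pow32 D"
        unfolding add_divide_distrib[symmetric] using p M(1) by (intro divide_right_mono) (auto simp: C_def)
      ultimately show ?thesis unfolding D_def[symmetric] by linarith
    qed
  qed
qed

text \<open>By reciprocity, the capacity of \<open>B\<close> is the equilibrium charge of \<open>X\<close> weighted with the probability of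
  hitting \<open>B\<close>.\<close>

lemma capacity_mono:
  assumes X: "finite X" and B: "B \<subseteq> X"
  shows "capacity B \<le> capacity X"
proof -
  have fB: "finite B" using X B by (rule finite_subset[rotated])
  have sym: "green (a - b) = green (b - a)" for a b using green_uminus[of "a - b"] by simp
  have "capacity B = (\<Sum>z\<in>B. equilibrium B B z * hit_prob X X z)"
    unfolding capacity_def using B by (intro sum.cong) (auto simp: hit_prob_in)
  also have "\<dots> = (\<Sum>z\<in>B. \<Sum>a\<in>X. equilibrium B B z * (equilibrium X X a * green (z - a)))"
    unfolding hit_prob_potential[OF X, of X] sum_distrib_left ..
  also have "\<dots> = (\<Sum>a\<in>X. \<Sum>z\<in>B. equilibrium X X a * (equilibrium B B z * green (a - z)))"
    by (subst sum.swap) (simp add: sym mult.left_commute)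
  also have "\<dots> = (\<Sum>a\<in>X. equilibrium X X a * hit_prob B B a)"
    unfolding hit_prob_potential[OF fB, of B] sum_distrib_left ..
  also have "\<dots> \<le> (\<Sum>a\<in>X. equilibrium X X a * 1)"
    by (intro sum_mono mult_left_mono hit_prob_le_1 equilibrium_nonneg)
  finally show ?thesis by (simp add: capacity_def)
qed

lemma harmonic_measure_mono:
  assumes X: "finite X" and B: "B \<subseteq> X" and y: "y \<in> B"
  shows "harmonic_measure y X \<le> equilibrium B B y / capacity B"
proof -
  have fB: "finite B" using X B by (rule finite_subset[rotated])
  have ne: "B \<noteq> {}" "X \<noteq> {}" using y B by auto
  have "harmonic_measure y X = equilibrium X X y / capacity X" using X ne y B by (intro harmonic_measure_eq) auto
  also have "\<dots> \<le> equilibrium B B y / capacity B"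
    using equilibrium_antimono[OF B y] capacity_mono[OF X B] capacity_pos[OF fB ne(1)] equilibrium_nonneg[of B y]
    by (intro frac_le) auto
  finally show ?thesis .
qed

text \<open>The equilibrium potential is \<open>1\<close> on the set.\<close>

lemma potential_sum_eq:
  assumes B: "finite B" and x: "x \<in> B"
  shows "(\<Sum>a\<in>B. equilibrium B B a * green (a - x)) = 1"
proof -
  have sym: "green (a - x) = green (x - a)" for a using green_uminus[of "a - x"] by simp
  show ?thesis using hit_prob_potential[OF B, of B x] x by (simp add: sym hit_prob_in)
qed

text \<open>Restrict to a chain from \<open>y\<close> and estimate separately the escape probability from \<open>y\<close>, by pairing
  the equilibrium charge with the signed measure built from \<open>escape_profile\<close>, and the capacity.\<close>

lemma beurling_estimate:
  "\<exists>c>0. \<exists>n0. \<forall>X y u n. finite X \<longrightarrow> lattice_connected X \<longrightarrow> y \<in> X \<longrightarrow> u \<in> X \<longrightarrow> n0 \<le> n \<longrightarrow>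
      real n \<le> euclidean_norm (u - y :: int ^ 3) \<longrightarrow> harmonic_measure y X \<le> c * sqrt (ln (real n)) / real n"
proof -
  obtain g C where gC: "g > 0" "C \<ge> 0" and
    lower: "\<And>x k :: nat. k \<ge> 1 \<Longrightarrow> real k \<le> euclidean_norm x \<Longrightarrow> euclidean_norm x < real k + 1 \<Longrightarrow>
        green x \<ge> g / real k - C / pow32 (real k)" and
    upper: "\<And>x d :: nat. d \<ge> 1 \<Longrightarrow> euclidean_norm x > real d - 1 \<Longrightarrow> green x \<le> g / real d + C / pow32 (real d)" and
    upper0: "\<And>x. green x \<le> C"
    using green_kernel_bounds by blast
  obtain s J where s: "s \<ge> 1" and J: "J \<ge> 1" "\<And>j0 i n. j0 \<ge> J \<Longrightarrow> i \<ge> j0 \<Longrightarrow> n \<ge> i \<Longrightarrow>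
     (\<Sum>j=j0..n. profile_drop s j * green_majorant g C i j) \<le> escape_profile s (j0 - 1) * (g / real i - C / pow32 (real i))"
    using profile_inequality[OF gC] by blast
  \<comment> \<open>Beyond distance \<open>j0\<close> the one-dimensional inequality holds and the Green function is at most \<open>1/2\<close>.\<close>
  define j0 where "j0 = max J (nat \<lceil>2 * (g + C)\<rceil> + 1)"
  have j0: "j0 \<ge> J" "j0 \<ge> 1" "real j0 \<ge> 2 * (g + C)"
  proof -
    show "j0 \<ge> J" "j0 \<ge> 1" by (auto simp: j0_def)
    have "real (nat \<lceil>2 * (g + C)\<rceil> + 1) \<le> real j0" by (simp add: j0_def)
    then show "real j0 \<ge> 2 * (g + C)" by linarith
  qed
  define A where "A = escape_profile s (j0 - 1)"
  have A: "A > 0" using shifted_log_ge_1[OF s, of "j0 - 1"] by (simp add: A_def escape_profile_def)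
  define S where "S = C + 2 * g + 6 * C"
  define c where "c = 8 * (S + 2 * g) / A"
  have c: "c > 0" using A gC by (simp add: c_def S_def)
  have main: "harmonic_measure y X \<le> c * sqrt (ln (real n)) / real n"
    if X: "finite X" and con: "lattice_connected X" and y: "y \<in> X" and u: "u \<in> X"
      and n: "max (2 * j0) 3 \<le> n" and un: "real n \<le> euclidean_norm (u - y)"
    for X :: "(int ^ 3) set" and y u n
  proof -
    have "\<exists>x\<in>X. real j \<le> euclidean_norm (x - y) \<and> euclidean_norm (x - y) < real j + 1" if "j \<le> n" for j
      using chain_exists[OF con y u] that un by (meson of_nat_le_iff order_trans)
    then obtain x where x: "\<And>j. j \<le> n \<Longrightarrow> x j \<in> X" "\<And>j. j \<le> n \<Longrightarrow> real j \<le> euclidean_norm (x j - y)"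
      "\<And>j. j \<le> n \<Longrightarrow> euclidean_norm (x j - y) < real j + 1" by metis
    have x0: "x 0 = y"
    proof -
      have "sqnorm (x 0 - y) < 1"
        using x(3)[of 0] by (simp add: euclidean_norm_sqnorm)
      then have "x 0 - y = 0" using sqnorm_ge_1[of "x 0 - y"] by fastforce
      then show ?thesis by simp
    qed
    have kb: "green (x i - x j) \<le> green_majorant g C i j" if "i \<le> n" "j \<le> n" for i j
    proof (cases "i = j")
      case True then show ?thesis using upper0 by (simp add: green_majorant_def)
    next
      case False
      define d where "d = nat \<bar>int i - int j\<bar>"
      have d: "d \<ge> 1" "real d = \<bar>real i - real j\<bar>" using False by (auto simp: d_def)
      have "x i - y - (x j - y) = x i - x j" by simp
      then have "euclidean_norm (x i - x j) \<ge> euclidean_norm (x i - y) - euclidean_norm (x j - y)"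
        using euclidean_norm_diff[of "x i - y" "x j - y"] by simp
      moreover have "x j - y - (x i - y) = - (x i - x j)" by simp
      then have "euclidean_norm (x i - x j) \<ge> euclidean_norm (x j - y) - euclidean_norm (x i - y)"
        using euclidean_norm_diff[of "x j - y" "x i - y"] by (metis euclidean_norm_minus)
      ultimately have "euclidean_norm (x i - x j) > real d - 1"
        unfolding d(2) using x(2,3)[OF that(1)] x(2,3)[OF that(2)] by linarith
      then show ?thesis using upper[OF d(1)] False d(2) by (simp add: green_majorant_def)
    qed
    \<comment> \<open>The tip \<open>x 0 = y\<close> is kept, but the chain resumes only at distance \<open>j0\<close>.\<close>
    define I where "I = insert 0 {j0..n}"
    have In: "i \<le> n" if "i \<in> I" for i using that by (auto simp: I_def)
    have inj: "inj_on x {..n}"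
    proof (rule inj_onI)
      fix i j assume ij: "i \<in> {..n}" "j \<in> {..n}" "x i = x j"
      then have "real i < real j + 1" "real j < real i + 1"
        using x(2)[of i] x(3)[of i] x(2)[of j] x(3)[of j] by auto
      then show "i = j" by linarith
    qed
    have injI: "inj_on x I" by (rule inj_on_subset[OF inj]) (auto dest: In)
    define B where "B = x ` I"
    have fB: "finite B" by (simp add: B_def I_def)
    have BX: "B \<subseteq> X" using x(1) In by (auto simp: B_def)
    have yB: "y \<in> B" using x0 by (auto simp: B_def I_def)
    have xB: "x j \<in> B" if "j \<in> {j0..n}" for j using that by (auto simp: B_def I_def)
    let ?e = "equilibrium B B"
    \<comment> \<open>The potential of mass \<open>A\<close> at \<open>y\<close> and mass \<open>- profile_drop s j\<close> at \<open>x j\<close>.\<close>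
    define m where "m a = A * green (a - y) - (\<Sum>j=j0..n. profile_drop s j * green (a - x j))" for a
    have tele: "A - (\<Sum>j=j0..n. profile_drop s j) = escape_profile s n"
    proof -
      have "j0 \<le> n" using n by simp
      then show ?thesis
      proof (induction n rule: dec_induct)
        case base then show ?case by (simp add: A_def profile_drop_def)
      next
        case (step k) then show ?case by (simp add: profile_drop_def)
      qed
    qed
    have m_sum: "(\<Sum>a\<in>B. ?e a * m a) = escape_profile s n"
    proof -
      have "(\<Sum>a\<in>B. ?e a * m a) = A * (\<Sum>a\<in>B. ?e a * green (a - y))
          - (\<Sum>a\<in>B. \<Sum>j=j0..n. profile_drop s j * (?e a * green (a - x j)))"
        unfolding m_def right_diff_distrib sum_subtractf sum_distrib_left by (simp add: mult.left_commute)
      also have "(\<Sum>a\<in>B. \<Sum>j=j0..n. profile_drop s j * (?e a * green (a - x j))) = (\<Sum>j=j0..n. profile_drop s j * (\<Sum>a\<in>B. ?e a * green (a - x j)))"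
        by (subst sum.swap) (simp add: sum_distrib_left)
      also have "\<dots> = (\<Sum>j=j0..n. profile_drop s j)"
        using potential_sum_eq[OF fB xB] by (intro sum.cong) auto
      finally show ?thesis using potential_sum_eq[OF fB yB] tele by simp
    qed
    have m_nonneg: "m (x i) \<ge> 0" if i: "i \<in> {j0..n}" for i
    proof -
      have i': "j0 \<le> i" "i \<le> n" "1 \<le> i" using i j0 by auto
      have "(\<Sum>j=j0..n. profile_drop s j * green (x i - x j)) \<le> (\<Sum>j=j0..n. profile_drop s j * green_majorant g C i j)"
        using kb i' by (intro sum_mono mult_left_mono profile_drop_nonneg[OF s]) auto
      also have "\<dots> \<le> A * (g / real i - C / pow32 (real i))"
        unfolding A_def by (rule J(2)) (use j0 i' in auto)
      also have "\<dots> \<le> A * green (x i - y)"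
        using lower[OF i'(3)] x(2,3)[OF i'(2)] A by (intro mult_left_mono) auto
      finally show ?thesis by (simp add: m_def)
    qed
    have m_y: "m y \<ge> A / 2"
    proof -
      have half: "green (y - x j) \<le> 1 / 2" if j: "j \<in> {j0..n}" for j
      proof -
        have j': "j0 \<le> j" "j \<le> n" "1 \<le> j" using j j0 by auto
        have "euclidean_norm (y - x j) = euclidean_norm (x j - y)"
          using euclidean_norm_minus[of "x j - y"] by simp
        then have "green (y - x j) \<le> g / real j + C / pow32 (real j)"
          using upper[OF j'(3)] x(2)[OF j'(2)] by simp
        also have "C / pow32 (real j) \<le> C / real j"
        proof -
          have "real j * 1 \<le> pow32 (real j)" unfolding pow32_def using j' by (intro mult_left_mono) auto
          then show ?thesis using gC j' by (intro divide_left_mono) (auto intro!: mult_pos_pos pow32_pos)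
        qed
        also have "g / real j + C / real j = (g + C) / real j" by (simp add: add_divide_distrib)
        also have "\<dots> \<le> 1 / 2"
        proof -
          have "2 * (g + C) \<le> real j" using j0(3) j'(1) by (meson of_nat_le_iff order_trans)
          then show ?thesis using j' by (simp add: field_simps)
        qed
        finally show ?thesis by simp
      qed
      have "(\<Sum>j=j0..n. profile_drop s j * green (y - x j)) \<le> (\<Sum>j=j0..n. profile_drop s j * (1/2))"
        using half by (intro sum_mono mult_left_mono profile_drop_nonneg[OF s]) auto
      also have "\<dots> = (\<Sum>j=j0..n. profile_drop s j) / 2" by (simp add: sum_divide_distrib)
      also have "\<dots> \<le> A / 2"
      proof -
        have "escape_profile s n \<ge> 0" using shifted_log_ge_1[OF s, of n] by (simp add: escape_profile_def)
        then show ?thesis using tele by simp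
      qed
      finally have "(\<Sum>j=j0..n. profile_drop s j * green (y - x j)) \<le> A / 2" .
      moreover have "A * 1 \<le> A * green 0" using A green_0_ge_1 by (intro mult_left_mono) auto
      ultimately show ?thesis by (simp add: m_def)
    qed
    \<comment> \<open>Only the tip is kept from a sum of nonnegative terms.\<close>
    have esc: "?e y * (A / 2) \<le> escape_profile s n"
    proof -
      have mB: "m a \<ge> 0" if "a \<in> B" for a
        using that m_nonneg m_y A x0 by (auto simp: B_def I_def)
      have "?e y * (A / 2) \<le> ?e y * m y" using m_y equilibrium_nonneg by (intro mult_left_mono) auto
      also have "\<dots> \<le> (\<Sum>a\<in>B. ?e a * m a)"
        using mB equilibrium_nonneg by (intro member_le_sum[of y B "\<lambda>a. ?e a * m a"] yB fB) auto
      finally show ?thesis using m_sum by simp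
    qed
    define L where "L = ln (real n)"
    have L: "L \<ge> 1"
    proof -
      have "exp 1 \<le> (3 :: real)" by (rule exp_le)
      also have "3 \<le> real n" using n by simp
      finally show ?thesis using n by (simp add: L_def ln_ge_iff)
    qed
    have profn: "escape_profile s n \<le> 1 / sqrt L"
    proof -
      have "L \<le> shifted_log s n" using s n by (simp add: L_def shifted_log_def add_increasing2)
      then show ?thesis unfolding escape_profile_def using L by (intro divide_left_mono) auto
    qed
    \<comment> \<open>The potential of unit masses on the chain, seen from any point of it.\<close>
    have ks: "(\<Sum>j=j0..n. green (x j - x i)) \<le> (S + 2 * g) * L" if i: "i \<le> n" for i
    proof -
      have "(\<Sum>j=j0..n. green (x j - x i)) \<le> (\<Sum>j=0..n. green (x j - x i))"
        by (intro sum_mono2) (auto simp: green_nonneg)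
      also have "\<dots> \<le> (\<Sum>j=0..n. green_majorant g C j i)" using kb i by (intro sum_mono) auto
      also have "\<dots> = (\<Sum>j\<in>{0..<i}. green_majorant g C j i) + green_majorant g C i i + (\<Sum>j\<in>{i<..n}. green_majorant g C j i)"
      proof -
        have "{0..n} = {0..<i} \<union> {i} \<union> {i<..n}" using i by auto
        then show ?thesis by (simp only:) (subst sum.union_disjoint; (subst sum.union_disjoint)?; auto)
      qed
      also have "(\<Sum>j\<in>{0..<i}. green_majorant g C j i) \<le> (\<Sum>k=1..n. g / real k + C / pow32 (real k))"
      proof -
        have "(\<Sum>j\<in>{0..<i}. green_majorant g C j i) = (\<Sum>j\<in>{0..<i}. g / real (i - j) + C / pow32 (real (i - j)))"
          by (intro sum.cong) (auto simp: green_majorant_def of_nat_diff)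
        also have "\<dots> \<le> (\<Sum>k=1..n. g / real k + C / pow32 (real k))"
        proof (rule sum_inj_le[of "\<lambda>j. i - j"])
          show "inj_on (\<lambda>j. i - j) {0..<i}" by (auto simp: inj_on_def)
          show "(\<lambda>j. i - j) ` {0..<i} \<subseteq> {1..n}" using i by auto
        qed (use gC in \<open>auto intro!: add_nonneg_nonneg divide_nonneg_nonneg pow32_nonneg\<close>)
        finally show ?thesis .
      qed
      also have "(\<Sum>j\<in>{i<..n}. green_majorant g C j i) \<le> (\<Sum>k=1..n. g / real k + C / pow32 (real k))"
      proof -
        have "(\<Sum>j\<in>{i<..n}. green_majorant g C j i) = (\<Sum>j\<in>{i<..n}. g / real (j - i) + C / pow32 (real (j - i)))"
          by (intro sum.cong) (auto simp: green_majorant_def of_nat_diff)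
        also have "\<dots> \<le> (\<Sum>k=1..n. g / real k + C / pow32 (real k))"
        proof (rule sum_inj_le[of "\<lambda>j. j - i"])
          show "inj_on (\<lambda>j. j - i) {i<..n}" by (rule inj_onI) auto
          show "(\<lambda>j. j - i) ` {i<..n} \<subseteq> {1..n}" by auto
        qed (use gC in \<open>auto intro!: add_nonneg_nonneg divide_nonneg_nonneg pow32_nonneg\<close>)
        finally show ?thesis .
      qed
      also have "(\<Sum>k=1..n. g / real k + C / pow32 (real k)) = g * harm n + C * (\<Sum>k=1..n. 1 / pow32 (real k))"
        by (simp add: sum.distrib harm_def sum_distrib_left inverse_eq_divide)
      finally have 1: "(\<Sum>j=j0..n. green (x j - x i)) \<le> (g * harm n + C * (\<Sum>k=1..n. 1 / pow32 (real k))) + C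
          + (g * harm n + C * (\<Sum>k=1..n. 1 / pow32 (real k)))" by (simp add: green_majorant_def)
      have 2: "C * (\<Sum>k=1..n. 1 / pow32 (real k)) \<le> C * 3"
        by (intro mult_left_mono sum_inv_pow32_le gC)
      have 3: "g * harm n \<le> g * (L + 1)" unfolding L_def
        using n gC by (intro mult_left_mono harm_le_ln) auto
      have 4: "S * 1 \<le> S * L" using L gC by (intro mult_left_mono) (auto simp: S_def)
      have 5: "2 * (g * (L + 1)) + C + 6 * C = S + 2 * g * L" by (simp add: S_def algebra_simps)
      have "(\<Sum>j=j0..n. green (x j - x i)) \<le> 2 * (g * (L + 1)) + C + 6 * C" using 1 2 3 by linarith
      also have "\<dots> \<le> (S + 2 * g) * L" unfolding 5 using 4 by (simp add: distrib_right)
      finally show ?thesis .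
    qed
    \<comment> \<open>Integrate the equilibrium potential, which is \<open>1\<close> on the chain, over the chain.\<close>
    have cap: "real n / 2 \<le> capacity B * ((S + 2 * g) * L)"
    proof -
      have "real n / 2 \<le> real (card {j0..n})" using n by (simp add: of_nat_diff)
      also have "\<dots> = (\<Sum>j=j0..n. (\<Sum>a\<in>B. ?e a * green (a - x j)))"
        using potential_sum_eq[OF fB xB] by simp
      also have "\<dots> = (\<Sum>a\<in>B. ?e a * (\<Sum>j=j0..n. green (a - x j)))"
        by (subst sum.swap) (simp add: sum_distrib_left)
      also have "\<dots> \<le> (\<Sum>a\<in>B. ?e a * ((S + 2 * g) * L))"
      proof (intro sum_mono mult_left_mono equilibrium_nonneg)
        fix a assume "a \<in> B"
        then obtain i where i: "i \<in> I" "a = x i" by (auto simp: B_def)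
        have sym: "green (a - x j) = green (x j - a)" for j using green_uminus[of "a - x j"] by simp
        show "(\<Sum>j=j0..n. green (a - x j)) \<le> (S + 2 * g) * L"
          unfolding sym unfolding i(2) by (rule ks[OF In[OF i(1)]])
      qed
      also have "\<dots> = capacity B * ((S + 2 * g) * L)" by (simp add: capacity_def sum_distrib_right)
      finally show ?thesis .
    qed
    have cB: "capacity B > 0" using fB yB by (intro capacity_pos) auto
    define D where "D = (S + 2 * g)"
    have D: "D > 0" using gC by (simp add: D_def S_def)
    have np: "real n > 0" using n by simp
    have e1: "?e y \<le> 2 / (A * sqrt L)"
    proof -
      have "?e y * (A / 2) \<le> 1 / sqrt L" using esc profn by simp
      then show ?thesis using A L by (simp add: field_simps)
    qed
    have e2: "1 / capacity B \<le> 2 * D * L / real n"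
      using cap cB np L D unfolding D_def[symmetric] by (simp add: field_simps)
    have "harmonic_measure y X \<le> ?e y * (1 / capacity B)"
      using harmonic_measure_mono[OF X BX yB] by simp
    also have "\<dots> \<le> 2 / (A * sqrt L) * (2 * D * L / real n)"
      using e1 e2 cB A L equilibrium_nonneg[of B y] by (intro mult_mono) auto
    also have "\<dots> = 4 * D / A * (L / sqrt L) / real n" by simp
    also have "L / sqrt L = sqrt L" using L by (simp add: real_div_sqrt)
    also have "4 * D / A * sqrt L / real n \<le> c * sqrt L / real n"
    proof -
      have "4 * D / A \<le> 8 * D / A" using A D by (intro divide_right_mono) auto
      then have "4 * D / A * sqrt L \<le> 8 * D / A * sqrt L"
        by (rule mult_right_mono) (use L in simp)
      then show ?thesis
        unfolding c_def D_def[symmetric] by (rule divide_right_mono) simp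
    qed
    finally show ?thesis by (simp add: L_def)
  qed
  then show ?thesis using c by (intro exI[of _ c] conjI exI[of _ "max (2 * j0) 3"]) auto
qed

section \<open>Transition probabilities of the dielectric-breakdown model\<close>

lemma adj_diff: "adj u (v :: int ^ 3) \<Longrightarrow> adj 0 (v - u)"
  by (simp add: adj_def abs_minus_commute)

lemma adj_add: "adj 0 e \<Longrightarrow> adj u (u + e :: int ^ 3)"
  by (simp add: adj_def)

lemma adj_sym: "adj u (v :: int ^ 3) \<Longrightarrow> adj v u"
  by (simp add: adj_def abs_minus_commute)

lemma outer_boundary_subset:
  "outer_boundary A \<subseteq> (\<lambda>(x, e). x + e) ` (A \<times> {e :: int ^ 3. adj 0 e})"
proof
  fix y assume "y \<in> outer_boundary A"
  then obtain x where "x \<in> A" "adj x y" by (auto simp: outer_boundary_def)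
  then show "y \<in> (\<lambda>(x, e). x + e) ` (A \<times> {e. adj 0 e})"
    by (intro image_eqI[where x = "(x, y - x)"]) (auto intro: adj_diff)
qed

lemma finite_outer_boundary: "finite A \<Longrightarrow> finite (outer_boundary (A :: (int ^ 3) set))"
  by (rule finite_subset[OF outer_boundary_subset]) auto

lemma card_outer_boundary:
  assumes "finite A" shows "card (outer_boundary (A :: (int ^ 3) set)) \<le> 6 * card A"
proof -
  have "card (outer_boundary A) \<le> card ((\<lambda>(x, e). x + e) ` (A \<times> {e :: int ^ 3. adj 0 e}))"
    using assms by (intro card_mono outer_boundary_subset) auto
  also have "\<dots> \<le> card (A \<times> {e :: int ^ 3. adj 0 e})" using assms by (intro card_image_le) auto
  also have "\<dots> = 6 * card A" by (simp add: card_cartesian_product card_unit_steps)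
  finally show ?thesis .
qed

lemma finite_closure: "finite A \<Longrightarrow> finite (lattice_closure (A :: (int ^ 3) set))"
  by (simp add: lattice_closure_def finite_outer_boundary)

text \<open>Every site of \<open>X\<close> is in \<open>A\<close> or adjacent to it.\<close>

lemma connected_between:
  assumes con: "lattice_connected A" and X: "A \<subseteq> X" "X \<subseteq> lattice_closure (A :: (int ^ 3) set)"
  shows "lattice_connected X"
proof -
  define R where "R X = {(u, v). u \<in> X \<and> v \<in> X \<and> adj u v}" for X :: "(int ^ 3) set"
  have mono: "(R A)\<^sup>* \<subseteq> (R X)\<^sup>*"
    using X(1) by (intro rtrancl_mono) (auto simp: R_def)
  have near: "\<exists>a\<in>A. (x, a) \<in> (R X)\<^sup>* \<and> (a, x) \<in> (R X)\<^sup>*" if "x \<in> X" for x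
  proof (cases "x \<in> A")
    case True then show ?thesis by auto
  next
    case False
    moreover have "x \<in> lattice_closure A" using that X(2) by blast
    ultimately obtain a where a: "a \<in> A" "adj a x" by (auto simp: lattice_closure_def outer_boundary_def)
    then have "(x, a) \<in> R X" "(a, x) \<in> R X"
      using that X(1) adj_sym[OF a(2)] by (auto simp: R_def)
    then show ?thesis using a(1) by auto
  qed
  have "(x, y) \<in> (R X)\<^sup>*" if xy: "x \<in> X" "y \<in> X" for x y
  proof -
    obtain a where a: "a \<in> A" "(x, a) \<in> (R X)\<^sup>*" using near[OF xy(1)] by blast
    obtain b where b: "b \<in> A" "(b, y) \<in> (R X)\<^sup>*" using near[OF xy(2)] by blast
    have "(a, b) \<in> (R A)\<^sup>*" using con a(1) b(1) by (simp add: lattice_connected_def R_def)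
    then have "(a, b) \<in> (R X)\<^sup>*" using mono by blast
    then show ?thesis using a(2) b(2) by (meson rtrancl_trans)
  qed
  then show ?thesis by (simp add: lattice_connected_def R_def)
qed

text \<open>A walk from far away cannot enter the closure at an interior site: such a site has all its
  neighbours in the closure and carries no equilibrium charge.\<close>

lemma harmonic_measure_boundary:
  assumes A: "finite (A :: (int ^ 3) set)" "A \<noteq> {}"
  shows "(\<Sum>z\<in>outer_boundary A. harmonic_measure z (lattice_closure A)) = 1"
    and "y \<in> outer_boundary A \<Longrightarrow> harmonic_measure y (lattice_closure A) \<ge> 0"
proof -
  define X where "X = lattice_closure A"
  have X: "finite X" "X \<noteq> {}" using finite_closure[OF A(1)] A(2) by (auto simp: X_def lattice_closure_def)
  have cap: "capacity X > 0" by (rule capacity_pos[OF X])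
  have hm: "harmonic_measure z X = equilibrium X X z / capacity X" if "z \<in> X" for z
    by (rule harmonic_measure_eq[OF X that])
  have bX: "z \<in> X" if "z \<in> outer_boundary A" for z
    using that by (simp add: X_def lattice_closure_def)
  have XA: "z \<in> A" if "z \<in> X" "z \<notin> outer_boundary A" for z
    using that by (simp add: X_def lattice_closure_def)
  have inner: "equilibrium X X z = 0" if "z \<in> A" for z
  proof -
    have nb: "z + e \<in> X" if "adj 0 e" for e
    proof (cases "z + e \<in> A")
      case True then show ?thesis by (simp add: X_def lattice_closure_def)
    next
      case False
      have "adj z (z + e)" using that by (rule adj_add)
      then show ?thesis using False \<open>z \<in> A\<close> by (auto simp: X_def lattice_closure_def outer_boundary_def)
    qed
    have "walk_mean (hit_prob X X) z = (\<Sum>e\<in>{e :: int ^ 3. adj 0 e}. 1) / 6"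
      unfolding walk_mean_def using nb by (intro arg_cong[where f = "\<lambda>t. t / 6"] sum.cong) (auto simp: hit_prob_in)
    then show ?thesis using that by (simp add: equilibrium_def card_unit_steps hit_prob_in X_def lattice_closure_def)
  qed
  have "(\<Sum>z\<in>outer_boundary A. harmonic_measure z X) = (\<Sum>z\<in>outer_boundary A. equilibrium X X z) / capacity X"
    unfolding sum_divide_distrib by (intro sum.cong refl hm bX)
  also have "(\<Sum>z\<in>outer_boundary A. equilibrium X X z) = capacity X"
    unfolding capacity_def
    using X bX XA inner by (intro sum.mono_neutral_left) blast+
  finally show "(\<Sum>z\<in>outer_boundary A. harmonic_measure z (lattice_closure A)) = 1"
    using cap by (simp add: X_def)
  show "harmonic_measure y (lattice_closure A) \<ge> 0" if "y \<in> outer_boundary A"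
    using hm[OF bX[OF that]] cap equilibrium_nonneg[of X y] unfolding X_def[symmetric] by simp
qed

lemma dbm_weight_nonneg: "dbm_weight \<eta> A y \<ge> 0"
  by (simp add: dbm_weight_def)

definition dbm_rate :: "real \<Rightarrow> (int ^ 3) set \<Rightarrow> int ^ 3 \<Rightarrow> real" where
  "dbm_rate \<eta> A y = dbm_weight \<eta> A y / (\<Sum>z\<in>outer_boundary A. dbm_weight \<eta> A z)"

lemma powr_split:
  fixes x \<eta> :: real assumes "x > 0" shows "x powr \<eta> = x * x powr (\<eta> - 1)"
  using assms by (simp add: powr_diff)

lemma dbm_weight_le:
  assumes A: "finite (A :: (int ^ 3) set)" "A \<noteq> {}" and \<eta>: "\<eta> \<ge> 0"
    and \<Omega>: "\<Omega> > 0" "harmonic_measure y (lattice_closure A) \<le> \<Omega>" and y: "y \<in> outer_boundary A"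
  shows "dbm_weight \<eta> A y \<le> \<Omega> powr \<eta>"
  using harmonic_measure_boundary(2)[OF A y] assms by (auto simp: dbm_weight_def intro: powr_mono2)

text \<open>If all \<open>\<omega> z \<le> \<Omega>\<close>, then \<open>\<omega> z powr \<eta> \<ge> \<omega> z * \<Omega> powr (\<eta> - 1)\<close> for \<open>\<eta> < 1\<close>, and the \<open>\<omega> z\<close>
  add up to \<open>1\<close>.\<close>

lemma dbm_total_lower_small:
  assumes A: "finite (A :: (int ^ 3) set)" "A \<noteq> {}" and \<eta>: "0 \<le> \<eta>" "\<eta> < 1"
    and \<Omega>: "\<Omega> > 0" "\<And>z. z \<in> outer_boundary A \<Longrightarrow> harmonic_measure z (lattice_closure A) \<le> \<Omega>"
  shows "(\<Sum>z\<in>outer_boundary A. dbm_weight \<eta> A z) \<ge> \<Omega> powr (\<eta> - 1)"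
proof -
  let ?h = "\<lambda>z. harmonic_measure z (lattice_closure A)"
  have "?h z * \<Omega> powr (\<eta> - 1) \<le> dbm_weight \<eta> A z" if z: "z \<in> outer_boundary A" for z
  proof (cases "?h z = 0")
    case True then show ?thesis using dbm_weight_nonneg by simp
  next
    case False
    then have h: "?h z > 0" using harmonic_measure_boundary(2)[OF A z] by simp
    have "\<Omega> powr (\<eta> - 1) \<le> ?h z powr (\<eta> - 1)"
      using \<Omega>(2)[OF z] h \<eta> by (intro powr_mono2') auto
    then have "?h z * \<Omega> powr (\<eta> - 1) \<le> ?h z * ?h z powr (\<eta> - 1)" using h by (intro mult_left_mono) auto
    also have "\<dots> = ?h z powr \<eta>" using h by (rule powr_split[symmetric])
    also have "\<dots> = dbm_weight \<eta> A z" using h by (simp add: dbm_weight_def)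
    finally show ?thesis .
  qed
  then have "(\<Sum>z\<in>outer_boundary A. ?h z * \<Omega> powr (\<eta> - 1)) \<le> (\<Sum>z\<in>outer_boundary A. dbm_weight \<eta> A z)"
    by (intro sum_mono)
  moreover have "(\<Sum>z\<in>outer_boundary A. ?h z * \<Omega> powr (\<eta> - 1)) = \<Omega> powr (\<eta> - 1)"
    unfolding sum_distrib_right[symmetric] harmonic_measure_boundary(1)[OF A] by simp
  ultimately show ?thesis by simp
qed

text \<open>The sites with harmonic measure above \<open>t = 1 / (2 * N)\<close> carry at least half of the mass, and for them
  \<open>\<omega> powr \<eta> \<ge> \<omega> * t powr (\<eta> - 1)\<close>. Both cases are covered by \<open>\<omega> powr \<eta> \<ge> (\<omega> - t) * t powr (\<eta> - 1)\<close>.\<close>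

lemma dbm_total_lower_large:
  assumes A: "finite (A :: (int ^ 3) set)" "A \<noteq> {}" and \<eta>: "\<eta> \<ge> 1" and N: "real (card (outer_boundary A)) \<le> N" "N > 0"
  shows "(\<Sum>z\<in>outer_boundary A. dbm_weight \<eta> A z) \<ge> (2 * N) powr (1 - \<eta>) / 2"
proof -
  let ?h = "\<lambda>z. harmonic_measure z (lattice_closure A)"
  define t where "t = 1 / (2 * N)"
  have t: "t > 0" using N by (simp add: t_def)
  have tp: "t powr (\<eta> - 1) = (2 * N) powr (1 - \<eta>)"
    using N by (simp add: t_def powr_divide powr_minus_divide[symmetric])
  have "(?h z - t) * t powr (\<eta> - 1) \<le> dbm_weight \<eta> A z" if z: "z \<in> outer_boundary A" for z
  proof (cases "?h z \<le> t")
    case True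
    then have "(?h z - t) * t powr (\<eta> - 1) \<le> 0" by (intro mult_nonpos_nonneg) auto
    then show ?thesis using dbm_weight_nonneg[of \<eta> A z] by linarith
  next
    case False
    then have h: "?h z > t" by simp
    have "(?h z - t) * t powr (\<eta> - 1) \<le> ?h z * ?h z powr (\<eta> - 1)"
      using h t \<eta> by (intro mult_mono powr_mono2) auto
    also have "\<dots> = ?h z powr \<eta>" using h t by (intro powr_split[symmetric]) auto
    finally show ?thesis using \<eta> by (simp add: dbm_weight_def)
  qed
  then have "(\<Sum>z\<in>outer_boundary A. (?h z - t) * t powr (\<eta> - 1)) \<le> (\<Sum>z\<in>outer_boundary A. dbm_weight \<eta> A z)"
    by (intro sum_mono)
  moreover have "(\<Sum>z\<in>outer_boundary A. (?h z - t) * t powr (\<eta> - 1))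
      = (1 - real (card (outer_boundary A)) * t) * t powr (\<eta> - 1)"
    unfolding sum_distrib_right[symmetric] sum_subtractf harmonic_measure_boundary(1)[OF A] by simp
  moreover have "(1 - real (card (outer_boundary A)) * t) * t powr (\<eta> - 1) \<ge> 1 / 2 * t powr (\<eta> - 1)"
  proof (rule mult_right_mono)
    have "real (card (outer_boundary A)) * t \<le> N * t" using N t by (intro mult_right_mono) auto
    also have "N * t = 1 / 2" using N by (simp add: t_def)
    finally show "1 / 2 \<le> 1 - real (card (outer_boundary A)) * t" by simp
  qed simp
  ultimately show ?thesis unfolding tp by simp
qed

lemma dbm_total_pos:
  assumes A: "finite (A :: (int ^ 3) set)" "A \<noteq> {}" and \<eta>: "\<eta> \<ge> 0"
  shows "(\<Sum>z\<in>outer_boundary A. dbm_weight \<eta> A z) > 0"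
proof (cases "\<eta> < 1")
  case True
  let ?h = "\<lambda>z. harmonic_measure z (lattice_closure A)"
  \<comment> \<open>The harmonic measures add up to \<open>1\<close>, so \<open>\<Omega> = 1\<close> is admissible.\<close>
  have le: "?h z \<le> 1" if "z \<in> outer_boundary A" for z
    using member_le_sum[of z "outer_boundary A" ?h] that harmonic_measure_boundary[OF A] finite_outer_boundary[OF A(1)]
    by auto
  have "1 powr (\<eta> - 1) \<le> (\<Sum>z\<in>outer_boundary A. dbm_weight \<eta> A z)"
    by (rule dbm_total_lower_small[OF A \<eta> True _ le]) auto
  then show ?thesis by simp
next
  case False
  have "0 < (2 * (real (card (outer_boundary A)) + 1)) powr (1 - \<eta>) / 2" by simp
  also have "\<dots> \<le> (\<Sum>z\<in>outer_boundary A. dbm_weight \<eta> A z)"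
    using False by (intro dbm_total_lower_large[OF A]) auto
  finally show ?thesis .
qed

lemma dbm_rate_sum:
  assumes A: "finite (A :: (int ^ 3) set)" "A \<noteq> {}" and \<eta>: "\<eta> \<ge> 0"
  shows "(\<Sum>y\<in>outer_boundary A. dbm_rate \<eta> A y) = 1"
  using dbm_total_pos[OF A \<eta>] by (simp add: dbm_rate_def sum_divide_distrib[symmetric])

lemma dbm_rate_le_small:
  assumes A: "finite (A :: (int ^ 3) set)" "A \<noteq> {}" and \<eta>: "0 \<le> \<eta>" "\<eta> < 1"
    and \<Omega>: "\<Omega> > 0" "\<And>z. z \<in> outer_boundary A \<Longrightarrow> harmonic_measure z (lattice_closure A) \<le> \<Omega>"
    and y: "y \<in> outer_boundary A"
  shows "dbm_rate \<eta> A y \<le> \<Omega>"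
proof -
  have "dbm_rate \<eta> A y \<le> \<Omega> powr \<eta> / \<Omega> powr (\<eta> - 1)"
    unfolding dbm_rate_def
    using dbm_weight_le[OF A \<eta>(1) \<Omega>(1) \<Omega>(2)[OF y] y] dbm_total_lower_small[OF A \<eta> \<Omega>] \<Omega>(1)
    by (intro frac_le) auto
  also have "\<dots> = \<Omega>" using \<Omega>(1) by (simp add: powr_diff)
  finally show ?thesis .
qed

lemma dbm_rate_le_large:
  assumes A: "finite (A :: (int ^ 3) set)" "A \<noteq> {}" and \<eta>: "\<eta> \<ge> 1" and N: "real (card (outer_boundary A)) \<le> N" "N > 0"
    and \<Omega>: "\<Omega> > 0" "\<And>z. z \<in> outer_boundary A \<Longrightarrow> harmonic_measure z (lattice_closure A) \<le> \<Omega>"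
    and y: "y \<in> outer_boundary A"
  shows "dbm_rate \<eta> A y \<le> 2 * (2 * N) powr (\<eta> - 1) * \<Omega> powr \<eta>"
proof -
  have "dbm_rate \<eta> A y \<le> \<Omega> powr \<eta> / ((2 * N) powr (1 - \<eta>) / 2)"
    unfolding dbm_rate_def
    using dbm_weight_le[OF A _ \<Omega>(1) \<Omega>(2)[OF y] y, of \<eta>] dbm_total_lower_large[OF A \<eta> N] \<eta> N
    by (intro frac_le) auto
  also have "\<dots> = 2 * (2 * N) powr (\<eta> - 1) * \<Omega> powr \<eta>"
    using N by (simp add: powr_diff field_simps)
  finally show ?thesis .
qed

section \<open>Histories and arms of the process\<close>

text \<open>The possible evolutions up to time \<open>n\<close>, continued by the empty set. The default value makes a history
  determined by its first \<open>n + 1\<close> sets, so that there are only finitely many.\<close>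

primrec histories :: "nat \<Rightarrow> (nat \<Rightarrow> (int ^ 3) set) set" where
  "histories 0 = {\<lambda>i. if i = 0 then {0} else {}}"
| "histories (Suc n) = (\<Union>a\<in>histories n. (\<lambda>y. a(Suc n := a n \<union> {y})) ` outer_boundary (a n))"

lemma histories_props_all:
  "a \<in> histories n \<Longrightarrow> a 0 = {0} \<and> (\<forall>i\<le>n. finite (a i) \<and> 0 \<in> a i \<and> card (a i) \<le> Suc i) \<and>
     (\<forall>i>n. a i = {}) \<and> (\<forall>i<n. \<exists>y\<in>outer_boundary (a i). a (Suc i) = a i \<union> {y})"
proof (induction n arbitrary: a)
  case 0 then show ?case by simp
next
  case (Suc n)
  from Suc.prems obtain b y where b: "b \<in> histories n" "y \<in> outer_boundary (b n)" "a = b(Suc n := b n \<union> {y})" by auto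
  note IH = Suc.IH[OF b(1)]
  show ?case
  proof (intro conjI allI impI)
    show "a 0 = {0}" using IH b(3) by simp
    fix i
    show "a i = {}" if "Suc n < i" using that b(3) IH by simp
    have *: "finite (a i) \<and> 0 \<in> a i \<and> card (a i) \<le> Suc i" if "i \<le> Suc n"
    proof (cases "i = Suc n")
      case True
      have "card (b n \<union> {y}) \<le> card (b n) + 1" by (rule order_trans[OF card_Un_le]) simp
      moreover have "finite (b n)" "0 \<in> b n" "card (b n) \<le> Suc n" using IH by auto
      ultimately show ?thesis using True b(3) by simp
    next
      case False then show ?thesis using that b(3) IH by simp
    qed
    show "finite (a i)" if "i \<le> Suc n" using *[OF that] by simp
    show "0 \<in> a i" if "i \<le> Suc n" using *[OF that] by simp
    show "card (a i) \<le> Suc i" if "i \<le> Suc n" using *[OF that] by simp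
    show "\<exists>y\<in>outer_boundary (a i). a (Suc i) = a i \<union> {y}" if "i < Suc n"
    proof (cases "i = n")
      case True then show ?thesis using b by auto
    next
      case False then show ?thesis using that b(3) IH by simp
    qed
  qed
qed

lemma histories_props:
  assumes "a \<in> histories n"
  shows "a 0 = {0}" "\<And>i. i \<le> n \<Longrightarrow> finite (a i) \<and> 0 \<in> a i \<and> card (a i) \<le> Suc i" "\<And>i. n < i \<Longrightarrow> a i = {}"
    "\<And>i. i < n \<Longrightarrow> \<exists>y\<in>outer_boundary (a i). a (Suc i) = a i \<union> {y}"
  using histories_props_all[OF assms] by simp_all

lemma histories_connected:
  assumes a: "a \<in> histories n" and i: "i \<le> n" shows "lattice_connected (a i)"
  using i
proof (induction i)
  case 0 then show ?case using histories_props(1)[OF a] by (simp add: lattice_connected_def)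
next
  case (Suc i)
  obtain y where y: "y \<in> outer_boundary (a i)" "a (Suc i) = a i \<union> {y}"
    using histories_props(4)[OF a, of i] Suc.prems by auto
  show ?case
    by (rule connected_between[of "a i"]) (use Suc y in \<open>auto simp: lattice_closure_def\<close>)
qed

lemma finite_histories: "finite (histories n)"
proof (induction n)
  case (Suc n)
  have "finite (outer_boundary (a n))" if "a \<in> histories n" for a
    using histories_props(2)[OF that, of n] finite_outer_boundary by blast
  then show ?case using Suc by simp
qed simp

lemma histories_inj:
  assumes "a \<in> histories n" "b \<in> histories n" "\<And>i. i \<le> n \<Longrightarrow> a i = b i" shows "a = b"
proof
  fix i show "a i = b i"
    using assms(3)[of i] histories_props(3)[OF assms(1), of i] histories_props(3)[OF assms(2), of i]
    by (cases "i \<le> n") auto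
qed

text \<open>Whether the sites of a list, latest first, have joined the cluster one after another by time \<open>n\<close>, each at
  a time when the cluster had property \<open>G\<close>.\<close>

fun arm :: "((int ^ 3) set \<Rightarrow> bool) \<Rightarrow> (int ^ 3) list \<Rightarrow> nat \<Rightarrow> (nat \<Rightarrow> (int ^ 3) set) \<Rightarrow> bool" where
  "arm G [] n a \<longleftrightarrow> True"
| "arm G (z # zs) 0 a \<longleftrightarrow> False"
| "arm G (z # zs) (Suc n) a \<longleftrightarrow> arm G (z # zs) n a \<or> (arm G zs n a \<and> z \<in> a (Suc n) \<and> z \<notin> a n \<and> G (a n))"

lemma arm_cong: "(\<And>i. i \<le> n \<Longrightarrow> a i = b i) \<Longrightarrow> arm G zs n a = arm G zs n b"
proof (induction G zs n a rule: arm.induct)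
  case (3 G z zs n a)
  have "arm G (z # zs) n a = arm G (z # zs) n b" "arm G zs n a = arm G zs n b"
    using 3 by auto
  then show ?case using 3(3)[of n] 3(3)[of "Suc n"] by simp
qed auto

lemma arm_mono: "arm G zs n a \<Longrightarrow> n \<le> m \<Longrightarrow> arm G zs m a"
proof (induction m)
  case (Suc m)
  show ?case
  proof (cases "n = Suc m")
    case False
    then have "arm G zs m a" using Suc by simp
    then show ?thesis by (cases zs) auto
  qed (use Suc in simp)
qed (cases zs; simp)

locale dbm =
  fixes \<eta> :: real and M :: "'w measure" and A :: "nat \<Rightarrow> 'w \<Rightarrow> (int ^ 3) set"
  assumes eta: "\<eta> \<ge> 0" and dbm: "is_dbm \<eta> M A"
begin

sublocale prob_space M using dbm by (simp add: is_dbm_def)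

lemma pred_A [measurable]: "Measurable.pred M (\<lambda>w. P (A n w))"
proof -
  have "A n \<in> M \<rightarrow>\<^sub>M count_space {X. finite X \<and> lattice_connected X}" using dbm by (simp add: is_dbm_def)
  then show ?thesis by (rule measurable_compose) simp
qed

definition follows :: "(nat \<Rightarrow> (int ^ 3) set) \<Rightarrow> nat \<Rightarrow> 'w \<Rightarrow> bool" where
  "follows a n w \<longleftrightarrow> (\<forall>i\<le>n. A i w = a i)"

lemma pred_follows [measurable]: "Measurable.pred M (follows a n)"
  unfolding follows_def by measurable

lemma follows_Suc: "follows (a(Suc n := b)) (Suc n) w \<longleftrightarrow> follows a n w \<and> A (Suc n) w = b"
  unfolding follows_def by (auto simp: le_Suc_eq)

text \<open>The definition of the chain says this for histories of positive probability; for the others both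
  sides are zero.\<close>

lemma follows_transition:
  assumes y: "y \<in> outer_boundary (a n)"
  shows "\<P>(w in M. A (Suc n) w = a n \<union> {y} \<and> follows a n w) = \<P>(w in M. follows a n w) * dbm_rate \<eta> (a n) y"
proof (cases "\<P>(w in M. follows a n w) > 0")
  case True
  then have "0 < \<P>(w in M. \<forall>i\<le>n. A i w = a i)" by (simp add: follows_def)
  from dbm[unfolded is_dbm_def, THEN conjunct2, THEN conjunct2, THEN conjunct2, rule_format, OF this y]
  have "\<P>(w in M. A (Suc n) w = a n \<union> {y} \<bar> follows a n w) = dbm_rate \<eta> (a n) y"
    unfolding follows_def dbm_rate_def .
  then show ?thesis using True by (simp add: cond_prob_def field_simps)
next
  case False
  then have z: "\<P>(w in M. follows a n w) = 0" by (simp add: measure_nonneg not_less antisym)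
  have "\<P>(w in M. A (Suc n) w = a n \<union> {y} \<and> follows a n w) \<le> \<P>(w in M. follows a n w)"
    by (intro finite_measure_mono) auto
  then have "\<P>(w in M. A (Suc n) w = a n \<union> {y} \<and> follows a n w) = 0"
    using z by (simp add: measure_nonneg antisym)
  then show ?thesis using z by simp
qed

text \<open>The transition probabilities over the boundary add up to one.\<close>

lemma AE_grows_by_boundary_site:
  assumes a: "a \<in> histories n"
  shows "AE w in M. follows a n w \<longrightarrow> (\<exists>y\<in>outer_boundary (a n). A (Suc n) w = a n \<union> {y})"
proof -
  have fin: "finite (a n)" "a n \<noteq> {}" using histories_props(2)[OF a, of n] by auto
  have fb: "finite (outer_boundary (a n))" by (rule finite_outer_boundary[OF fin(1)])
  define E where "E y = {w\<in>space M. A (Suc n) w = a n \<union> {y} \<and> follows a n w}" for y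
  have E_sets: "E y \<in> sets M" for y unfolding E_def by measurable
  have "disjoint_family_on E (outer_boundary (a n))"
    unfolding disjoint_family_on_def E_def outer_boundary_def by blast
  then have "measure M (\<Union>y\<in>outer_boundary (a n). E y) = (\<Sum>y\<in>outer_boundary (a n). measure M (E y))"
    using E_sets by (intro finite_measure_finite_Union[OF fb]) auto
  also have "\<dots> = (\<Sum>y\<in>outer_boundary (a n). \<P>(w in M. follows a n w) * dbm_rate \<eta> (a n) y)"
    unfolding E_def by (intro sum.cong follows_transition) auto
  also have "\<dots> = \<P>(w in M. follows a n w)"
    unfolding sum_distrib_left[symmetric] dbm_rate_sum[OF fin eta] by simp
  finally have eq: "measure M (\<Union>y\<in>outer_boundary (a n). E y) = \<P>(w in M. follows a n w)" .
  define F where "F = {w\<in>space M. follows a n w} - (\<Union>y\<in>outer_boundary (a n). E y)"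
  have U: "(\<Union>y\<in>outer_boundary (a n). E y) \<in> sets M" using fb E_sets by blast
  have "measure M F = \<P>(w in M. follows a n w) - measure M (\<Union>y\<in>outer_boundary (a n). E y)"
    unfolding F_def using U by (intro finite_measure_Diff) (auto simp: E_def)
  then have "measure M F = 0" using eq by simp
  moreover have "F \<in> sets M" unfolding F_def using U by measurable
  ultimately have "F \<in> null_sets M" by (simp add: null_sets_def emeasure_eq_measure)
  then show ?thesis
    by (rule AE_I') (auto simp: F_def E_def)
qed

lemma AE_follows_history: "AE w in M. \<exists>a\<in>histories n. follows a n w"
proof (induction n)
  case 0
  have "A 0 w = {0}" if "w \<in> space M" for w using dbm that by (simp add: is_dbm_def)
  then show ?case by (intro AE_I2) (simp add: follows_def)
next
  case (Suc n)
  have "AE w in M. \<forall>a\<in>histories n. follows a n w \<longrightarrow> (\<exists>y\<in>outer_boundary (a n). A (Suc n) w = a n \<union> {y})"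
    using AE_grows_by_boundary_site by (intro AE_finite_allI finite_histories) auto
  with Suc show ?case
  proof eventually_elim
    case (elim w)
    then obtain a y where a: "a \<in> histories n" "follows a n w" "y \<in> outer_boundary (a n)" "A (Suc n) w = a n \<union> {y}"
      by blast
    have "follows (a(Suc n := a n \<union> {y})) (Suc n) w" unfolding follows_Suc using a(2,4) ..
    moreover have "a(Suc n := a n \<union> {y}) \<in> histories (Suc n)" using a(1,3) by auto
    ultimately show ?case ..
  qed
qed

lemma pred_arm [measurable]: "Measurable.pred M (\<lambda>w. arm G zs n (\<lambda>i. A i w))"
proof (induction G zs n "\<lambda>i :: nat. {} :: (int ^ 3) set" rule: arm.induct)
  case (3 G z zs n)
  have "Measurable.pred M (\<lambda>w. z \<in> A (Suc n) w)" "Measurable.pred M (\<lambda>w. z \<notin> A n w)" "Measurable.pred M (\<lambda>w. G (A n w))"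
    by (rule pred_A)+
  then show ?case using 3 by simp
qed simp_all

lemma follows_disjoint: "disjoint_family_on (\<lambda>a. {w\<in>space M. follows a n w \<and> Q w}) (histories n)"
  unfolding disjoint_family_on_def
proof (intro ballI impI)
  fix a b assume ab: "a \<in> histories n" "b \<in> histories n" "a \<noteq> b"
  then obtain i where "i \<le> n" "a i \<noteq> b i" using histories_inj by blast
  then show "{w\<in>space M. follows a n w \<and> Q w} \<inter> {w\<in>space M. follows b n w \<and> Q w} = {}"
    unfolding follows_def by auto
qed

lemma prob_by_histories:
  assumes [measurable]: "Measurable.pred M Q"
  shows "\<P>(w in M. Q w) = (\<Sum>a\<in>histories n. \<P>(w in M. follows a n w \<and> Q w))"
proof -
  have "\<P>(w in M. Q w) = measure M (\<Union>a\<in>histories n. {w\<in>space M. follows a n w \<and> Q w})"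
  proof (rule finite_measure_eq_AE)
    show "AE w in M. (w \<in> {w\<in>space M. Q w}) = (w \<in> (\<Union>a\<in>histories n. {w\<in>space M. follows a n w \<and> Q w}))"
      using AE_follows_history[of n] AE_space by eventually_elim auto
  qed (auto intro!: sets.finite_UN finite_histories)
  also have "\<dots> = (\<Sum>a\<in>histories n. \<P>(w in M. follows a n w \<and> Q w))"
    by (intro finite_measure_finite_Union finite_histories follows_disjoint) auto
  finally show ?thesis .
qed

text \<open>Decompose according to the history up to time \<open>n\<close>. On each history, whether the arm exists and whether
  the cluster has property \<open>G\<close> is already decided.\<close>

lemma arm_step:
  assumes q: "\<And>a y. a \<in> histories n \<Longrightarrow> G (a n) \<Longrightarrow> y \<in> outer_boundary (a n) \<Longrightarrow> dbm_rate \<eta> (a n) y \<le> q" and q0: "q \<ge> 0"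
  shows "\<P>(w in M. arm G zs n (\<lambda>i. A i w) \<and> z \<in> A (Suc n) w \<and> z \<notin> A n w \<and> G (A n w))
     \<le> q * \<P>(w in M. arm G zs n (\<lambda>i. A i w))"
proof -
  let ?Q = "\<lambda>w. arm G zs n (\<lambda>i. A i w) \<and> z \<in> A (Suc n) w \<and> z \<notin> A n w \<and> G (A n w)"
  have mQ [measurable]: "Measurable.pred M ?Q" by measurable
  have each: "\<P>(w in M. follows a n w \<and> ?Q w) \<le> q * \<P>(w in M. follows a n w \<and> arm G zs n (\<lambda>i. A i w))"
    if a: "a \<in> histories n" for a
  \<comment> \<open>In the remaining case the event has probability zero, as only boundary sites join.\<close>
  proof (cases "arm G zs n a \<and> G (a n) \<and> z \<in> outer_boundary (a n)")
    case True
    have arm_eq: "arm G zs n (\<lambda>i. A i w) = arm G zs n a" if "follows a n w" for w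
      using that by (intro arm_cong) (auto simp: follows_def)
    have "\<P>(w in M. follows a n w \<and> ?Q w) \<le> \<P>(w in M. A (Suc n) w = a n \<union> {z} \<and> follows a n w)"
    proof (rule finite_measure_mono_AE)
      show "AE w in M. w \<in> {w\<in>space M. follows a n w \<and> ?Q w} \<longrightarrow> w \<in> {w\<in>space M. A (Suc n) w = a n \<union> {z} \<and> follows a n w}"
        using AE_grows_by_boundary_site[OF a]
      proof eventually_elim
        case (elim w)
        then show ?case by (auto simp: follows_def)
      qed
    qed measurable
    also have "\<dots> = \<P>(w in M. follows a n w) * dbm_rate \<eta> (a n) z"
      using True by (intro follows_transition) auto
    also have "\<dots> \<le> \<P>(w in M. follows a n w) * q"
      using q[OF a] True by (intro mult_left_mono) auto
    also have "\<P>(w in M. follows a n w) = \<P>(w in M. follows a n w \<and> arm G zs n (\<lambda>i. A i w))"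
      using arm_eq True by (intro arg_cong[where f = "measure M"]) auto
    finally show ?thesis by (simp add: mult.commute)
  next
    case False
    have "\<P>(w in M. follows a n w \<and> ?Q w) \<le> measure M {}"
    proof (rule finite_measure_mono_AE)
      show "AE w in M. w \<in> {w\<in>space M. follows a n w \<and> ?Q w} \<longrightarrow> w \<in> {}"
        using AE_grows_by_boundary_site[OF a]
      proof eventually_elim
        case (elim w)
        show ?case
        proof (rule impI, rule ccontr)
          assume "w \<in> {w\<in>space M. follows a n w \<and> ?Q w}"
          then have f: "follows a n w" and Q: "?Q w" by auto
          have "arm G zs n a" using Q arm_cong[of n "\<lambda>i. A i w" a G zs] f by (auto simp: follows_def)
          moreover have "A n w = a n" using f by (simp add: follows_def)
          ultimately show False using elim f Q False by auto
        qed
      qed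
    qed simp
    then have "\<P>(w in M. follows a n w \<and> ?Q w) \<le> 0" by simp
    also have "0 \<le> q * \<P>(w in M. follows a n w \<and> arm G zs n (\<lambda>i. A i w))" using q0 by (simp add: measure_nonneg)
    finally show ?thesis .
  qed
  have "\<P>(w in M. ?Q w) \<le> (\<Sum>a\<in>histories n. q * \<P>(w in M. follows a n w \<and> arm G zs n (\<lambda>i. A i w)))"
    unfolding prob_by_histories[OF mQ, of n] by (intro sum_mono each)
  also have "\<dots> = q * \<P>(w in M. arm G zs n (\<lambda>i. A i w))"
    unfolding sum_distrib_left[symmetric] prob_by_histories[OF pred_arm, of G zs n n] ..
  finally show ?thesis .
qed

text \<open>Pascal's rule: either the arm is there one step earlier, or its last site joins now.\<close>

lemma prob_arm:
  assumes q: "\<And>k a y. k < m \<Longrightarrow> a \<in> histories k \<Longrightarrow> G (a k) \<Longrightarrow> y \<in> outer_boundary (a k) \<Longrightarrow> dbm_rate \<eta> (a k) y \<le> q"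
    and q0: "q \<ge> 0" and n: "n \<le> m"
  shows "\<P>(w in M. arm G zs n (\<lambda>i. A i w)) \<le> real (n choose length zs) * q ^ length zs"
  using n
proof (induction n arbitrary: zs)
  case 0
  then show ?case by (cases zs) (auto simp: prob_space)
next
  case (Suc n)
  show ?case
  proof (cases zs)
    case Nil then show ?thesis by (simp add: prob_space)
  next
    case (Cons z ys)
    let ?B = "\<lambda>zs. {w\<in>space M. arm G zs n (\<lambda>i. A i w)}"
    let ?N = "{w\<in>space M. arm G ys n (\<lambda>i. A i w) \<and> z \<in> A (Suc n) w \<and> z \<notin> A n w \<and> G (A n w)}"
    have "\<P>(w in M. arm G zs (Suc n) (\<lambda>i. A i w)) = measure M (?B zs \<union> ?N)"
      using Cons by (intro arg_cong[where f = "measure M"]) auto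
    also have "\<dots> \<le> measure M (?B zs) + measure M ?N" by (intro measure_Un_le) measurable
    also have "measure M ?N \<le> q * measure M (?B ys)"
      using Suc.prems by (intro arm_step q q0) auto
    also have "measure M (?B zs) \<le> real (n choose length zs) * q ^ length zs" using Suc by auto
    also have "q * measure M (?B ys) \<le> q * (real (n choose length ys) * q ^ length ys)"
      using Suc q0 by (intro mult_left_mono) auto
    finally show ?thesis using Cons by (simp add: algebra_simps)
  qed
qed

end

fun lattice_path :: "(int ^ 3) list \<Rightarrow> bool" where
  "lattice_path [] \<longleftrightarrow> True"
| "lattice_path [z] \<longleftrightarrow> True"
| "lattice_path (y # z # zs) \<longleftrightarrow> adj z y \<and> lattice_path (z # zs)"

definition paths_from :: "nat \<Rightarrow> int ^ 3 \<Rightarrow> (int ^ 3) list set" where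
  "paths_from L v = {zs. length zs = Suc L \<and> hd zs = v \<and> lattice_path zs}"

lemma paths_from_Suc: "paths_from (Suc L) v \<subseteq> (\<lambda>(e, zs). v # zs) ` (SIGMA e:{e. adj 0 e}. paths_from L (v - e))"
proof
  fix zs assume "zs \<in> paths_from (Suc L) v"
  then obtain z ys where z: "zs = v # z # ys" "length ys = L" "adj z v" "lattice_path (z # ys)"
    unfolding paths_from_def by (cases zs rule: lattice_path.cases) auto
  then have "(v - z, z # ys) \<in> (SIGMA e:{e. adj 0 e}. paths_from L (v - e))"
    by (auto simp: paths_from_def intro: adj_diff)
  then show "zs \<in> (\<lambda>(e, zs). v # zs) ` (SIGMA e:{e. adj 0 e}. paths_from L (v - e))"
    using z(1) by (intro image_eqI[where x = "(v - z, z # ys)"]) auto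
qed

lemma paths_from_card: "finite (paths_from L v) \<and> card (paths_from L v) \<le> 6 ^ L"
proof (induction L arbitrary: v)
  case 0
  have "paths_from 0 v \<subseteq> {[v]}" by (auto simp: paths_from_def length_Suc_conv)
  then show ?case using card_mono[of "{[v]}" "paths_from 0 v"] finite_subset by auto
next
  case (Suc L)
  let ?S = "SIGMA e:{e. adj 0 e}. paths_from L (v - e)"
  have f: "finite ?S" using Suc by (intro finite_SigmaI) auto
  have "card (paths_from (Suc L) v) \<le> card ((\<lambda>(e, zs). v # zs) ` ?S)"
    using f by (intro card_mono paths_from_Suc) auto
  also have "\<dots> \<le> card ?S" by (rule card_image_le[OF f])
  also have "\<dots> = (\<Sum>e\<in>{e :: int ^ 3. adj 0 e}. card (paths_from L (v - e)))" using Suc by (intro card_SigmaI) auto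
  also have "\<dots> \<le> (\<Sum>e\<in>{e :: int ^ 3. adj 0 e}. 6 ^ L)" using Suc by (intro sum_mono) auto
  also have "\<dots> = 6 ^ Suc L" by (simp add: card_unit_steps)
  finally have "card (paths_from (Suc L) v) \<le> 6 ^ Suc L" .
  moreover have "finite (paths_from (Suc L) v)"
    by (rule finite_subset[OF paths_from_Suc finite_imageI[OF f]])
  ultimately show ?case by simp
qed

text \<open>Trace a far site back: when it joined, it was adjacent to an earlier site, whose norm is smaller by at
  most one. As long as the norms stay above \<open>r\<close>, these earlier sites witness that the cluster already reached
  radius \<open>r\<close>.\<close>

lemma arm_exists:
  assumes a: "a \<in> histories n" and r: "r > 0"
    and G: "\<And>b u. u \<in> b \<Longrightarrow> r \<le> euclidean_norm u \<Longrightarrow> G b"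
  shows "k \<le> n \<Longrightarrow> v \<in> a k \<Longrightarrow> r + real (Suc L) \<le> euclidean_norm v \<Longrightarrow> \<exists>zs\<in>paths_from L v. arm G zs k a"
proof (induction L arbitrary: k v)
  \<comment> \<open>The time at which a site joins, and an earlier neighbour of it.\<close>
  have entry: "\<exists>k' x. Suc k' \<le> k \<and> v \<in> a (Suc k') \<and> v \<notin> a k' \<and> x \<in> a k' \<and> adj x v \<and> euclidean_norm v - 1 \<le> euclidean_norm x"
    if k: "k \<le> n" and v: "v \<in> a k" "euclidean_norm v > 0" for k v
  proof -
    define j where "j = (LEAST j. v \<in> a j)"
    have vj: "v \<in> a j" unfolding j_def by (rule LeastI[of "\<lambda>j. v \<in> a j", OF v(1)])
    have jk: "j \<le> k" unfolding j_def by (rule Least_le[of "\<lambda>j. v \<in> a j", OF v(1)])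
    have "v \<notin> a 0"
    proof
      assume "v \<in> a 0"
      then have "v = 0" unfolding histories_props(1)[OF a] by simp
      then show False using v(2) by simp
    qed
    then have "j \<noteq> 0" using vj by metis
    then obtain k' where k': "j = Suc k'" using not0_implies_Suc by blast
    have "k' < j" unfolding k' by simp
    then have nv: "v \<notin> a k'" unfolding j_def by (rule not_less_Least)
    obtain y where y: "y \<in> outer_boundary (a k')" "a (Suc k') = a k' \<union> {y}"
      using histories_props(4)[OF a, of k'] k' jk k by auto
    then have "v = y" using vj nv unfolding k' by simp
    then obtain x where x: "x \<in> a k'" "adj x v" using y(1) by (auto simp: outer_boundary_def)
    have "euclidean_norm v \<le> euclidean_norm (v - x) + euclidean_norm x"
      using euclidean_norm_triangle[of "v - x" x] by simp
    then have "euclidean_norm v - 1 \<le> euclidean_norm x" using adj_norm[OF x(2)] by simp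
    then show ?thesis using k' jk vj nv x by blast
  qed
  {
    case 0
    then obtain k' x where x: "Suc k' \<le> k" "v \<in> a (Suc k')" "v \<notin> a k'" "x \<in> a k'" "euclidean_norm v - 1 \<le> euclidean_norm x"
      using entry[of k v] r 0 by auto
    have "G (a k')" using G[OF x(4)] x(5) 0 by simp
    then have "arm G [v] (Suc k') a" using x by simp
    then have "arm G [v] k a" using x(1) by (rule arm_mono)
    then show ?case by (intro bexI[of _ "[v]"]) (auto simp: paths_from_def)
  next
    case (Suc L)
    then obtain k' x where x: "Suc k' \<le> k" "v \<in> a (Suc k')" "v \<notin> a k'" "x \<in> a k'" "adj x v" "euclidean_norm v - 1 \<le> euclidean_norm x"
      using entry[of k v] r Suc.prems by auto
    have xr: "r + real (Suc L) \<le> euclidean_norm x" using x(6) Suc.prems by simp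
    then have "G (a k')" using G[OF x(4)] by simp
    obtain zs where zs: "zs \<in> paths_from L x" "arm G zs k' a"
      using Suc.IH[OF _ x(4) xr] x(1) Suc.prems(1) by auto
    have "arm G (v # zs) (Suc k') a" using zs x \<open>G (a k')\<close> by simp
    then have "arm G (v # zs) k a" using x(1) by (rule arm_mono)
    moreover have "v # zs \<in> paths_from (Suc L) v"
      using zs(1) x(5) unfolding paths_from_def by (cases zs) auto
    ultimately show ?case by blast
  }
qed

lemma card_ball: "finite {v :: int ^ 3. euclidean_norm v < real j} \<and> card {v :: int ^ 3. euclidean_norm v < real j} \<le> (2 * j + 1) ^ 3"
proof -
  let ?I = "{- int j..int j}"
  define \<phi> where "\<phi> v = (v $ 1, v $ 2, v $ 3)" for v :: "int ^ 3"
  have inj: "inj \<phi>" by (auto simp: inj_on_def \<phi>_def vec_eq_iff forall_3)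
  have sub: "\<phi> ` {v :: int ^ 3. euclidean_norm v < real j} \<subseteq> ?I \<times> ?I \<times> ?I"
  proof
    fix t assume "t \<in> \<phi> ` {v :: int ^ 3. euclidean_norm v < real j}"
    then obtain v where v: "t = \<phi> v" "euclidean_norm v < real j" by auto
    have "v $ i \<in> ?I" for i
    proof -
      have "\<bar>real_of_int (v $ i)\<bar> < real j" using coord_abs_le[of v i] v(2) by (simp add: coord_def)
      then have "real_of_int (v $ i) < real j" "- real j < real_of_int (v $ i)" by auto
      then show ?thesis by simp
    qed
    then show "t \<in> ?I \<times> ?I \<times> ?I" using v(1) by (simp add: \<phi>_def)
  qed
  have c: "card (?I \<times> ?I \<times> ?I) = (2 * j + 1) ^ 3"
    by (simp add: card_cartesian_product power3_eq_cube nat_add_distrib nat_mult_distrib)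
  have fin: "finite {v :: int ^ 3. euclidean_norm v < real j}"
    using finite_subset[OF sub] finite_imageD[OF _ inj_on_subset[OF inj]] by blast
  have "card {v :: int ^ 3. euclidean_norm v < real j} = card (\<phi> ` {v :: int ^ 3. euclidean_norm v < real j})"
    by (rule card_image[symmetric, OF inj_on_subset[OF inj]]) simp
  also have "\<dots> \<le> (2 * j + 1) ^ 3" unfolding c[symmetric] using sub by (intro card_mono) auto
  finally show ?thesis using fin by simp
qed

context dbm
begin

text \<open>If the radius reaches \<open>3 * l\<close>, connectedness provides a site of norm between \<open>3 * l\<close> and \<open>3 * l + 1\<close>. From it
  an arm of \<open>l\<close> sites can be traced back, all of which joined when the radius was at least \<open>2 * l\<close>. There are at most
  \<open>(6 * l + 3) ^ 3\<close> end sites and \<open>6 ^ l\<close> lattice paths to each of them.\<close>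

lemma prob_radius:
  fixes l :: nat
  assumes l: "l \<ge> 1"
    and q: "\<And>k a u y. k < m \<Longrightarrow> a \<in> histories k \<Longrightarrow> u \<in> a k \<Longrightarrow> 2 * real l \<le> euclidean_norm u \<Longrightarrow>
       y \<in> outer_boundary (a k) \<Longrightarrow> dbm_rate \<eta> (a k) y \<le> q"
    and q0: "q \<ge> 0"
  shows "\<P>(w in M. radius (A m w) \<ge> 3 * real l) \<le> real ((6 * l + 3) ^ 3) * 6 ^ l * (real (m choose l) * q ^ l)"
proof -
  define G where "G b \<longleftrightarrow> (\<exists>u\<in>b. 2 * real l \<le> euclidean_norm u)" for b :: "(int ^ 3) set"
  define V where "V = {v :: int ^ 3. euclidean_norm v < real (3 * l + 1)}"
  define I where "I = (SIGMA v:V. paths_from (l - 1) v)"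
  have V: "finite V" "card V \<le> (6 * l + 3) ^ 3"
  proof -
    have e: "2 * (3 * l + 1) + 1 = 6 * l + 3" by simp
    show "finite V" "card V \<le> (6 * l + 3) ^ 3"
      using card_ball[of "3 * l + 1", unfolded e] unfolding V_def by blast+
  qed
  have fI: "finite I" unfolding I_def using V paths_from_card by (intro finite_SigmaI) auto
  have "card I = (\<Sum>v\<in>V. card (paths_from (l - 1) v))"
    unfolding I_def using V paths_from_card by (intro card_SigmaI) auto
  also have "\<dots> \<le> (\<Sum>v\<in>V. 6 ^ (l - 1))" using paths_from_card by (intro sum_mono) auto
  also have "\<dots> \<le> (6 * l + 3) ^ 3 * 6 ^ l" using V(2) by (simp add: mult_mono power_increasing)
  finally have cI: "card I \<le> (6 * l + 3) ^ 3 * 6 ^ l" .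
  let ?E = "\<lambda>i. {w\<in>space M. arm G (snd i) m (\<lambda>j. A j w)}"
  have "\<P>(w in M. radius (A m w) \<ge> 3 * real l) \<le> measure M (\<Union>i\<in>I. ?E i)"
  proof (rule finite_measure_mono_AE)
    show "AE w in M. w \<in> {w\<in>space M. radius (A m w) \<ge> 3 * real l} \<longrightarrow> w \<in> (\<Union>i\<in>I. ?E i)"
      using AE_follows_history[of m]
    proof eventually_elim
      case (elim w)
      then obtain a where a: "a \<in> histories m" "follows a m w" by blast
      show ?case
      proof
        assume "w \<in> {w\<in>space M. radius (A m w) \<ge> 3 * real l}"
        then have w: "w \<in> space M" "radius (A m w) \<ge> 3 * real l" by auto
        have Am: "A m w = a m" using a(2) by (simp add: follows_def)
        have fin: "finite (a m)" "0 \<in> a m" using histories_props(2)[OF a(1), of m] by auto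
        have con: "lattice_connected (a m)" using histories_connected[OF a(1)] by simp
        have "radius (a m) \<in> euclidean_norm ` a m"
          unfolding radius_def using fin by (intro Max_in) auto
        then obtain u where u: "u \<in> a m" "euclidean_norm u \<ge> real (3 * l)" using w(2) Am by auto
        obtain v where v: "v \<in> a m" "real (3 * l) \<le> euclidean_norm v" "euclidean_norm v < real (3 * l) + 1"
          using chain_exists[OF con fin(2) u(1), of "3 * l"] u(2) by auto
        have "\<exists>zs\<in>paths_from (l - 1) v. arm G zs m a"
          by (rule arm_exists[OF a(1), of "2 * real l"]) (use l v in \<open>auto simp: G_def of_nat_diff\<close>)
        then obtain zs where zs: "zs \<in> paths_from (l - 1) v" "arm G zs m a" by blast
        have "arm G zs m (\<lambda>j. A j w)"
          using arm_cong[of m "\<lambda>j. A j w" a G zs] a(2) zs(2) by (simp add: follows_def)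
        moreover have "(v, zs) \<in> I" using zs(1) v by (auto simp: I_def V_def)
        ultimately show "w \<in> (\<Union>i\<in>I. ?E i)" using w(1) by force
      qed
    qed
    show "(\<Union>i\<in>I. ?E i) \<in> sets M" using fI by (intro sets.finite_UN) auto
  qed
  also have "\<dots> \<le> (\<Sum>i\<in>I. measure M (?E i))"
    by (intro finite_measure_subadditive_finite fI) auto
  also have "\<dots> \<le> (\<Sum>i\<in>I. real (m choose l) * q ^ l)"
  proof (rule sum_mono)
    fix i assume "i \<in> I"
    then have len: "length (snd i) = l" using l by (auto simp: I_def paths_from_def)
    have "measure M (?E i) \<le> real (m choose length (snd i)) * q ^ length (snd i)"
    proof (rule prob_arm[OF _ q0 order.refl])
      fix k a y assume "k < m" "a \<in> histories k" "G (a k)" "y \<in> outer_boundary (a k)"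
      then show "dbm_rate \<eta> (a k) y \<le> q" unfolding G_def using q by blast
    qed
    then show "measure M (?E i) \<le> real (m choose l) * q ^ l" by (simp add: len)
  qed
  also have "\<dots> = real (card I) * (real (m choose l) * q ^ l)" by simp
  also have "\<dots> \<le> real ((6 * l + 3) ^ 3 * 6 ^ l) * (real (m choose l) * q ^ l)"
    using cI q0 by (intro mult_right_mono of_nat_mono) auto
  finally show ?thesis by simp
qed

end

section \<open>Growth of the radius\<close>

lemma power_le_exp_fact: "x \<ge> 0 \<Longrightarrow> x ^ n / fact n \<le> exp (x :: real)"
proof -
  assume x: "x \<ge> 0"
  have s: "(\<lambda>k. x ^ k / fact k) sums exp x"
    using exp_converges[of x] by (simp add: divide_inverse mult.commute)
  have "(\<Sum>k\<in>{n}. x ^ k / fact k) \<le> (\<Sum>k. x ^ k / fact k)"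
    by (rule sum_le_suminf[OF sums_summable[OF s]]) (use x in auto)
  then show ?thesis using sums_unique[OF s] by simp
qed

text \<open>Stirling's bound \<open>fact l \<ge> (l / e) ^ l\<close>, in the form of one term of the exponential series.\<close>

lemma choose_le:
  assumes "l \<ge> 1" shows "real (m choose l) \<le> (exp 1 * real m / real l) ^ l"
proof -
  have "real (m choose l) * fact l \<le> real m ^ l"
    using binomial_fact_pow[of m l] by (metis of_nat_fact of_nat_le_iff of_nat_mult of_nat_power)
  then have 1: "real (m choose l) \<le> real m ^ l / fact l" by (simp add: pos_le_divide_eq)
  have "real l ^ l / fact l \<le> exp (real l)" by (rule power_le_exp_fact) simp
  also have "exp (real l) = exp 1 ^ l" using exp_of_nat_mult[of l "1 :: real"] by simp
  finally have "1 / fact l \<le> exp 1 ^ l / real l ^ l" using assms by (simp add: field_simps)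
  then have "real m ^ l * (1 / fact l) \<le> real m ^ l * (exp 1 ^ l / real l ^ l)"
    by (intro mult_left_mono) auto
  then show ?thesis using 1 by (simp add: power_mult_distrib power_divide mult.commute)
qed

lemma arm_union_tail:
  fixes q :: real
  assumes l: "l \<ge> 1" and q: "q \<ge> 0" "96 * exp 1 * real m * q \<le> real l"
  shows "real ((6 * l + 3) ^ 3) * 6 ^ l * (real (m choose l) * q ^ l) \<le> 729 * (1 / 2) ^ l"
proof -
  have l0: "real l > 0" using l by simp
  have "6 ^ l * (real (m choose l) * q ^ l) \<le> 6 ^ l * ((exp 1 * real m / real l) ^ l * q ^ l)"
    using choose_le[OF l, of m] q by (intro mult_left_mono mult_right_mono) auto
  also have "\<dots> = (6 * (exp 1 * real m / real l) * q) ^ l" by (simp only: power_mult_distrib mult.assoc)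
  also have "\<dots> \<le> (1 / 16) ^ l"
    using q l0 by (intro power_mono) (auto simp: field_simps)
  finally have 1: "6 ^ l * (real (m choose l) * q ^ l) \<le> (1 / 16) ^ l" .
  \<comment> \<open>The constant \<open>96 = 6 * 16\<close> leaves a factor \<open>(1 / 16) ^ l\<close>, of which \<open>8 ^ l\<close> is spent on the polynomial.\<close>
  have "real ((6 * l + 3) ^ 3) \<le> 729 * 8 ^ l"
  proof -
    have "6 * l + 3 \<le> 9 * l" using l by simp
    also have "9 * l \<le> 9 * 2 ^ l" using less_exp[of l] by simp
    finally have "(6 * l + 3) ^ 3 \<le> (9 * 2 ^ l) ^ 3" by (intro power_mono) auto
    also have "(9 * 2 ^ l) ^ 3 = (729 * 8 ^ l :: nat)"
    proof -
      have "(2 ^ l) ^ 3 = ((2 ^ 3) ^ l :: nat)" by (simp only: power_mult[symmetric] mult.commute)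
      then show ?thesis by (simp add: power_mult_distrib)
    qed
    finally have "real ((6 * l + 3) ^ 3) \<le> real (729 * 8 ^ l)" by (simp only: of_nat_le_iff)
    then show ?thesis by simp
  qed
  then have "real ((6 * l + 3) ^ 3) * (6 ^ l * (real (m choose l) * q ^ l)) \<le> (729 * 8 ^ l) * (1 / 16) ^ l"
    using 1 q by (intro mult_mono) auto
  also have "\<dots> = 729 * (8 * (1 / 16)) ^ l" by (simp only: power_mult_distrib mult.assoc)
  finally show ?thesis by (simp add: mult.assoc)
qed

context dbm
begin

text \<open>Exponential smallness in \<open>l m \<ge> sqrt m\<close> is more than summable, so Borel-Cantelli applies to all
  times \<open>m\<close> directly and not only along a subsequence.\<close>

lemma radius_eventually_less:
  fixes l :: "nat \<Rightarrow> nat" and q :: "nat \<Rightarrow> real"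
  assumes rate: "\<forall>\<^sub>F m in sequentially. \<forall>k a u y. k < m \<longrightarrow> a \<in> histories k \<longrightarrow> u \<in> a k \<longrightarrow>
       2 * real (l m) \<le> euclidean_norm u \<longrightarrow> y \<in> outer_boundary (a k) \<longrightarrow> dbm_rate \<eta> (a k) y \<le> q m"
    and q: "\<forall>\<^sub>F m in sequentially. q m \<ge> 0 \<and> 96 * exp 1 * real m * q m \<le> real (l m)"
    and l: "\<forall>\<^sub>F m in sequentially. sqrt (real m) \<le> real (l m)"
  shows "AE w in M. \<forall>\<^sub>F m in sequentially. radius (A m w) < 3 * real (l m)"
proof -
  define E where "E m = {w\<in>space M. radius (A m w) \<ge> 3 * real (l m)}" for m
  have E_sets: "E m \<in> sets M" for m
  proof -
    have "Measurable.pred M (\<lambda>w. radius (A m w) \<ge> 3 * real (l m))" by (rule pred_A)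
    then show ?thesis by (simp add: E_def pred_def)
  qed
  have "\<forall>\<^sub>F m in sequentially. 2 powr (- sqrt (real m)) \<le> real m powr (- 2)" by real_asymp
  then have ev: "\<forall>\<^sub>F m in sequentially. norm (measure M (E m)) \<le> 729 * real m powr (- 2)"
    using rate q l eventually_gt_at_top[of 0]
  proof eventually_elim
    case (elim m)
    have "sqrt (real m) > 0" using elim by simp
    then have "real (l m) > 0" using elim by linarith
    then have l1: "l m \<ge> 1" by simp
    have "measure M (E m) \<le> real ((6 * l m + 3) ^ 3) * 6 ^ l m * (real (m choose l m) * q m ^ l m)"
      unfolding E_def by (rule prob_radius[OF l1]) (use elim in blast)+
    also have "\<dots> \<le> 729 * (1 / 2) ^ l m" using elim by (intro arm_union_tail l1) auto
    also have "(1 / 2 :: real) ^ l m = 2 powr (- real (l m))" by (simp add: powr_minus powr_realpow power_one_over inverse_eq_divide)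
    also have "729 * 2 powr (- real (l m)) \<le> 729 * 2 powr (- sqrt (real m))" using elim by simp
    also have "\<dots> \<le> 729 * real m powr (- 2)" using elim by simp
    finally show ?case by (simp add: measure_nonneg)
  qed
  have "summable (\<lambda>m. 729 * real m powr (- 2))" by (intro summable_mult) (simp add: summable_real_powr_iff)
  from summable_comparison_test_ev[OF ev this] have "summable (\<lambda>m. measure M (E m))" .
  then have "AE w in M. \<forall>\<^sub>F m in sequentially. w \<in> space M - E m"
    by (intro borel_cantelli_AE1 E_sets) (auto simp: emeasure_eq_measure)
  then show ?thesis
    using AE_space
  proof eventually_elim
    case (elim w)
    from elim(1) show ?case by eventually_elim (use elim(2) in \<open>auto simp: E_def\<close>)
  qed
qed

end

text \<open>The origin and a site at distance \<open>2 * l\<close> from it cannot both be close to \<open>z\<close>.\<close>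

lemma far_point:
  assumes a: "a \<in> histories k" and u: "u \<in> a k" "2 * l \<le> euclidean_norm u"
  shows "\<exists>v\<in>a k. l \<le> euclidean_norm (v - z)"
proof (cases "l \<le> euclidean_norm (u - z)")
  case True then show ?thesis using u by blast
next
  case False
  have "euclidean_norm u \<le> euclidean_norm (u - z) + euclidean_norm z"
    using euclidean_norm_triangle[of "u - z" z] by simp
  then have "l \<le> euclidean_norm (0 - z)" using False u by simp
  moreover have "0 \<in> a k" using histories_props(2)[OF a, of k] by simp
  ultimately show ?thesis by blast
qed

lemma history_harmonic_bound:
  obtains c n0 where "c > 0"
    "\<And>a k u z l. a \<in> histories k \<Longrightarrow> u \<in> a k \<Longrightarrow> 2 * real l \<le> euclidean_norm u \<Longrightarrow> n0 \<le> l \<Longrightarrow>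
       z \<in> outer_boundary (a k) \<Longrightarrow> harmonic_measure z (lattice_closure (a k)) \<le> c * sqrt (ln (real l)) / real l"
proof -
  obtain c n0 where c: "c > 0" and b: "\<And>X y u n. finite X \<Longrightarrow> lattice_connected X \<Longrightarrow> y \<in> X \<Longrightarrow> u \<in> X \<Longrightarrow> n0 \<le> n \<Longrightarrow>
      real n \<le> euclidean_norm (u - y :: int ^ 3) \<Longrightarrow> harmonic_measure y X \<le> c * sqrt (ln (real n)) / real n"
    using beurling_estimate by blast
  show thesis
  proof (rule that[OF c])
    fix a k u z l
    assume a: "a \<in> histories k" and u: "u \<in> a k" "2 * real l \<le> euclidean_norm u" and l: "n0 \<le> l"
      and z: "z \<in> outer_boundary (a k)"
    obtain v where v: "v \<in> a k" "real l \<le> euclidean_norm (v - z)" using far_point[OF a u] by blast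
    have fin: "finite (a k)" using histories_props(2)[OF a, of k] by simp
    have con: "lattice_connected (a k)" by (rule histories_connected[OF a]) simp
    show "harmonic_measure z (lattice_closure (a k)) \<le> c * sqrt (ln (real l)) / real l"
    proof (rule b[OF _ _ _ _ l v(2)])
      show "finite (lattice_closure (a k))" by (rule finite_closure[OF fin])
      show "lattice_connected (lattice_closure (a k))"
        by (rule connected_between[OF con]) (auto simp: lattice_closure_def)
      show "z \<in> lattice_closure (a k)" "v \<in> lattice_closure (a k)" using z v by (auto simp: lattice_closure_def)
    qed
  qed
qed

text \<open>Elementary asymptotics of the radius scale \<open>l m\<close>: at least \<open>sqrt m\<close>, at most \<open>m\<close>, and rounding
  costs at most a factor \<open>4/3\<close>.\<close>

lemma growth_scale:
  fixes \<alpha> \<beta> K :: real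
  assumes \<alpha>: "1/2 \<le> \<alpha>" "\<alpha> < 1" and \<beta>: "\<beta> \<ge> 0" and K: "K \<ge> 1"
  defines "f \<equiv> \<lambda>m :: nat. real m powr \<alpha> * ln (real m) powr \<beta>"
  defines "l \<equiv> \<lambda>m. nat \<lceil>K * f m\<rceil>"
  shows "\<forall>\<^sub>F m in sequentially. sqrt (real m) \<le> real (l m)"
    "\<forall>\<^sub>F m in sequentially. K * f m \<le> real (l m)"
    "\<forall>\<^sub>F m in sequentially. l m \<le> m"
    "\<forall>\<^sub>F m in sequentially. 3 * real (l m) \<le> 4 * K * f m"
    "filterlim l at_top sequentially"
proof -
  have f0: "f m \<ge> 0" for m unfolding f_def by (intro mult_nonneg_nonneg) auto
  have l_ge: "K * f m \<le> real (l m)" for m unfolding l_def by linarith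
  have l_le: "real (l m) \<le> K * f m + 1" for m
    unfolding l_def using f0[of m] K by (simp add: of_nat_nat)
  show "\<forall>\<^sub>F m in sequentially. K * f m \<le> real (l m)" using l_ge by simp
  have ev3: "\<forall>\<^sub>F m :: nat in sequentially. m \<ge> 3" by (rule eventually_ge_at_top)
  have fs: "\<forall>\<^sub>F m in sequentially. sqrt (real m) \<le> f m"
    using ev3
  proof eventually_elim
    case (elim m)
    have "ln (real m) \<ge> 1"
    proof -
      have "exp 1 \<le> (3 :: real)" by (rule exp_le)
      also have "3 \<le> real m" using elim by simp
      finally show ?thesis using elim by (simp add: ln_ge_iff)
    qed
    then have "1 \<le> ln (real m) powr \<beta>" using \<beta> by (intro ge_one_powr_ge_zero) auto
    moreover have "sqrt (real m) \<le> real m powr \<alpha>"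
      using elim \<alpha> by (simp add: powr_half_sqrt[symmetric] powr_mono)
    ultimately have "sqrt (real m) * 1 \<le> real m powr \<alpha> * ln (real m) powr \<beta>" by (intro mult_mono) auto
    then show ?case by (simp add: f_def)
  qed
  have fK: "f m \<le> K * f m" for m using K f0[of m] mult_right_mono[of 1 K "f m"] by simp
  show sq: "\<forall>\<^sub>F m in sequentially. sqrt (real m) \<le> real (l m)"
    using fs
  proof eventually_elim
    case (elim m)
    then show ?case using l_ge[of m] fK[of m] by linarith
  qed
  have lim0: "((\<lambda>m. K * f m / real m) \<longlongrightarrow> 0) sequentially"
  proof -
    have "((\<lambda>m. ln (real m) powr \<beta> / real m powr (1 - \<alpha>)) \<longlongrightarrow> 0) sequentially"
      using \<alpha> by real_asymp
    then have "((\<lambda>m. K * (ln (real m) powr \<beta> / real m powr (1 - \<alpha>))) \<longlongrightarrow> K * 0) sequentially"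
      by (intro tendsto_mult tendsto_const)
    then have "((\<lambda>m. K * (ln (real m) powr \<beta> / real m powr (1 - \<alpha>))) \<longlongrightarrow> 0) sequentially" by simp
    then show ?thesis
    proof (rule Lim_transform_eventually)
      show "\<forall>\<^sub>F m in sequentially. K * (ln (real m) powr \<beta> / real m powr (1 - \<alpha>)) = K * f m / real m"
        using eventually_gt_at_top[of 0]
      proof eventually_elim
        case (elim m)
        then have "real m powr (1 - \<alpha>) = real m / real m powr \<alpha>" by (simp add: powr_diff)
        then show ?case using elim by (simp add: f_def)
      qed
    qed
  qed
  have "\<forall>\<^sub>F m in sequentially. K * f m / real m < 1 / 2" using lim0 by (rule order_tendstoD(2)) simp
  then show "\<forall>\<^sub>F m in sequentially. l m \<le> m"
    using ev3
  proof eventually_elim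
    case (elim m)
    then have "K * f m < real m / 2" by (simp add: field_simps)
    then have "real (l m) \<le> real m" using l_le[of m] elim by linarith
    then show ?case by simp
  qed
  have "\<forall>\<^sub>F m :: nat in sequentially. sqrt (real m) \<ge> 3" by real_asymp
  then show "\<forall>\<^sub>F m in sequentially. 3 * real (l m) \<le> 4 * K * f m"
    using fs
  proof eventually_elim
    case (elim m)
    have "3 \<le> K * f m" using elim fK[of m] by linarith
    then show ?case using l_le[of m] by linarith
  qed
  have "filterlim (\<lambda>m. real (l m)) at_top sequentially"
    by (rule filterlim_at_top_mono[OF _ sq]) real_asymp
  then show "filterlim l at_top sequentially"
    by (rule filterlim_sequentially_iff_filterlim_real[THEN iffD2])
qed

lemma scaled_growth:
  fixes \<alpha> \<beta> \<eta> K :: real and M :: "'w measure" and A :: "nat \<Rightarrow> 'w \<Rightarrow> (int ^ 3) set"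
  assumes \<alpha>: "1/2 \<le> \<alpha>" "\<alpha> < 1" and \<beta>: "\<beta> \<ge> 0" and K: "K \<ge> 1" and \<eta>: "\<eta> \<ge> 0"
  defines "f \<equiv> \<lambda>m :: nat. real m powr \<alpha> * ln (real m) powr \<beta>"
  defines "l \<equiv> \<lambda>m. nat \<lceil>K * f m\<rceil>"
  assumes rate: "\<forall>\<^sub>F m in sequentially. \<forall>k a u y. k < m \<longrightarrow> a \<in> histories k \<longrightarrow> u \<in> a k \<longrightarrow>
       2 * real (l m) \<le> euclidean_norm u \<longrightarrow> y \<in> outer_boundary (a k) \<longrightarrow> dbm_rate \<eta> (a k) y \<le> q m"
    and q: "\<forall>\<^sub>F m in sequentially. q m \<ge> 0 \<and> 96 * exp 1 * real m * q m \<le> real (l m)"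
    and dbm: "is_dbm \<eta> M A"
  shows "AE w in M. \<exists>N. \<forall>n>N. radius (A n w) < 4 * K * real n powr \<alpha> * ln (real n) powr \<beta>"
proof -
  interpret dbm \<eta> M A by unfold_locales fact+
  have sc1: "\<forall>\<^sub>F m in sequentially. sqrt (real m) \<le> real (l m)"
    using growth_scale(1)[OF \<alpha> \<beta> K] unfolding l_def f_def .
  have sc4: "\<forall>\<^sub>F m in sequentially. 3 * real (l m) \<le> 4 * K * f m"
    using growth_scale(4)[OF \<alpha> \<beta> K] unfolding l_def f_def .
  have "AE w in M. \<forall>\<^sub>F m in sequentially. radius (A m w) < 3 * real (l m)"
    by (rule radius_eventually_less[OF rate q sc1])
  then show ?thesis
  proof eventually_elim
    case (elim w)
    from sc4 elim have "\<forall>\<^sub>F m in sequentially. radius (A m w) < 4 * K * real m powr \<alpha> * ln (real m) powr \<beta>"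
      by eventually_elim (simp add: f_def mult.assoc)
    then show ?case unfolding eventually_sequentially by (meson less_imp_le)
  qed
qed

theorem theorem4:
  fixes \<eta> :: real
  assumes "\<eta> \<ge> 0"
  shows "(\<eta> \<ge> 1 \<longrightarrow>
      (\<exists>C>0. \<forall>(M :: 'w measure) (A :: nat \<Rightarrow> 'w \<Rightarrow> (int ^ 3) set). is_dbm \<eta> M A \<longrightarrow>
        (AE w in M. \<exists>N. \<forall>n>N.
          radius (A n w) <
            C * real n powr (\<eta> / (1 + \<eta>)) * ln (real n) powr (\<eta> / (2 * (\<eta> + 1)))))) \<and>
    (\<eta> < 1 \<longrightarrow>
      (\<exists>C>0. \<forall>(M :: 'w measure) (A :: nat \<Rightarrow> 'w \<Rightarrow> (int ^ 3) set). is_dbm \<eta> M A \<longrightarrow>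
        (AE w in M. \<exists>N. \<forall>n>N.
          radius (A n w) < C * real n powr (1 / 2) * ln (real n) powr (1 / 4))))"
proof -
  obtain c n0 where c: "c > 0" and hm:
    "\<And>a k u z l. a \<in> histories k \<Longrightarrow> u \<in> a k \<Longrightarrow> 2 * real l \<le> euclidean_norm u \<Longrightarrow> n0 \<le> l \<Longrightarrow>
       z \<in> outer_boundary (a k) \<Longrightarrow> harmonic_measure z (lattice_closure (a k)) \<le> c * sqrt (ln (real l)) / real l"
    using history_harmonic_bound by blast
  have hist: "finite (a k)" "a k \<noteq> {}" "card (a k) \<le> Suc k" if "a \<in> histories k" for a k
    using histories_props(2)[OF that, of k] by auto
  show ?thesis
  proof (intro conjI impI)
    assume \<eta>: "\<eta> < 1"
    \<comment> \<open>Chosen such that \<open>96 e m q \<le> l\<close> follows from \<open>K ^ 2 * m * sqrt (ln m) \<le> l ^ 2\<close>.\<close>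
    define K where "K = 1 + 96 * exp 1 * c"
    define l where "l m = nat \<lceil>K * (real m powr (1/2) * ln (real m) powr (1/4))\<rceil>" for m :: nat
    define q where "q m = c * sqrt (ln (real (l m))) / real (l m)" for m
    have K: "K \<ge> 1" using c by (simp add: K_def)
    have half: "1/2 \<le> (1/2 :: real)" "1/2 < (1 :: real)" "(1/4 :: real) \<ge> 0" by simp_all
    note sc = growth_scale[OF half K, folded l_def]
    have big: "\<forall>\<^sub>F m in sequentially. max n0 2 \<le> l m"
      using sc(5) unfolding filterlim_at_top by blast
    have rate: "\<forall>\<^sub>F m in sequentially. \<forall>k a u y. k < m \<longrightarrow> a \<in> histories k \<longrightarrow> u \<in> a k \<longrightarrow>
       2 * real (l m) \<le> euclidean_norm u \<longrightarrow> y \<in> outer_boundary (a k) \<longrightarrow> dbm_rate \<eta> (a k) y \<le> q m"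
      using big
    proof eventually_elim
      case (elim m)
      show ?case
      proof (intro allI impI)
        fix k a u y
        assume a: "k < m" "a \<in> histories k" "u \<in> a k" "2 * real (l m) \<le> euclidean_norm u" "y \<in> outer_boundary (a k)"
        have "q m > 0" using elim c by (auto simp: q_def intro!: divide_pos_pos mult_pos_pos)
        then show "dbm_rate \<eta> (a k) y \<le> q m"
          using hm[OF a(2-4)] elim a(5)
          by (intro dbm_rate_le_small[OF hist(1,2)[OF a(2)] assms \<eta>]) (auto simp: q_def)
      qed
    qed
    have "\<forall>\<^sub>F m in sequentially. q m \<ge> 0 \<and> 96 * exp 1 * real m * q m \<le> real (l m)"
      using big sc(2,3)
    proof eventually_elim
      case (elim m)
      have m: "l m \<ge> 2" "l m \<le> m" using elim by auto
      define L where "L = ln (real m)"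
      have L: "L > 0" "ln (real (l m)) \<le> L" using m by (auto simp: L_def)
      have lp: "real (l m) > 0" using m by simp
      have q0: "q m \<ge> 0" using m c by (simp add: q_def)
      have "(K * (real m powr (1/2) * L powr (1/4)))^2 \<le> real (l m)^2"
        using elim K by (intro power_mono) (auto simp: L_def)
      moreover have "(K * (real m powr (1/2) * L powr (1/4)))^2 = K^2 * (real m * sqrt L)"
      proof -
        have "(real m powr (1/2))^2 = real m" by (simp add: powr_half_sqrt)
        moreover have "(L powr (1/4))^2 = sqrt L"
          using L by (simp add: powr_half_sqrt[symmetric] powr_powr flip: powr_realpow)
        ultimately show ?thesis by (simp add: power_mult_distrib)
      qed
      ultimately have 1: "K^2 * (real m * sqrt L) \<le> real (l m)^2" by simp
      have "96 * exp 1 * c * (real m * sqrt L) \<le> K^2 * (real m * sqrt L)"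
      proof (rule mult_right_mono)
        have "96 * exp 1 * c \<le> K" by (simp add: K_def)
        also have "K \<le> K^2" using K by (intro self_le_power) auto
        finally show "96 * exp 1 * c \<le> K^2" .
      qed (use L in simp)
      then have 2: "96 * exp 1 * c * (real m * sqrt L) \<le> real (l m)^2" using 1 by simp
      have "96 * exp 1 * real m * q m = 96 * exp 1 * c * (real m * sqrt (ln (real (l m)))) / real (l m)"
        by (simp add: q_def)
      also have "\<dots> \<le> 96 * exp 1 * c * (real m * sqrt L) / real (l m)"
        using c L lp by (intro divide_right_mono mult_left_mono) auto
      also have "\<dots> \<le> real (l m)^2 / real (l m)" using 2 lp by (intro divide_right_mono) auto
      also have "\<dots> = real (l m)" using lp by (simp add: power2_eq_square)
      finally show ?case using q0 by simp
    qed
    note g = scaled_growth[OF half K assms, of q, folded l_def, OF rate this]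
    show "\<exists>C>0. \<forall>(M :: 'w measure) (A :: nat \<Rightarrow> 'w \<Rightarrow> (int ^ 3) set). is_dbm \<eta> M A \<longrightarrow>
        (AE w in M. \<exists>N. \<forall>n>N. radius (A n w) < C * real n powr (1 / 2) * ln (real n) powr (1 / 4))"
      using K g by (intro exI[of _ "4 * K"]) auto
  next
    assume \<eta>: "\<eta> \<ge> 1"
    define \<alpha> \<beta> where "\<alpha> = \<eta> / (1 + \<eta>)" and "\<beta> = \<eta> / (2 * (\<eta> + 1))"
    have ab: "1/2 \<le> \<alpha>" "\<alpha> < 1" "\<beta> \<ge> 0" "(1 + \<eta>) * \<alpha> = \<eta>" "(1 + \<eta>) * \<beta> = \<eta> / 2"
      using \<eta> by (auto simp: \<alpha>_def \<beta>_def field_simps)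
    \<comment> \<open>Chosen such that \<open>96 e m q \<le> l\<close> follows from \<open>D * m powr \<eta> * ln m powr (\<eta> / 2) \<le> l powr (1 + \<eta>)\<close>.\<close>
    define D where "D = 192 * exp 1 * 12 powr (\<eta> - 1) * c powr \<eta>"
    define K where "K = 1 + D"
    define l where "l m = nat \<lceil>K * (real m powr \<alpha> * ln (real m) powr \<beta>)\<rceil>" for m :: nat
    define \<Omega> where "\<Omega> m = c * sqrt (ln (real (l m))) / real (l m)" for m
    define q where "q m = 2 * (12 * real m) powr (\<eta> - 1) * \<Omega> m powr \<eta>" for m
    have D: "D \<ge> 0" by (simp add: D_def)
    then have K: "K \<ge> 1" by (simp add: K_def)
    note sc = growth_scale[OF ab(1-3) K, folded l_def]
    have big: "\<forall>\<^sub>F m in sequentially. max n0 2 \<le> l m"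
      using sc(5) unfolding filterlim_at_top by blast
    have rate: "\<forall>\<^sub>F m in sequentially. \<forall>k a u y. k < m \<longrightarrow> a \<in> histories k \<longrightarrow> u \<in> a k \<longrightarrow>
       2 * real (l m) \<le> euclidean_norm u \<longrightarrow> y \<in> outer_boundary (a k) \<longrightarrow> dbm_rate \<eta> (a k) y \<le> q m"
      using big
    proof eventually_elim
      case (elim m)
      show ?case
      proof (intro allI impI)
        fix k a u y
        assume a: "k < m" "a \<in> histories k" "u \<in> a k" "2 * real (l m) \<le> euclidean_norm u" "y \<in> outer_boundary (a k)"
        have "\<Omega> m > 0" using elim c by (auto simp: \<Omega>_def intro!: divide_pos_pos mult_pos_pos)
        moreover have "real (card (outer_boundary (a k))) \<le> 6 * real m"
        proof -
          have "card (outer_boundary (a k)) \<le> 6 * m"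
            using card_outer_boundary[OF hist(1)[OF a(2)]] hist(3)[OF a(2)] a(1) by simp
          then have "real (card (outer_boundary (a k))) \<le> real (6 * m)" by (simp only: of_nat_le_iff)
          then show ?thesis by simp
        qed
        moreover have "6 * real m > 0" using a(1) by simp
        ultimately have "dbm_rate \<eta> (a k) y \<le> 2 * (2 * (6 * real m)) powr (\<eta> - 1) * \<Omega> m powr \<eta>"
          using hm[OF a(2-4)] elim a(5)
          by (intro dbm_rate_le_large[OF hist(1,2)[OF a(2)] \<eta>]) (auto simp: \<Omega>_def)
        then show "dbm_rate \<eta> (a k) y \<le> q m" by (simp add: q_def)
      qed
    qed
    have "\<forall>\<^sub>F m in sequentially. q m \<ge> 0 \<and> 96 * exp 1 * real m * q m \<le> real (l m)"
      using big sc(2,3)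
    proof eventually_elim
      case (elim m)
      have m: "l m \<ge> 2" "l m \<le> m" using elim by auto
      define L where "L = ln (real m)"
      have L: "L > 0" "ln (real (l m)) \<le> L" using m by (auto simp: L_def)
      have lp: "real (l m) > 0" and mp: "real m > 0" using m by simp_all
      have q0: "q m \<ge> 0" by (simp add: q_def)
      have "(K * (real m powr \<alpha> * L powr \<beta>)) powr (1 + \<eta>) \<le> real (l m) powr (1 + \<eta>)"
        using elim K \<eta> by (intro powr_mono2) (auto simp: L_def)
      moreover have "(K * (real m powr \<alpha> * L powr \<beta>)) powr (1 + \<eta>) = K powr (1 + \<eta>) * (real m powr \<eta> * L powr (\<eta> / 2))"
      proof -
        have e: "\<alpha> * (1 + \<eta>) = \<eta>" "\<beta> * (1 + \<eta>) = \<eta> / 2" using ab(4,5) by (simp_all only: mult.commute)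
        show ?thesis using K by (simp add: powr_mult powr_powr e)
      qed
      ultimately have 1: "K powr (1 + \<eta>) * (real m powr \<eta> * L powr (\<eta> / 2)) \<le> real (l m) powr (1 + \<eta>)" by simp
      have "D \<le> K powr (1 + \<eta>)"
      proof -
        have "D \<le> K powr 1" using K by (simp add: K_def)
        also have "\<dots> \<le> K powr (1 + \<eta>)" using K \<eta> by (intro powr_mono) auto
        finally show ?thesis .
      qed
      then have "D * (real m powr \<eta> * L powr (\<eta> / 2)) \<le> K powr (1 + \<eta>) * (real m powr \<eta> * L powr (\<eta> / 2))"
        by (intro mult_right_mono) auto
      then have 2: "D * (real m powr \<eta> * L powr (\<eta> / 2)) \<le> real (l m) powr (1 + \<eta>)" using 1 by simp
      have \<Omega>: "\<Omega> m powr \<eta> \<le> c powr \<eta> * L powr (\<eta> / 2) / real (l m) powr \<eta>"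
      proof -
        have "\<Omega> m \<le> c * sqrt L / real (l m)"
          unfolding \<Omega>_def using c L lp by (intro divide_right_mono mult_left_mono) auto
        then have "\<Omega> m powr \<eta> \<le> (c * sqrt L / real (l m)) powr \<eta>"
          using \<eta> m c by (intro powr_mono2) (auto simp: \<Omega>_def)
        also have "\<dots> = c powr \<eta> * L powr (\<eta> / 2) / real (l m) powr \<eta>"
          using c L lp by (simp add: powr_divide powr_mult powr_half_sqrt[symmetric] powr_powr)
        finally show ?thesis .
      qed
      have "96 * exp 1 * real m * q m = 192 * exp 1 * 12 powr (\<eta> - 1) * (real m * real m powr (\<eta> - 1)) * \<Omega> m powr \<eta>"
        by (simp add: q_def powr_mult)
      also have "real m * real m powr (\<eta> - 1) = real m powr \<eta>" using mp by (rule powr_split[symmetric])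
      also have "192 * exp 1 * 12 powr (\<eta> - 1) * real m powr \<eta> * \<Omega> m powr \<eta>
        \<le> 192 * exp 1 * 12 powr (\<eta> - 1) * real m powr \<eta> * (c powr \<eta> * L powr (\<eta> / 2) / real (l m) powr \<eta>)"
        using \<Omega> by (intro mult_left_mono) auto
      also have "\<dots> = D * (real m powr \<eta> * L powr (\<eta> / 2)) / real (l m) powr \<eta>" by (simp add: D_def)
      also have "\<dots> \<le> real (l m) powr (1 + \<eta>) / real (l m) powr \<eta>" using 2 by (intro divide_right_mono) auto
      also have "\<dots> = real (l m)" using lp by (simp add: powr_add)
      finally show ?case using q0 by simp
    qed
    note g = scaled_growth[OF ab(1-3) K assms, of q, folded l_def, OF rate this]
    show "\<exists>C>0. \<forall>(M :: 'w measure) (A :: nat \<Rightarrow> 'w \<Rightarrow> (int ^ 3) set). is_dbm \<eta> M A \<longrightarrow>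
        (AE w in M. \<exists>N. \<forall>n>N. radius (A n w) < C * real n powr (\<eta> / (1 + \<eta>)) * ln (real n) powr (\<eta> / (2 * (\<eta> + 1))))"
      using K g unfolding \<alpha>_def \<beta>_def by (intro exI[of _ "4 * K"]) auto
  qed
qed

end
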